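(* Let $a,c\in\mathbb R$ with $0<a<c$ and $c^2>\frac{4a(a+1)^3}{27}$, let $g_{11},g_{21},g_{22}\in\mathbb R$, and consider on mean-zero $2\pi$-periodic pairs $(u,v)$ the system $$\partial_tu=\partial_xv-a\,\partial_x^4u+g_{11}(u_xv+uv_x),\qquad \partial_tv=c^2\partial_xu-\delta\,\partial_x^2v-\partial_x^4v+g_{21}uu_x+g_{22}vv_x,$$ with bifurcation parameter $\delta$, $\delta_c=a+1$. Let $\zeta,\xi$ be its $O(2)$-Hopf normal form coefficients at $\delta=\delta_c$ (critical wavenumber $m_c=1$; see context, with the eigenvector normalization given there). With $D_\zeta=a^2(5a-16)^2+4(a+1)^2(c^2-a^2)$, $D_\xi=c^2-16a(a-3)$ and $\mathbf g=(g_{11},g_{21},g_{22})^{\top}$, $$\operatorname{Re}\zeta=\frac{\mathbf g^{\top}N\mathbf g}{12c^2D_\zeta},\qquad \operatorname{Re}\xi=-\frac{a(g_{11}-g_{22})\bigl[c^2(g_{11}-4g_{22})+4g_{21}\bigr]}{c^2D_\xi},$$ where $N=N^\top$ is the $3\times3$ matrix with $$\begin{aligned}N_{11}&=-2c^2(9a^3-72a^2+4ac^2+108a+4c^2),& N_{22}&=-2(a+1),\\ N_{33}&=c^2(63a^3-126a^2-2ac^2-2c^2),& N_{12}&=\tfrac12(a^3+22a^2-8ac^2-168a-8c^2),\\ N_{13}&=\tfrac12c^2(63a^3-126a^2-8ac^2-8c^2),& N_{23}&=\tfrac12(35a^3-154a^2-4ac^2-4c^2).\end{aligned}$$ Moreover,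 all six scenarios of the classification of the $O(2)$-Hopf bifurcation are realized in this family: already for $a=\tfrac12$, $c=1$, $g_{21}=1$, for each of the following six regions there exist $(g_{11},g_{22})\in\mathbb R^2$ for which $(\zeta_R,\xi_R)=(\operatorname{Re}\zeta,\operatorname{Re}\xi)$ lies in it: I: $\zeta_R+\xi_R>0,\ \zeta_R-\xi_R>0$; II: $\zeta_R>0,\ \zeta_R-\xi_R<0$; III: $\zeta_R<0,\ \zeta_R+\xi_R>0$; IV: $\zeta_R+\xi_R<0,\ \zeta_R-\xi_R<0$; V: $\zeta_R<0,\ \zeta_R-\xi_R>0$; VI: $\zeta_R>0,\ \zeta_R+\xi_R<0$.
   Context: The linear part of the system on the Fourier mode $e^{imx}$, $m\in\mathbb Z\setminus\{0\}$, is $M_m(\delta)=\begin{pmatrix}-am^4&im\\ ic^2m&\delta m^2-m^4\end{pmatrix}$. At $\delta=\delta_c$, $M_1$ has eigenvalues $\beta_{1,1}=i\omega$, $\beta_{1,2}=-i\omega$ with $\omega=\sqrt{c^2-a^2}$, all other modes $m\neq0,\pm1$ have eigenvalues in the open left half plane bounded away from the imaginary axis, and there is a four-dimensional local center manifold for $\delta$ near $\delta_c$. The critical eigenvectors are normalized as $$\mathbf q_{1,n}=\begin{bmatrix}\dfrac{i}{a+\beta_{1,n}}\\1\end{bmatrix},\qquad n=1,2.$$ Writing the projection of a real solution onto the critical modes as $A e^{ix}\mathbf q_{1,1}+Be^{ix}\mathbf q_{1,2}+\mathrm{c.c.}$, the flow on the center manifold is brought, by a near-identity change of coordinates $Z_1=A+O(|(A,B)|^3)$,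 $Z_2=B+O(|(A,B)|^3)$ (equivariant under the $O(2)$-action generated by $(u,v)(x)\mapsto(u,v)(x+h)$ and $(u,v)(x)\mapsto(u(-x),-v(-x))$), into the normal form $$\dot Z_1=\beta_{1,1}(\delta)Z_1+Z_1(\zeta|Z_1|^2+\xi|Z_2|^2)+O(|\delta-\delta_c||Z|^3+|Z|^5),\quad \dot Z_2=\beta_{1,2}(\delta)Z_2+Z_2(\bar\xi|Z_1|^2+\bar\zeta|Z_2|^2)+O(|\delta-\delta_c||Z|^3+|Z|^5);$$ this defines $\zeta$ and $\xi$ (evaluated at $\delta_c$). *)

theory Defs
  imports "HOL-Analysis.Analysis"
begin

section \<open>Functions of class \<open>C\<^sup>k\<close>\<close>

text \<open>On an open subset of a finite-dimensional space, being \<open>C\<^sup>k\<^sup>+\<^sup>1\<close> means being differentiable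
  with all directional derivatives \<open>C\<^sup>k\<close>; in this form the recursion does not change types.\<close>

primrec C_k_on :: "nat \<Rightarrow> ('a::euclidean_space \<Rightarrow> 'b::real_normed_vector) \<Rightarrow> 'a set \<Rightarrow> bool" where
  "C_k_on 0 f S \<longleftrightarrow> continuous_on S f"
| "C_k_on (Suc k) f S \<longleftrightarrow>
     (\<forall>x\<in>S. f differentiable (at x)) \<and>
     (\<forall>v. C_k_on k (\<lambda>x. frechet_derivative f (at x) v) S)"


section \<open>The linear part\<close>

text \<open>The matrix \<open>M\<^sub>m(\<delta>)\<close> by which the linear part acts on the Fourier mode \<open>e\<^sup>i\<^sup>m\<^sup>x\<close>.\<close>

definition linear_symbol :: "real \<Rightarrow> real \<Rightarrow> real \<Rightarrow> int \<Rightarrow> complex^2^2" where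
  "linear_symbol a c \<delta> m =
     vector [vector [- of_real a * of_int m ^ 4, \<i> * of_int m],
             vector [\<i> * of_real (c\<^sup>2) * of_int m, of_real \<delta> * of_int m ^ 2 - of_int m ^ 4]]"

definition \<delta>_crit :: "real \<Rightarrow> real" where
  "\<delta>_crit a = a + 1"

text \<open>The eigenvalues \<open>\<beta>\<^bsub>1,1\<^esub>(\<delta>)\<close>, \<open>\<beta>\<^bsub>1,2\<^esub>(\<delta>)\<close> of \<open>M\<^sub>1(\<delta>)\<close>: the matrix has trace \<open>\<delta> - 1 - a\<close> and
  determinant \<open>c\<^sup>2 - a (\<delta> - 1)\<close>.  These are complex conjugate simple eigenvalues as long as the
  radicand is positive, in particular for \<open>\<delta>\<close> near \<open>a + 1\<close> if \<open>0 < a < c\<close>.\<close>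

definition beta1 :: "real \<Rightarrow> real \<Rightarrow> real \<Rightarrow> complex" where
  "beta1 a c \<delta> = Complex ((\<delta> - 1 - a) / 2) (sqrt (c\<^sup>2 - ((\<delta> - 1 + a) / 2)\<^sup>2))"

definition beta2 :: "real \<Rightarrow> real \<Rightarrow> real \<Rightarrow> complex" where
  "beta2 a c \<delta> = Complex ((\<delta> - 1 - a) / 2) (- sqrt (c\<^sup>2 - ((\<delta> - 1 + a) / 2)\<^sup>2))"

definition eigvec :: "real \<Rightarrow> complex \<Rightarrow> complex^2" where
  "eigvec a \<beta> = vector [\<i> / (of_real a + \<beta>), 1]"

lemma beta_crit:
  "beta1 a c (\<delta>_crit a) = \<i> * of_real (sqrt (c\<^sup>2 - a\<^sup>2))"
  "beta2 a c (\<delta>_crit a) = - \<i> * of_real (sqrt (c\<^sup>2 - a\<^sup>2))"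
  by (simp_all add: beta1_def beta2_def \<delta>_crit_def complex_eq_iff)

lemma eigvec_eigenvector:
  assumes "\<bar>(\<delta> - 1 + a) / 2\<bar> < \<bar>c\<bar>" and "\<beta> = beta1 a c \<delta> \<or> \<beta> = beta2 a c \<delta>"
  shows "linear_symbol a c \<delta> 1 *v eigvec a \<beta> = \<beta> *s eigvec a \<beta>"
proof -
  define r where "r = sqrt (c\<^sup>2 - ((\<delta> - 1 + a) / 2)\<^sup>2)"
  have pos: "0 < c\<^sup>2 - ((\<delta> - 1 + a) / 2)\<^sup>2"
    using assms(1) abs_le_square_iff[of c "(\<delta> - 1 + a) / 2"] by linarith
  then have r: "r\<^sup>2 = c\<^sup>2 - ((\<delta> - 1 + a) / 2)\<^sup>2" "r \<noteq> 0"
    unfolding r_def by (simp_all)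
  have b: "\<beta> = Complex ((\<delta> - 1 - a) / 2) r \<or> \<beta> = Complex ((\<delta> - 1 - a) / 2) (- r)"
    using assms(2) by (simp add: beta1_def beta2_def r_def)
  have ne: "of_real a + \<beta> \<noteq> 0"
    using b r(2) by (auto simp: complex_eq_iff)
  have "(\<beta> + of_real a) * (\<beta> + 1 - of_real \<delta>) + of_real (c\<^sup>2) = 0"
    using b r(1) by (auto simp: complex_eq_iff power2_eq_square field_simps)
  then have char: "- of_real (c\<^sup>2) + (of_real a + \<beta>) * (of_real \<delta> - 1) = \<beta> * (of_real a + \<beta>)"
    by (simp add: algebra_simps)
  define p where "p = \<i> / (of_real a + \<beta>)"
  have p: "(of_real a + \<beta>) * p = \<i>"
    using ne by (simp add: p_def)
  then have row1: "\<i> - of_real a * p = \<beta> * p"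
    by (simp add: algebra_simps)
  have "(of_real a + \<beta>) * (\<i> * of_real (c\<^sup>2) * p + (of_real \<delta> - 1))
      = \<i> * of_real (c\<^sup>2) * ((of_real a + \<beta>) * p) + (of_real a + \<beta>) * (of_real \<delta> - 1)"
    by (simp only: distrib_left mult.left_commute mult.assoc)
  also have "\<dots> = (of_real a + \<beta>) * \<beta>"
    unfolding p using char by (simp add: mult.commute)
  finally have row2: "\<i> * of_real (c\<^sup>2) * p + (of_real \<delta> - 1) = \<beta>"
    using ne by simp
  show ?thesis
    using row1 row2
    by (simp add: vec_eq_iff forall_2 matrix_vector_mult_def sum_2 linear_symbol_def eigvec_def
        p_def [symmetric])
qed


section \<open>The system of partial differential equations\<close>

definition mean_zero_periodic :: "(real \<Rightarrow> real \<times> real) \<Rightarrow> bool" where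
  "mean_zero_periodic w \<longleftrightarrow>
     continuous_on UNIV w \<and> (\<forall>x. w (x + 2 * pi) = w x) \<and> integral {0..2 * pi} w = 0"

text \<open>Classical solutions on an open time interval \<open>I\<close>; \<open>u t x\<close> and \<open>v t x\<close> have the time as
  first argument.\<close>

definition classical_solution ::
  "real \<Rightarrow> real \<Rightarrow> real \<Rightarrow> real \<Rightarrow> real \<Rightarrow> real \<Rightarrow> real set
     \<Rightarrow> (real \<Rightarrow> real \<Rightarrow> real) \<Rightarrow> (real \<Rightarrow> real \<Rightarrow> real) \<Rightarrow> bool" where
  "classical_solution a c g11 g21 g22 \<delta> I u v \<longleftrightarrow>
     (\<forall>t\<in>I. mean_zero_periodic (\<lambda>x. (u t x, v t x))) \<and>
     (\<forall>w\<in>{u, v}.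
        (\<forall>k<4. \<forall>t\<in>I. \<forall>x. (deriv ^^ k) (w t) differentiable (at x)) \<and>
        (\<forall>k\<le>4. continuous_on (I \<times> UNIV) (\<lambda>(t, x). (deriv ^^ k) (w t) x))) \<and>
     (\<forall>t\<in>I. \<forall>x.
        ((\<lambda>s. u s x) has_real_derivative
           deriv (v t) x - a * (deriv ^^ 4) (u t) x
           + g11 * (deriv (u t) x * v t x + u t x * deriv (v t) x)) (at t) \<and>
        ((\<lambda>s. v s x) has_real_derivative
           c\<^sup>2 * deriv (u t) x - \<delta> * (deriv ^^ 2) (v t) x - (deriv ^^ 4) (v t) x
           + g21 * u t x * deriv (u t) x + g22 * v t x * deriv (v t) x) (at t))"


section \<open>Critical modes and symmetry\<close>

text \<open>\<open>A e\<^sup>i\<^sup>x q\<^bsub>1,1\<^esub> + B e\<^sup>i\<^sup>x q\<^bsub>1,2\<^esub> + c.c.\<close>\<close>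

definition critical_part :: "real \<Rightarrow> real \<Rightarrow> real \<Rightarrow> complex \<times> complex \<Rightarrow> real \<Rightarrow> real \<times> real" where
  "critical_part a c \<delta> z x =
     (let y = (cis x * fst z) *s eigvec a (beta1 a c \<delta>) + (cis x * snd z) *s eigvec a (beta2 a c \<delta>)
      in (Re (y $ 1 + cnj (y $ 1)), Re (y $ 2 + cnj (y $ 2))))"

text \<open>Vanishing Fourier coefficients at \<open>m = 1\<close>; for real functions this also covers \<open>m = -1\<close>.\<close>

definition no_critical_part :: "(real \<Rightarrow> real \<times> real) \<Rightarrow> bool" where
  "no_critical_part w \<longleftrightarrow>
     integral {0..2 * pi} (\<lambda>x. cis (- x) * of_real (fst (w x))) = 0 \<and>
     integral {0..2 * pi} (\<lambda>x. cis (- x) * of_real (snd (w x))) = 0"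

definition translate :: "real \<Rightarrow> (real \<Rightarrow> real \<times> real) \<Rightarrow> real \<Rightarrow> real \<times> real" where
  "translate s w x = w (x + s)"

definition reflect :: "(real \<Rightarrow> real \<times> real) \<Rightarrow> real \<Rightarrow> real \<times> real" where
  "reflect w x = (fst (w (- x)), - snd (w (- x)))"

text \<open>The action of \<open>O(2)\<close> induced on the amplitudes \<open>(A, B)\<close>; see \<open>critical_part_equivariant\<close>.\<close>

definition rot_amp :: "real \<Rightarrow> complex \<times> complex \<Rightarrow> complex \<times> complex" where
  "rot_amp s z = (cis s * fst z, cis s * snd z)"

definition refl_amp :: "complex \<times> complex \<Rightarrow> complex \<times> complex" where
  "refl_amp z = (- cnj (snd z), - cnj (fst z))"

lemma critical_part_equivariant:
  "critical_part a c \<delta> (rot_amp s z) = translate s (critical_part a c \<delta> z)"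
  "critical_part a c \<delta> (refl_amp z) = reflect (critical_part a c \<delta> z)"
proof -
  show "critical_part a c \<delta> (rot_amp s z) = translate s (critical_part a c \<delta> z)"
    by (simp add: fun_eq_iff critical_part_def rot_amp_def translate_def Let_def
        cis_mult [symmetric] mult.assoc)
  define p1 p2 where "p1 = \<i> / (of_real a + beta1 a c \<delta>)" and "p2 = \<i> / (of_real a + beta2 a c \<delta>)"
  have p: "p2 = - cnj p1"
    by (simp add: p1_def p2_def beta1_def beta2_def complex_cnj cnj_def complex_eq_iff
        Re_divide Im_divide)
  show "critical_part a c \<delta> (refl_amp z) = reflect (critical_part a c \<delta> z)"
    by (simp add: fun_eq_iff critical_part_def refl_amp_def reflect_def Let_def eigvec_def
        p1_def [symmetric] p2_def [symmetric] p algebra_simps)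
qed


section \<open>Center manifold and normal form\<close>

text \<open>A center manifold is a graph over the critical modes: the phase space is represented by the
  bounded continuous functions with the supremum norm, and the point with amplitudes
  \<open>z = (A, B)\<close> at the parameter \<open>\<delta>\<close> is the sum of the critical part and \<open>h (\<delta>, z)\<close>.\<close>

definition manifold_point ::
  "real \<Rightarrow> real \<Rightarrow> (real \<times> complex \<times> complex \<Rightarrow> (real \<Rightarrow>\<^sub>C (real \<times> real)))
     \<Rightarrow> real \<Rightarrow> complex \<times> complex \<Rightarrow> real \<Rightarrow> real \<times> real" where
  "manifold_point a c h \<delta> z x = critical_part a c \<delta> z x + apply_bcontfun (h (\<delta>, z)) x"

definition solution_on_manifold ::
  "real \<Rightarrow> real \<Rightarrow> real \<Rightarrow> real \<Rightarrow> real \<Rightarrow> real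
     \<Rightarrow> (real \<times> complex \<times> complex \<Rightarrow> (real \<Rightarrow>\<^sub>C (real \<times> real)))
     \<Rightarrow> real \<Rightarrow> real set \<Rightarrow> (real \<Rightarrow> complex \<times> complex) \<Rightarrow> bool" where
  "solution_on_manifold a c g11 g21 g22 \<rho> h \<delta> I z \<longleftrightarrow>
     (\<forall>t\<in>I. z t \<in> ball 0 \<rho>) \<and>
     classical_solution a c g11 g21 g22 \<delta> I
       (\<lambda>t x. fst (manifold_point a c h \<delta> (z t) x))
       (\<lambda>t x. snd (manifold_point a c h \<delta> (z t) x))"

text \<open>The modes \<open>m = 1, -1\<close> are invariant under the linear part for every \<open>\<delta>\<close>, so that the graph can be
  taken over the same four-dimensional space for all \<open>\<delta>\<close> near \<open>\<delta>\<^sub>c\<close>.  The fourth conjunct is the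
  tangency to this space, the sixth the local invariance, and the last two express that the
  manifold is mapped to itself by the \<open>O(2)\<close>-action.\<close>

definition local_center_manifold ::
  "real \<Rightarrow> real \<Rightarrow> real \<Rightarrow> real \<Rightarrow> real \<Rightarrow> real
     \<Rightarrow> (real \<times> complex \<times> complex \<Rightarrow> (real \<Rightarrow>\<^sub>C (real \<times> real))) \<Rightarrow> bool" where
  "local_center_manifold a c g11 g21 g22 \<rho> h \<longleftrightarrow>
     0 < \<rho> \<and>
     C_k_on 5 h (ball (\<delta>_crit a) \<rho> \<times> ball 0 \<rho>) \<and>
     (\<forall>\<delta>\<in>ball (\<delta>_crit a) \<rho>. h (\<delta>, 0) = 0) \<and>
     (h has_derivative (\<lambda>_. 0)) (at (\<delta>_crit a, 0)) \<and>
     (\<forall>\<delta>\<in>ball (\<delta>_crit a) \<rho>. \<forall>z\<in>ball 0 \<rho>.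
        mean_zero_periodic (apply_bcontfun (h (\<delta>, z))) \<and>
        no_critical_part (apply_bcontfun (h (\<delta>, z)))) \<and>
     (\<forall>\<delta>\<in>ball (\<delta>_crit a) \<rho>. \<forall>z0\<in>ball 0 \<rho>.
        \<exists>\<tau>>0. \<exists>z. z 0 = z0 \<and> solution_on_manifold a c g11 g21 g22 \<rho> h \<delta> {-\<tau><..<\<tau>} z) \<and>
     (\<forall>\<delta>\<in>ball (\<delta>_crit a) \<rho>. \<forall>z\<in>ball 0 \<rho>. \<forall>s.
        apply_bcontfun (h (\<delta>, rot_amp s z)) = translate s (apply_bcontfun (h (\<delta>, z)))) \<and>
     (\<forall>\<delta>\<in>ball (\<delta>_crit a) \<rho>. \<forall>z\<in>ball 0 \<rho>.
        apply_bcontfun (h (\<delta>, refl_amp z)) = reflect (apply_bcontfun (h (\<delta>, z))))"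

text \<open>\<open>\<theta> (\<delta>, (A, B)) = (Z\<^sub>1, Z\<^sub>2)\<close> is the change of coordinates; the last conjunct is the normal form
  of the flow on the center manifold, \<open>R\<close> being the order \<open>|\<delta> - \<delta>\<^sub>c| |Z|\<^sup>3 + |Z|\<^sup>5\<close> of the remainder.\<close>

definition O2_Hopf_normal_form ::
  "real \<Rightarrow> real \<Rightarrow> real \<Rightarrow> real \<Rightarrow> real \<Rightarrow> real
     \<Rightarrow> (real \<times> complex \<times> complex \<Rightarrow> (real \<Rightarrow>\<^sub>C (real \<times> real)))
     \<Rightarrow> (real \<times> complex \<times> complex \<Rightarrow> complex \<times> complex) \<Rightarrow> complex \<Rightarrow> complex \<Rightarrow> bool" where
  "O2_Hopf_normal_form a c g11 g21 g22 \<rho> h \<theta> \<zeta> \<xi> \<longleftrightarrow>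
     C_k_on 5 \<theta> (ball (\<delta>_crit a) \<rho> \<times> ball 0 \<rho>) \<and>
     (\<forall>\<delta>\<in>ball (\<delta>_crit a) \<rho>. \<forall>z\<in>ball 0 \<rho>.
        (\<forall>s. \<theta> (\<delta>, rot_amp s z) = rot_amp s (\<theta> (\<delta>, z))) \<and>
        \<theta> (\<delta>, refl_amp z) = refl_amp (\<theta> (\<delta>, z))) \<and>
     (\<exists>K. \<forall>\<delta>\<in>ball (\<delta>_crit a) \<rho>. \<forall>z\<in>ball 0 \<rho>. norm (\<theta> (\<delta>, z) - z) \<le> K * norm z ^ 3) \<and>
     (\<exists>K. \<forall>\<delta>\<in>ball (\<delta>_crit a) \<rho>. \<forall>r s z. solution_on_manifold a c g11 g21 g22 \<rho> h \<delta> {r<..<s} z \<longrightarrow>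
        (\<forall>t\<in>{r<..<s}. \<exists>d1 d2.
           ((\<lambda>\<tau>. \<theta> (\<delta>, z \<tau>)) has_vector_derivative (d1, d2)) (at t) \<and>
           (let Z1 = fst (\<theta> (\<delta>, z t)); Z2 = snd (\<theta> (\<delta>, z t));
                R = \<bar>\<delta> - \<delta>_crit a\<bar> * norm (Z1, Z2) ^ 3 + norm (Z1, Z2) ^ 5
            in norm (d1 - (beta1 a c \<delta> * Z1
                   + Z1 * (\<zeta> * of_real ((cmod Z1)\<^sup>2) + \<xi> * of_real ((cmod Z2)\<^sup>2)))) \<le> K * R \<and>
               norm (d2 - (beta2 a c \<delta> * Z2
                   + Z2 * (cnj \<xi> * of_real ((cmod Z1)\<^sup>2) + cnj \<zeta> * of_real ((cmod Z2)\<^sup>2)))) \<le> K * R)))"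

definition O2_Hopf_coefficients ::
  "real \<Rightarrow> real \<Rightarrow> real \<Rightarrow> real \<Rightarrow> real \<Rightarrow> complex \<Rightarrow> complex \<Rightarrow> bool" where
  "O2_Hopf_coefficients a c g11 g21 g22 \<zeta> \<xi> \<longleftrightarrow>
     (\<exists>\<rho> h \<theta>. local_center_manifold a c g11 g21 g22 \<rho> h \<and>
              O2_Hopf_normal_form a c g11 g21 g22 \<rho> h \<theta> \<zeta> \<xi>)"


section \<open>The data of the explicit formulas\<close>

definition D_zeta :: "real \<Rightarrow> real \<Rightarrow> real" where
  "D_zeta a c = a\<^sup>2 * (5 * a - 16)\<^sup>2 + 4 * (a + 1)\<^sup>2 * (c\<^sup>2 - a\<^sup>2)"

definition D_xi :: "real \<Rightarrow> real \<Rightarrow> real" where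
  "D_xi a c = c\<^sup>2 - 16 * a * (a - 3)"

definition N_mat :: "real \<Rightarrow> real \<Rightarrow> real^3^3" where
  "N_mat a c =
     (let N11 = - 2 * c\<^sup>2 * (9 * a^3 - 72 * a\<^sup>2 + 4 * a * c\<^sup>2 + 108 * a + 4 * c\<^sup>2);
          N22 = - 2 * (a + 1);
          N33 = c\<^sup>2 * (63 * a^3 - 126 * a\<^sup>2 - 2 * a * c\<^sup>2 - 2 * c\<^sup>2);
          N12 = 1/2 * (a^3 + 22 * a\<^sup>2 - 8 * a * c\<^sup>2 - 168 * a - 8 * c\<^sup>2);
          N13 = 1/2 * c\<^sup>2 * (63 * a^3 - 126 * a\<^sup>2 - 8 * a * c\<^sup>2 - 8 * c\<^sup>2);
          N23 = 1/2 * (35 * a^3 - 154 * a\<^sup>2 - 4 * a * c\<^sup>2 - 4 * c\<^sup>2)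
      in vector [vector [N11, N12, N13],
                 vector [N12, N22, N23],
                 vector [N13, N23, N33]])"

definition zeta_R_formula :: "real \<Rightarrow> real \<Rightarrow> real \<Rightarrow> real \<Rightarrow> real \<Rightarrow> real" where
  "zeta_R_formula a c g11 g21 g22 =
     (let g = vector [g11, g21, g22] in g \<bullet> (N_mat a c *v g) / (12 * c\<^sup>2 * D_zeta a c))"

definition xi_R_formula :: "real \<Rightarrow> real \<Rightarrow> real \<Rightarrow> real \<Rightarrow> real \<Rightarrow> real" where
  "xi_R_formula a c g11 g21 g22 =
     - (a * (g11 - g22) * (c\<^sup>2 * (g11 - 4 * g22) + 4 * g21) / (c\<^sup>2 * D_xi a c))"

text \<open>The six regions of the \<open>(\<zeta>\<^sub>R, \<xi>\<^sub>R)\<close>-plane, I to VI in this order.\<close>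

definition O2_Hopf_scenarios :: "(real \<times> real) set list" where
  "O2_Hopf_scenarios =
     [{(zR, xR). zR + xR > 0 \<and> zR - xR > 0},
      {(zR, xR). zR > 0 \<and> zR - xR < 0},
      {(zR, xR). zR < 0 \<and> zR + xR > 0},
      {(zR, xR). zR + xR < 0 \<and> zR - xR < 0},
      {(zR, xR). zR < 0 \<and> zR - xR > 0},
      {(zR, xR). zR > 0 \<and> zR + xR < 0}]"

end

theory Submission
  imports Defs
begin

text \<open>The coefficients \<open>\<zeta>\<close>, \<open>\<xi>\<close> are extracted from an arbitrary center manifold \<open>h\<close> and an arbitrary
  change of coordinates \<open>\<theta>\<close> at the single parameter value \<open>\<delta> = \<delta>\<^sub>c\<close>; with \<open>\<Lambda>(A, B) = (i\<omega>A, -i\<omega>B)\<close> and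
  \<open>\<omega>\<^sup>2 = c\<^sup>2 - a\<^sup>2\<close> the linear flow of the amplitudes is periodic, and this replaces every
  Taylor expansion by an average over a period.

  A point of the manifold is a wave of wavenumber one plus a remainder \<open>h(z) = O(|z|\<^sup>2)\<close> without
  the Fourier modes \<open>0, 1, -1\<close>.  In mode one the quadratic terms of the system therefore see only the
  mode-two part \<open>H(z)\<close> of the remainder, up to \<open>O(|z|\<^sup>4)\<close>, and in mode two they see only products of the wave
  with itself, up to \<open>O(|z|\<^sup>3)\<close> (\<open>fourier_coeff_wave_product\<close>).  Projecting the system on these two modes
  (\<open>classical_solution_modes\<close>, \<open>flow_on_manifold\<close>) and applying the chain rule gives
  \<open>DH(z) \<Lambda>z = M\<^sub>2 H(z) + Q(z) + O(|z|\<^sup>3)\<close> with an explicit quadratic \<open>Q\<close> and, for the first component \<open>T\<close> of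
  \<open>\<theta>(z) - z\<close>, \<open>DT(z) \<Lambda>z = i\<omega> T(z) + A (\<zeta> |A|\<^sup>2 + \<xi> |B|\<^sup>2) - P(z) + O(|z|\<^sup>4)\<close>, where \<open>P\<close> is linear in \<open>H\<close>
  (\<open>reduced_equations\<close>).

  Along the periodic orbit \<open>\<epsilon> (e\<^sup>i\<^sup>x, s e\<^sup>-\<^sup>i\<^sup>x)\<close> of the linear flow the left-hand sides are derivatives in the
  phase \<open>x\<close>.  The phase Fourier coefficients of order \<open>n = 0, 2\<close> of the first equation solve
  \<open>(in\<omega> - M\<^sub>2) G\<^sub>n = Q\<^sub>n\<close> in the limit \<open>\<epsilon> \<rightarrow> 0\<close>.  The coefficient of order one of the second equation
  contains \<open>T\<close> on both sides with the same factor \<open>i\<omega>\<close>; it cancels, and \<open>\<zeta> + s\<^sup>2 \<xi>\<close> is left as an explicit expression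
  in \<open>G\<^sub>0\<close> and \<open>G\<^sub>2\<close> (\<open>resonant_coefficients\<close>).  The values \<open>s = 0, 1\<close> give both coefficients.  The determinant for
  \<open>n = 2\<close> has nonzero imaginary part \<open>24\<omega>(a + 1)\<close>, the one for \<open>n = 0\<close> is \<open>4 D\<^sub>\<xi>\<close>, which is positive by
  the lower bound on \<open>c\<^sup>2\<close> (\<open>D_xi_pos\<close>).  What remains is polynomial algebra, and one pair \<open>(g\<^sub>1\<^sub>1, g\<^sub>2\<^sub>2)\<close> for
  each of the six regions.\<close>

section \<open>Fourier coefficients\<close>

definition fourier_coeff :: "int \<Rightarrow> (real \<Rightarrow> complex) \<Rightarrow> complex" where
  "fourier_coeff n f = integral {0..2 * pi} (\<lambda>x. cis (- (of_int n * x)) * f x) / of_real (2 * pi)"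

lemma fourier_integrable:
  assumes "continuous_on {0..2 * pi} f"
  shows "(\<lambda>x. cis (- (of_int n * x)) * f x) integrable_on {0..2 * pi}"
  by (intro integrable_continuous_real continuous_intros assms)

lemma fourier_coeff_add:
  assumes "continuous_on {0..2 * pi} f" "continuous_on {0..2 * pi} g"
  shows "fourier_coeff n (\<lambda>x. f x + g x) = fourier_coeff n f + fourier_coeff n g"
  using integral_add[OF fourier_integrable[OF assms(1)] fourier_integrable[OF assms(2)], of n n]
  by (simp add: fourier_coeff_def algebra_simps add_divide_distrib)

lemma fourier_coeff_cmult: "fourier_coeff n (\<lambda>x. k * f x) = k * fourier_coeff n f"
proof -
  have "integral {0..2 * pi} (\<lambda>x. k * (cis (- (of_int n * x)) * f x))
      = k * integral {0..2 * pi} (\<lambda>x. cis (- (of_int n * x)) * f x)"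
    by (rule integral_mult_right)
  then show ?thesis
    by (simp add: fourier_coeff_def algebra_simps)
qed

lemma fourier_coeff_diff:
  assumes "continuous_on {0..2 * pi} f" "continuous_on {0..2 * pi} g"
  shows "fourier_coeff n (\<lambda>x. f x - g x) = fourier_coeff n f - fourier_coeff n g"
  using fourier_coeff_add[OF assms(1), of "\<lambda>x. (-1) * g x" n] assms(2)
    fourier_coeff_cmult[of n "-1" g] by (simp add: continuous_on_minus)

lemma fourier_coeff_shift:
  "fourier_coeff n (\<lambda>x. cis (of_int m * x) * f x) = fourier_coeff (n - m) f"
proof -
  have "cis (- (of_int n * x)) * (cis (of_int m * x) * f x) = cis (- (of_int (n - m) * x)) * f x" for x
  proof -
    have "cis (- (of_int n * x)) * cis (of_int m * x) = cis (- (of_int (n - m) * x))"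
      by (simp add: cis_mult algebra_simps)
    then show ?thesis by (metis mult.assoc)
  qed
  then show ?thesis unfolding fourier_coeff_def by presburger
qed

lemma cis_has_vector_derivative:
  "((\<lambda>x. cis (k * x)) has_vector_derivative \<i> * of_real k * cis (k * x)) (at x within S)"
proof -
  have "((\<lambda>z. exp (\<i> * of_real k * z)) has_field_derivative
      \<i> * of_real k * exp (\<i> * of_real k * of_real x)) (at (of_real x))"
    by (rule derivative_eq_intros refl | simp)+
  from has_vector_derivative_real_field[OF this] show ?thesis
    by (simp add: cis_conv_exp[abs_def] mult.assoc)
qed

text \<open>Integration by parts with an error term.  The fundamental theorem of calculus for the Henstock--Kurzweil
  integral supplies the integrability of \<open>k'\<close>, so that only the approximation \<open>g\<close> is assumed continuous.
  With \<open>k = 0\<close> it is the trivial bound, with \<open>\<eta> = 0\<close> the rule for derivatives.\<close>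

lemma fourier_coeff_approx:
  assumes k: "\<And>x. x \<in> {0..2 * pi} \<Longrightarrow> (k has_vector_derivative k' x) (at x within {0..2 * pi})"
    and per: "k (2 * pi) = k 0"
    and g: "continuous_on {0..2 * pi} g"
    and close: "\<And>x. x \<in> {0..2 * pi} \<Longrightarrow> norm (k' x - g x) \<le> \<eta>"
  shows "norm (\<i> * of_int n * fourier_coeff n k - fourier_coeff n g) \<le> \<eta>"
proof -
  define e where "e x = cis (- (of_int n * x))" for x
  have contk: "continuous_on {0..2 * pi} k"
    using k has_vector_derivative_continuous by (fastforce simp: continuous_on_eq_continuous_within)
  have e': "(e has_vector_derivative - \<i> * of_int n * e x) (at x within {0..2 * pi})" for x
    using cis_has_vector_derivative[of "- of_int n"] by (simp add: e_def[abs_def])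
  have "((\<lambda>x. e x * k' x + - \<i> * of_int n * e x * k x) has_integral e (2 * pi) * k (2 * pi) - e 0 * k 0)
      {0..2 * pi}"
    by (rule fundamental_theorem_of_calculus) (use has_vector_derivative_mult[OF e' k] in simp_all)
  moreover have "e (2 * pi) = 1" "e 0 = 1"
    by (simp_all add: e_def complex_eq_iff mult.commute[of _ "2 * pi"])
       (simp_all add: mult.assoc mult.left_commute sin_int_times_real cos_int_times_real)?
  ultimately have 1: "((\<lambda>x. e x * k' x + - \<i> * of_int n * e x * k x) has_integral 0) {0..2 * pi}"
    using per by simp
  have 2: "((\<lambda>x. \<i> * of_int n * (e x * k x)) has_integral \<i> * of_int n * integral {0..2 * pi} (\<lambda>x. e x * k x))
      {0..2 * pi}"
    using fourier_integrable[OF contk, of n]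
    by (intro has_integral_mult_right) (simp add: e_def integrable_integral)
  have 3: "((\<lambda>x. e x * g x) has_integral integral {0..2 * pi} (\<lambda>x. e x * g x)) {0..2 * pi}"
    using fourier_integrable[OF g, of n] by (simp add: e_def integrable_integral)
  have I: "((\<lambda>x. e x * (k' x - g x)) has_integral
      \<i> * of_int n * integral {0..2 * pi} (\<lambda>x. e x * k x) - integral {0..2 * pi} (\<lambda>x. e x * g x))
      (cbox 0 (2 * pi))"
    using has_integral_diff[OF has_integral_add[OF 1 2] 3] by (simp add: algebra_simps)
  have e: "norm (e x * (k' x - g x)) \<le> \<eta>" if "x \<in> cbox 0 (2 * pi)" for x
    using close[of x] that by (simp add: norm_mult e_def)
  have "0 \<le> \<eta>"
    using close[of 0] norm_ge_zero[of "k' 0 - g 0"] by (simp del: norm_ge_zero)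
  from has_integral_bound[OF this I e]
  have "norm (\<i> * of_int n * integral {0..2 * pi} (\<lambda>x. e x * k x) - integral {0..2 * pi} (\<lambda>x. e x * g x))
      \<le> \<eta> * (2 * pi)"
    by simp
  moreover have *: "\<i> * of_int n * fourier_coeff n k - fourier_coeff n g =
     (\<i> * of_int n * integral {0..2 * pi} (\<lambda>x. e x * k x) - integral {0..2 * pi} (\<lambda>x. e x * g x)) / of_real (2 * pi)"
    by (simp add: fourier_coeff_def e_def diff_divide_distrib)
  ultimately show ?thesis
    unfolding * norm_divide by (simp add: norm_mult divide_le_eq)
qed

lemma fourier_coeff_deriv:
  assumes "\<And>x. x \<in> {0..2 * pi} \<Longrightarrow> (k has_vector_derivative k' x) (at x within {0..2 * pi})"
    and "k (2 * pi) = k 0" and "continuous_on {0..2 * pi} k'"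
  shows "fourier_coeff n k' = \<i> * of_int n * fourier_coeff n k"
  using fourier_coeff_approx[of k k' k' 0 n] assms by simp

lemma fourier_coeff_bound:
  assumes "continuous_on {0..2 * pi} f" and "\<And>x. x \<in> {0..2 * pi} \<Longrightarrow> norm (f x) \<le> B"
  shows "norm (fourier_coeff n f) \<le> B"
  using fourier_coeff_approx[of "\<lambda>_. 0" "\<lambda>_. 0" f B n] assms by (simp add: fourier_coeff_def)

lemma fourier_coeff_const: "fourier_coeff n (\<lambda>_. k) = (if n = 0 then k else 0)"
proof (cases "n = 0")
  case False
  then show ?thesis
    using fourier_coeff_deriv[of "\<lambda>_. k" "\<lambda>_. 0" n] by (simp add: fourier_coeff_def)
qed (simp add: fourier_coeff_def scaleR_conv_of_real)

lemma fourier_coeff_cis: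
  "fourier_coeff n (\<lambda>x. cis (of_int m * x) * k) = (if n = m then k else 0)"
  by (simp add: fourier_coeff_shift fourier_coeff_const)

lemma fourier_coeff_leibniz:
  fixes w :: "real \<Rightarrow> real \<Rightarrow> real"
  assumes "open I" "convex I" "t \<in> I"
    and w: "\<And>t x. t \<in> I \<Longrightarrow> ((\<lambda>s. w s x) has_real_derivative w' t x) (at t)"
    and cont: "\<And>t. t \<in> I \<Longrightarrow> continuous_on UNIV (w t)"
    and cont': "continuous_on (I \<times> UNIV) (\<lambda>(t, x). w' t x)"
  shows "((\<lambda>s. fourier_coeff n (\<lambda>x. of_real (w s x))) has_vector_derivative
           fourier_coeff n (\<lambda>x. of_real (w' t x))) (at t)"
proof -
  have "((\<lambda>s. integral (cbox 0 (2 * pi)) (\<lambda>x. cis (- (of_int n * x)) * of_real (w s x))) has_vector_derivative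
     integral (cbox 0 (2 * pi)) (\<lambda>x. cis (- (of_int n * x)) * of_real (w' t x))) (at t within I)"
  proof (rule leibniz_rule_vector_derivative[OF _ _ _ \<open>t \<in> I\<close> \<open>convex I\<close>])
    fix s x :: real
    assume s: "s \<in> I"
    have "((\<lambda>s. w s x) has_real_derivative w' s x) (at s within I)"
      by (rule has_field_derivative_at_within[OF w[OF s]])
    from has_vector_derivative_mult_right[OF has_vector_derivative_of_real[OF this]]
    show "((\<lambda>s. cis (- (of_int n * x)) * complex_of_real (w s x)) has_vector_derivative
        cis (- (of_int n * x)) * complex_of_real (w' s x)) (at s within I)"
      .
  next
    fix s assume "s \<in> I"
    then have "continuous_on {0..2 * pi} (\<lambda>x. complex_of_real (w s x))"
      using continuous_on_subset[OF cont] by (intro continuous_on_of_real) auto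
    then show "(\<lambda>x. cis (- (of_int n * x)) * complex_of_real (w s x)) integrable_on cbox 0 (2 * pi)"
      using fourier_integrable by simp
  next
    have "continuous_on (I \<times> cbox 0 (2 * pi)) (\<lambda>(t, x). w' t x)"
      by (rule continuous_on_subset[OF cont']) auto
    then show "continuous_on (I \<times> cbox 0 (2 * pi)) (\<lambda>(s, x). cis (- (of_int n * x)) * complex_of_real (w' s x))"
      unfolding case_prod_beta by (intro continuous_intros) auto
  qed
  from has_vector_derivative_divide[OF this, of "of_real (2 * pi)"] show ?thesis
    unfolding fourier_coeff_def cbox_interval at_within_open[OF assms(3,1)] .
qed

section \<open>The Fourier modes of a classical solution\<close>

lemma deriv_periodic:
  fixes f :: "real \<Rightarrow> real"
  assumes "\<And>x. f differentiable (at x)" and "\<And>x. f (x + p) = f x"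
  shows "deriv f (x + p) = deriv f x"
proof -
  have "(f has_real_derivative deriv f (x + p)) (at (x + p))"
    using assms(1) by (simp add: DERIV_deriv_iff_real_differentiable)
  then have "((\<lambda>x. f (x + p)) has_real_derivative deriv f (x + p)) (at x)"
    by (simp add: DERIV_shift)
  then show ?thesis
    using assms(2) by (simp add: DERIV_imp_deriv)
qed

lemma fourier_coeff_deriv_real:
  fixes f f' :: "real \<Rightarrow> real"
  assumes f: "\<And>x. (f has_real_derivative f' x) (at x)"
    and "\<And>x. f (x + 2 * pi) = f x" and "continuous_on UNIV f'"
  shows "fourier_coeff n (\<lambda>x. of_real (f' x)) = \<i> * of_int n * fourier_coeff n (\<lambda>x. of_real (f x))"
proof (rule fourier_coeff_deriv)
  show "((\<lambda>x. complex_of_real (f x)) has_vector_derivative complex_of_real (f' x)) (at x within {0..2 * pi})" for x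
    using has_field_derivative_at_within[OF f]
    by (intro has_vector_derivative_of_real) (simp only: has_real_derivative_iff_has_vector_derivative)
  show "complex_of_real (f (2 * pi)) = complex_of_real (f 0)"
    using assms(2)[of 0] by simp
  show "continuous_on {0..2 * pi} (\<lambda>x. complex_of_real (f' x))"
    using continuous_on_subset[OF assms(3)] by (intro continuous_intros) auto
qed

lemma fourier_coeff_iterated_deriv:
  fixes f :: "real \<Rightarrow> real"
  assumes diff: "\<And>k x. k < N \<Longrightarrow> (deriv ^^ k) f differentiable (at x)"
    and cont: "\<And>k. k \<le> N \<Longrightarrow> continuous_on UNIV ((deriv ^^ k) f)"
    and per: "\<And>x. f (x + 2 * pi) = f x" and "k \<le> N"
  shows "(\<forall>x. (deriv ^^ k) f (x + 2 * pi) = (deriv ^^ k) f x) \<and>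
    fourier_coeff n (\<lambda>x. of_real ((deriv ^^ k) f x)) = (\<i> * of_int n) ^ k * fourier_coeff n (\<lambda>x. of_real (f x))"
  using \<open>k \<le> N\<close>
proof (induction k)
  case 0
  then show ?case using per by simp
next
  case (Suc k)
  then have IH: "\<And>x. (deriv ^^ k) f (x + 2 * pi) = (deriv ^^ k) f x"
    "fourier_coeff n (\<lambda>x. of_real ((deriv ^^ k) f x)) = (\<i> * of_int n) ^ k * fourier_coeff n (\<lambda>x. of_real (f x))"
    by auto
  have d: "((deriv ^^ k) f has_real_derivative (deriv ^^ Suc k) f x) (at x)" for x
    using diff[of k x] Suc.prems by (simp add: DERIV_deriv_iff_real_differentiable)
  have "(deriv ^^ Suc k) f (x + 2 * pi) = (deriv ^^ Suc k) f x" for x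
    using deriv_periodic[of "(deriv ^^ k) f" "2 * pi" x] diff[of k] Suc.prems IH(1) by simp
  moreover have "fourier_coeff n (\<lambda>x. of_real ((deriv ^^ Suc k) f x))
      = \<i> * of_int n * fourier_coeff n (\<lambda>x. of_real ((deriv ^^ k) f x))"
    by (rule fourier_coeff_deriv_real[OF d IH(1) cont[OF Suc.prems]])
  ultimately show ?case
    using IH(2) by simp
qed

text \<open>All nonlinear terms are \<open>x\<close>-derivatives, of \<open>uv\<close>, \<open>u\<^sup>2 / 2\<close> and \<open>v\<^sup>2 / 2\<close>; so on every mode the partial derivatives
  become factors \<open>in\<close>, and time differentiation commutes with taking the coefficient by the Leibniz rule.\<close>

lemma classical_solution_modes:
  fixes n :: int
  assumes sol: "classical_solution a c g11 g21 g22 \<delta> I u v"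
    and I: "open I" "convex I" "t \<in> I"
  defines "U \<equiv> fourier_coeff n (\<lambda>x. of_real (u t x))"
    and "V \<equiv> fourier_coeff n (\<lambda>x. of_real (v t x))"
  shows "((\<lambda>s. fourier_coeff n (\<lambda>x. of_real (u s x))) has_vector_derivative
       \<i> * of_int n * V - of_real a * of_int n ^ 4 * U
         + \<i> * of_int n * (of_real g11 * fourier_coeff n (\<lambda>x. of_real (u t x * v t x)))) (at t)"
    and "((\<lambda>s. fourier_coeff n (\<lambda>x. of_real (v s x))) has_vector_derivative
       \<i> * of_int n * (of_real (c\<^sup>2) * U) + of_real \<delta> * of_int n ^ 2 * V - of_int n ^ 4 * V
         + \<i> * of_int n * (of_real (g21 / 2) * fourier_coeff n (\<lambda>x. of_real ((u t x)\<^sup>2))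
                        + of_real (g22 / 2) * fourier_coeff n (\<lambda>x. of_real ((v t x)\<^sup>2)))) (at t)"
proof -
  have mz: "\<And>s. s \<in> I \<Longrightarrow> mean_zero_periodic (\<lambda>x. (u s x, v s x))"
    and diff: "\<And>w k s x. w \<in> {u, v} \<Longrightarrow> k < 4 \<Longrightarrow> s \<in> I \<Longrightarrow> (deriv ^^ k) (w s) differentiable (at x)"
    and cont: "\<And>w k. w \<in> {u, v} \<Longrightarrow> k \<le> 4 \<Longrightarrow> continuous_on (I \<times> UNIV) (\<lambda>(s, x). (deriv ^^ k) (w s) x)"
    and du: "\<And>s x. s \<in> I \<Longrightarrow> ((\<lambda>s. u s x) has_real_derivative
           deriv (v s) x - a * (deriv ^^ 4) (u s) x
           + g11 * (deriv (u s) x * v s x + u s x * deriv (v s) x)) (at s)"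
    and dv: "\<And>s x. s \<in> I \<Longrightarrow> ((\<lambda>s. v s x) has_real_derivative
           c\<^sup>2 * deriv (u s) x - \<delta> * (deriv ^^ 2) (v s) x - (deriv ^^ 4) (v s) x
           + g21 * u s x * deriv (u s) x + g22 * v s x * deriv (v s) x) (at s)"
    using sol unfolding classical_solution_def by blast+
  have per: "w s (x + 2 * pi) = w s x" if "w \<in> {u, v}" "s \<in> I" for w s x
    using mz[OF that(2)] that(1) unfolding mean_zero_periodic_def by auto
  have cx: "continuous_on UNIV ((deriv ^^ k) (w s))" if "w \<in> {u, v}" "k \<le> 4" "s \<in> I" for w k s
  proof -
    have "continuous_on UNIV ((\<lambda>(s, x). (deriv ^^ k) (w s) x) \<circ> Pair s)"
      by (rule continuous_on_compose) (auto intro!: continuous_intros continuous_on_subset[OF cont[OF that(1,2)]] that)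
    then show ?thesis by (simp add: o_def)
  qed
  have cx': "continuous_on S ((deriv ^^ k) (w t))" if "w \<in> {u, v}" "k \<le> 4" for w k S
    using cx[OF that \<open>t \<in> I\<close>] continuous_on_subset by blast
  have it: "fourier_coeff n (\<lambda>x. of_real ((deriv ^^ k) (w t) x)) = (\<i> * of_int n) ^ k * fourier_coeff n (\<lambda>x. of_real (w t x))"
    if "w \<in> {u, v}" "k \<le> 4" for w k
    using fourier_coeff_iterated_deriv[of 4 "w t" k n] diff[OF that(1)] cx[OF that(1)] per[OF that(1)] I(3) that(2)
    by blast
  have d1: "(w t has_real_derivative deriv (w t) x) (at x)" if "w \<in> {u, v}" for w x
    using diff[OF that, of 0 t x] I(3) by (simp add: DERIV_deriv_iff_real_differentiable)
  have prod: "fourier_coeff n (\<lambda>x. of_real (deriv (w t) x * y t x + w t x * deriv (y t) x))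
      = \<i> * of_int n * fourier_coeff n (\<lambda>x. of_real (w t x * y t x))" if "w \<in> {u, v}" "y \<in> {u, v}" for w y
  proof (rule fourier_coeff_deriv_real)
    show "((\<lambda>x. w t x * y t x) has_real_derivative deriv (w t) x * y t x + w t x * deriv (y t) x) (at x)" for x
      using DERIV_mult[OF d1[OF that(1)] d1[OF that(2)], of x] by (simp add: algebra_simps)
    show "w t (x + 2 * pi) * y t (x + 2 * pi) = w t x * y t x" for x
      using per[OF that(1) I(3)] per[OF that(2) I(3)] by simp
    show "continuous_on UNIV (\<lambda>x. deriv (w t) x * y t x + w t x * deriv (y t) x)"
      using cx'[OF that(1), of 0] cx'[OF that(1), of 1] cx'[OF that(2), of 0] cx'[OF that(2), of 1]
      by (intro continuous_intros) auto
  qed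
  have c0: "continuous_on S (w t)" and c1: "continuous_on S (deriv (w t))"
    and c2: "continuous_on S ((deriv ^^ 2) (w t))" and c4: "continuous_on S ((deriv ^^ 4) (w t))"
    if "w \<in> {u, v}" for w S
    using cx'[OF that, of 0] cx'[OF that, of 1] cx'[OF that, of 2] cx'[OF that, of 4] by auto
  have j: "continuous_on (I \<times> UNIV) (\<lambda>p. w (fst p) (snd p))"
    "continuous_on (I \<times> UNIV) (\<lambda>p. deriv (w (fst p)) (snd p))"
    "continuous_on (I \<times> UNIV) (\<lambda>p. (deriv ^^ 2) (w (fst p)) (snd p))"
    "continuous_on (I \<times> UNIV) (\<lambda>p. (deriv ^^ 4) (w (fst p)) (snd p))"
    if "w \<in> {u, v}" for w
    using cont[OF that, of 0] cont[OF that, of 1] cont[OF that, of 2] cont[OF that, of 4]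
    by (auto simp: case_prod_beta)
  have it1: "fourier_coeff n (\<lambda>x. of_real (deriv (w t) x)) = \<i> * of_int n * fourier_coeff n (\<lambda>x. of_real (w t x))"
    and it2: "fourier_coeff n (\<lambda>x. of_real ((deriv ^^ 2) (w t) x)) = (\<i> * of_int n)\<^sup>2 * fourier_coeff n (\<lambda>x. of_real (w t x))"
    and it4: "fourier_coeff n (\<lambda>x. of_real ((deriv ^^ 4) (w t) x)) = (\<i> * of_int n) ^ 4 * fourier_coeff n (\<lambda>x. of_real (w t x))"
    if "w \<in> {u, v}" for w
    using it[OF that, of 1] it[OF that, of 2] it[OF that, of 4] by auto
  have uv: "u \<in> {u, v}" "v \<in> {u, v}" by simp_all
  note cnt = c0[OF uv(1)] c1[OF uv(1)] c2[OF uv(1)] c4[OF uv(1)] c0[OF uv(2)] c1[OF uv(2)] c2[OF uv(2)] c4[OF uv(2)]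
  note modes = it1[OF uv(1)] it1[OF uv(2)] it2[OF uv(1)] it2[OF uv(2)] it4[OF uv(1)] it4[OF uv(2)]
    prod[OF uv] prod[OF uv(1) uv(1), folded power2_eq_square] prod[OF uv(2) uv(2), folded power2_eq_square]
  note lin = fourier_coeff_add fourier_coeff_cmult continuous_on_add continuous_on_mult continuous_on_const continuous_on_of_real
  have Du: "((\<lambda>s. fourier_coeff n (\<lambda>x. of_real (u s x))) has_vector_derivative
     fourier_coeff n (\<lambda>x. of_real (deriv (v t) x - a * (deriv ^^ 4) (u t) x
           + g11 * (deriv (u t) x * v t x + u t x * deriv (v t) x)))) (at t)"
    by (rule fourier_coeff_leibniz[OF I du])
       (use cx[of u 0] j[of u] j[of v] in \<open>auto simp: case_prod_beta intro!: continuous_intros\<close>)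
  have Dv: "((\<lambda>s. fourier_coeff n (\<lambda>x. of_real (v s x))) has_vector_derivative
     fourier_coeff n (\<lambda>x. of_real (c\<^sup>2 * deriv (u t) x - \<delta> * (deriv ^^ 2) (v t) x - (deriv ^^ 4) (v t) x
           + g21 * u t x * deriv (u t) x + g22 * v t x * deriv (v t) x))) (at t)"
    by (rule fourier_coeff_leibniz[OF I dv])
       (use cx[of v 0] j[of u] j[of v] in \<open>auto simp: case_prod_beta intro!: continuous_intros\<close>)
  have split_u: "complex_of_real (deriv (v t) x - a * (deriv ^^ 4) (u t) x
           + g11 * (deriv (u t) x * v t x + u t x * deriv (v t) x))
     = of_real (deriv (v t) x) + (of_real (- a) * of_real ((deriv ^^ 4) (u t) x)
        + of_real g11 * of_real (deriv (u t) x * v t x + u t x * deriv (v t) x))" for x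
    by (simp add: algebra_simps)
  have split_v: "complex_of_real (c\<^sup>2 * deriv (u t) x - \<delta> * (deriv ^^ 2) (v t) x - (deriv ^^ 4) (v t) x
           + g21 * u t x * deriv (u t) x + g22 * v t x * deriv (v t) x)
     = of_real (c\<^sup>2) * of_real (deriv (u t) x) + (of_real (- \<delta>) * of_real ((deriv ^^ 2) (v t) x)
        + ((- 1) * of_real ((deriv ^^ 4) (v t) x)
        + (of_real (g21 / 2) * of_real (deriv (u t) x * u t x + u t x * deriv (u t) x)
        + of_real (g22 / 2) * of_real (deriv (v t) x * v t x + v t x * deriv (v t) x))))" for x
    by (simp add: algebra_simps)
  have "fourier_coeff n (\<lambda>x. of_real (deriv (v t) x - a * (deriv ^^ 4) (u t) x
           + g11 * (deriv (u t) x * v t x + u t x * deriv (v t) x)))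
     = \<i> * of_int n * V - of_real a * of_int n ^ 4 * U
         + \<i> * of_int n * (of_real g11 * fourier_coeff n (\<lambda>x. of_real (u t x * v t x)))"
    unfolding split_u U_def V_def
    by (simp only: lin cnt modes) (simp add: power2_eq_square power4_eq_xxxx algebra_simps)
  with Du show "((\<lambda>s. fourier_coeff n (\<lambda>x. of_real (u s x))) has_vector_derivative
       \<i> * of_int n * V - of_real a * of_int n ^ 4 * U
         + \<i> * of_int n * (of_real g11 * fourier_coeff n (\<lambda>x. of_real (u t x * v t x)))) (at t)"
    by simp
  have "fourier_coeff n (\<lambda>x. of_real (c\<^sup>2 * deriv (u t) x - \<delta> * (deriv ^^ 2) (v t) x - (deriv ^^ 4) (v t) x
           + g21 * u t x * deriv (u t) x + g22 * v t x * deriv (v t) x))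
     = \<i> * of_int n * (of_real (c\<^sup>2) * U) + of_real \<delta> * of_int n ^ 2 * V - of_int n ^ 4 * V
         + \<i> * of_int n * (of_real (g21 / 2) * fourier_coeff n (\<lambda>x. of_real ((u t x)\<^sup>2))
                        + of_real (g22 / 2) * fourier_coeff n (\<lambda>x. of_real ((v t x)\<^sup>2)))"
    unfolding split_v U_def V_def
    by (simp only: lin cnt modes) (simp add: power2_eq_square power4_eq_xxxx algebra_simps)
  with Dv show "((\<lambda>s. fourier_coeff n (\<lambda>x. of_real (v s x))) has_vector_derivative
       \<i> * of_int n * (of_real (c\<^sup>2) * U) + of_real \<delta> * of_int n ^ 2 * V - of_int n ^ 4 * V
         + \<i> * of_int n * (of_real (g21 / 2) * fourier_coeff n (\<lambda>x. of_real ((u t x)\<^sup>2))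
                        + of_real (g22 / 2) * fourier_coeff n (\<lambda>x. of_real ((v t x)\<^sup>2)))) (at t)"
    by simp
qed

section \<open>Derivatives of \<open>C\<^sup>2\<close> maps near a point\<close>

lemma differentiable_pointwise_lipschitz:
  fixes g :: "'a::real_normed_vector \<Rightarrow> 'b::real_normed_vector"
  assumes "g differentiable (at x0)"
  shows "\<exists>C\<ge>0. \<forall>\<^sub>F x in nhds x0. norm (g x - g x0) \<le> C * norm (x - x0)"
proof -
  from assms obtain g' where g': "(g has_derivative g') (at x0)"
    by (auto simp: differentiable_def)
  then obtain K where K: "K > 0" "\<And>x. norm (g' x) \<le> norm x * K"
    using bounded_linear.pos_bounded[OF has_derivative_bounded_linear] by blast
  from g' obtain d where d: "d > 0"
    "\<And>y. norm (y - x0) < d \<Longrightarrow> norm (g y - g x0 - g' (y - x0)) \<le> 1 * norm (y - x0)"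
    unfolding has_derivative_at_alt by (metis zero_less_one)
  have "norm (g y - g x0) \<le> (K + 1) * norm (y - x0)" if "dist y x0 < d" for y
    using d(2)[of y] K(2)[of "y - x0"] that norm_triangle_sub[of "g y - g x0" "g' (y - x0)"]
    by (simp add: dist_norm algebra_simps)
  then show ?thesis
    using d(1) K(1) by (intro exI[of _ "K + 1"]) (auto simp: eventually_nhds_metric)
qed

text \<open>The definition of \<open>C\<^sup>2\<close> gives differentiability of \<open>Df(x) b\<close> for each fixed direction \<open>b\<close>; a basis of
  directions yields an estimate uniform in the direction.\<close>

lemma C_2_derivative_pointwise_lipschitz:
  fixes f :: "'a::euclidean_space \<Rightarrow> 'b::real_normed_vector"
  assumes f: "C_k_on (Suc (Suc k)) f S" and S: "open S" "x0 \<in> S"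
  shows "\<exists>C\<ge>0. \<forall>\<^sub>F x in nhds x0. \<forall>v.
    norm (frechet_derivative f (at x) v - frechet_derivative f (at x0) v) \<le> C * norm (x - x0) * norm v"
proof -
  define D where "D x = frechet_derivative f (at x)" for x
  have lin: "linear (D x)" if "x \<in> S" for x
    using f that linear_frechet_derivative unfolding D_def by auto
  have "\<forall>b. \<exists>C\<ge>0. \<forall>\<^sub>F x in nhds x0. norm (D x b - D x0 b) \<le> C * norm (x - x0)"
    using f S(2) by (intro allI differentiable_pointwise_lipschitz) (simp add: D_def)
  then obtain C where C: "\<And>b. C b \<ge> 0" "\<And>b. \<forall>\<^sub>F x in nhds x0. norm (D x b - D x0 b) \<le> C b * norm (x - x0)"
    by metis
  have "\<forall>\<^sub>F x in nhds x0. x \<in> S \<and> (\<forall>b\<in>Basis. norm (D x b - D x0 b) \<le> C b * norm (x - x0))"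
    using eventually_nhds_in_open[OF S] C(2) by (simp add: eventually_conj eventually_ball_finite)
  then have "\<forall>\<^sub>F x in nhds x0. \<forall>v. norm (D x v - D x0 v) \<le> (\<Sum>b\<in>Basis. C b) * norm (x - x0) * norm v"
  proof eventually_elim
    case (elim x)
    show ?case
    proof
      fix v :: 'a
      have "D y v = (\<Sum>b\<in>Basis. (v \<bullet> b) *\<^sub>R D y b)" if "y \<in> S" for y
        using linear_sum[OF lin[OF that], of "\<lambda>b. (v \<bullet> b) *\<^sub>R b" Basis] lin[OF that]
        by (simp add: euclidean_representation linear_cmul)
      then have "D x v - D x0 v = (\<Sum>b\<in>Basis. (v \<bullet> b) *\<^sub>R (D x b - D x0 b))"
        using elim S(2) by (simp add: sum_subtractf scaleR_diff_right)
      also have "norm \<dots> \<le> (\<Sum>b\<in>Basis. norm v * (C b * norm (x - x0)))"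
        using elim by (intro sum_norm_le) (auto intro!: mult_mono simp: Basis_le_norm)
      finally show "norm (D x v - D x0 v) \<le> (\<Sum>b\<in>Basis. C b) * norm (x - x0) * norm v"
        by (simp add: sum_distrib_left sum_distrib_right algebra_simps)
    qed
  qed
  moreover have "(\<Sum>b\<in>Basis. C b) \<ge> 0"
    by (intro sum_nonneg C(1))
  ultimately show ?thesis
    unfolding D_def by blast
qed

lemma C_2_slice:
  fixes f :: "'p::euclidean_space \<times> 'e::euclidean_space \<Rightarrow> 'b::real_normed_vector"
  assumes f: "C_k_on (Suc (Suc k)) f (ball d \<rho> \<times> ball 0 \<rho>)" and "0 < \<rho>"
    and L: "((\<lambda>z. f (d, z)) has_derivative L) (at 0)"
  obtains C r F' where "0 < r" "r \<le> \<rho>" "0 \<le> C"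
    and "\<And>z. z \<in> ball 0 r \<Longrightarrow> ((\<lambda>z. f (d, z)) has_derivative F' z) (at z)"
    and "\<And>z v. z \<in> ball 0 r \<Longrightarrow> norm (F' z v - L v) \<le> C * norm z * norm v"
proof -
  define F' where "F' z v = frechet_derivative f (at (d, z)) (0, v)" for z v
  have der: "((\<lambda>z. f (d, z)) has_derivative F' z) (at z)" if "z \<in> ball 0 \<rho>" for z
  proof -
    have "f differentiable (at (d, z))"
      using f that \<open>0 < \<rho>\<close> by simp
    then have "(f has_derivative frechet_derivative f (at (d, z))) (at (d, z))"
      by (simp add: frechet_derivative_works)
    moreover have "((\<lambda>z. (d, z)) has_derivative (\<lambda>v. (0, v))) (at z)"
      by (auto intro!: derivative_eq_intros)
    ultimately show ?thesis
      using has_derivative_compose[of "Pair d" "\<lambda>v. (0, v)" z UNIV f] unfolding F'_def by auto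
  qed
  have "F' 0 = L"
    using has_derivative_unique[OF der L] \<open>0 < \<rho>\<close> by simp
  obtain C where "0 \<le> C" and C: "\<forall>\<^sub>F x in nhds (d, 0). \<forall>v.
      norm (frechet_derivative f (at x) v - frechet_derivative f (at (d, 0)) v) \<le> C * norm (x - (d, 0)) * norm v"
    using C_2_derivative_pointwise_lipschitz[OF f, of "(d, 0)"] \<open>0 < \<rho>\<close> by (auto simp: open_Times)
  then obtain r where "0 < r" and r: "\<And>x v. dist x (d, 0) < r \<Longrightarrow>
      norm (frechet_derivative f (at x) v - frechet_derivative f (at (d, 0)) v) \<le> C * norm (x - (d, 0)) * norm v"
    unfolding eventually_nhds_metric by blast
  have "norm (F' z v - L v) \<le> C * norm z * norm v" if "z \<in> ball 0 (min r \<rho>)" for z v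
    using r[of "(d, z)" "(0, v)"] that unfolding \<open>F' 0 = L\<close>[symmetric]
    by (simp add: F'_def dist_Pair_Pair dist_norm norm_Pair)
  then show thesis
    using that[of "min r \<rho>" C F'] der \<open>0 < r\<close> \<open>0 < \<rho>\<close> \<open>0 \<le> C\<close> by simp
qed

lemma quadratic_bound:
  fixes F :: "'e::real_normed_vector \<Rightarrow> 'b::real_normed_vector"
  assumes der: "\<And>z. z \<in> ball 0 r \<Longrightarrow> (F has_derivative F' z) (at z)"
    and bound: "\<And>z v. z \<in> ball 0 r \<Longrightarrow> norm (F' z v) \<le> C * norm z * norm v"
    and "0 \<le> C" "F 0 = 0" "z \<in> ball 0 r"
  shows "norm (F z) \<le> C * norm z ^ 2"
proof -
  have "norm (F z - F 0) \<le> (C * norm z) * norm (z - 0)"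
  proof (rule differentiable_bound)
    show "convex (cball (0 :: 'e) (norm z))" by simp
    show "(F has_derivative F' x) (at x within cball 0 (norm z))" if "x \<in> cball 0 (norm z)" for x
      using der[of x] that assms(5) by (simp add: has_derivative_at_withinI)
    show "onorm (F' x) \<le> C * norm z" if "x \<in> cball 0 (norm z)" for x
    proof (rule onorm_bound)
      show "0 \<le> C * norm z" using \<open>0 \<le> C\<close> by simp
      fix v
      have "norm (F' x v) \<le> C * norm x * norm v"
        using bound[of x] that assms(5) by simp
      also have "\<dots> \<le> C * norm z * norm v"
        using that \<open>0 \<le> C\<close> by (intro mult_right_mono mult_left_mono) auto
      finally show "norm (F' x v) \<le> C * norm z * norm v" .
    qed
  qed auto
  then show ?thesis
    using \<open>F 0 = 0\<close> by (simp add: power2_eq_square mult.assoc)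
qed

section \<open>Products of a harmonic wave and a small perturbation\<close>

text \<open>In the product of two waves with remainders, the wave-times-wave part has the modes \<open>0, 2, -2\<close> only, and a
  wave shifts the modes of a remainder by one.  Mode one hence involves the modes \<open>0\<close> and \<open>2\<close> of the
  remainders, of which the former vanishes.\<close>

lemma fourier_coeff_wave_product:
  fixes f g fh gh :: "real \<Rightarrow> real" and U V :: complex
  assumes f: "\<And>x. f x = 2 * Re (cis x * U) + fh x" and g: "\<And>x. g x = 2 * Re (cis x * V) + gh x"
    and cont: "continuous_on {0..2 * pi} fh" "continuous_on {0..2 * pi} gh"
    and fh0: "fourier_coeff 0 (\<lambda>x. of_real (fh x)) = 0" and gh0: "fourier_coeff 0 (\<lambda>x. of_real (gh x)) = 0"
    and small: "\<And>x. \<bar>fh x\<bar> \<le> \<eta>" "\<And>x. \<bar>gh x\<bar> \<le> \<eta>"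
  shows "norm (fourier_coeff 1 (\<lambda>x. of_real (f x * g x))
      - (cnj U * fourier_coeff 2 (\<lambda>x. of_real (gh x)) + cnj V * fourier_coeff 2 (\<lambda>x. of_real (fh x)))) \<le> \<eta>\<^sup>2"
    and "norm (fourier_coeff 2 (\<lambda>x. of_real (f x * g x)) - U * V) \<le> 2 * (norm U + norm V) * \<eta> + \<eta>\<^sup>2"
proof -
  have wave: "complex_of_real (2 * Re (cis x * W)) = cis x * W + cis (- x) * cnj W" for x W
    by (simp add: complex_eq_iff)
  define F G where "F x = complex_of_real (fh x)" and "G x = complex_of_real (gh x)" for x
  have cFG: "continuous_on {0..2 * pi} F" "continuous_on {0..2 * pi} G"
    unfolding F_def G_def by (intro continuous_intros cont)+
  define W where "W x = cis (of_int 2 * x) * (U * V) + (cis (of_int 0 * x) * (U * cnj V + cnj U * V)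
      + cis (of_int (- 2) * x) * (cnj U * cnj V))" for x
  define P where "P x = (cis (of_int 1 * x) * (U * G x) + cis (of_int (- 1) * x) * (cnj U * G x))
      + (cis (of_int 1 * x) * (V * F x) + cis (of_int (- 1) * x) * (cnj V * F x))" for x
  have prod: "complex_of_real (f x * g x) = W x + (P x + F x * G x)" for x
  proof -
    have c2: "cis (2 * x) = cis x * cis x" "cis (- (2 * x)) = cis (- x) * cis (- x)" "cis x * cis (- x) = 1"
      by (simp_all add: cis_mult)
    have "complex_of_real (f x * g x) =
        (cis x * U + cis (- x) * cnj U + F x) * (cis x * V + cis (- x) * cnj V + G x)"
      by (simp only: f g wave F_def G_def of_real_mult[of "_ + _"] of_real_add)
    also have "\<dots> = W x + (P x + F x * G x)"
      using c2(3) unfolding W_def P_def by (simp add: c2(1,2)) algebra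
    finally show ?thesis .
  qed
  have cW: "continuous_on {0..2 * pi} W" and cP: "continuous_on {0..2 * pi} P"
    unfolding W_def P_def by (intro continuous_intros cFG)+
  have cw: "continuous_on {0..2 * pi} (\<lambda>x. cis (of_int m * x) * k)" for m k
    by (intro continuous_intros)
  have cp: "continuous_on {0..2 * pi} (\<lambda>x. cis (of_int m * x) * (k * F x))"
    "continuous_on {0..2 * pi} (\<lambda>x. cis (of_int m * x) * (k * G x))" for m k
    by (intro continuous_intros cFG)+
  have "fourier_coeff n W = (if n = 2 then U * V else 0)
      + ((if n = 0 then U * cnj V + cnj U * V else 0) + (if n = - 2 then cnj U * cnj V else 0))" for n
    unfolding W_def by (simp only: fourier_coeff_add continuous_on_add cw fourier_coeff_cis)
  then have W1: "fourier_coeff 1 W = 0" and W2: "fourier_coeff 2 W = U * V"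
    by simp_all
  have P1: "fourier_coeff 1 P = cnj U * fourier_coeff 2 G + cnj V * fourier_coeff 2 F"
    unfolding P_def
    by (simp only: fourier_coeff_add continuous_on_add cp fourier_coeff_shift fourier_coeff_cmult)
       (simp add: F_def[abs_def] G_def[abs_def] fh0 gh0)
  have FG: "norm (F x * G x) \<le> \<eta>\<^sup>2" for x
    using mult_mono[OF small(1)[of x] small(2)[of x]] small(1)[of 0]
    by (simp add: F_def G_def norm_mult power2_eq_square abs_mult)
  have P: "norm (P x) \<le> 2 * (norm U + norm V) * \<eta>" for x
  proof -
    have "norm (P x) \<le> (norm U * \<bar>gh x\<bar> + norm U * \<bar>gh x\<bar>) + (norm V * \<bar>fh x\<bar> + norm V * \<bar>fh x\<bar>)"
      unfolding P_def
      by (intro order.trans[OF norm_triangle_ineq] add_mono) (simp_all add: norm_mult F_def G_def)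
    also have "\<dots> \<le> (norm U * \<eta> + norm U * \<eta>) + (norm V * \<eta> + norm V * \<eta>)"
      using small by (intro add_mono mult_left_mono) auto
    finally show ?thesis by (simp add: algebra_simps)
  qed
  have "fourier_coeff 1 (\<lambda>x. of_real (f x * g x)) =
      (cnj U * fourier_coeff 2 G + cnj V * fourier_coeff 2 F) + fourier_coeff 1 (\<lambda>x. F x * G x)"
    by (simp only: prod fourier_coeff_add continuous_on_add continuous_on_mult cW cP cFG W1 P1) simp
  moreover have "norm (fourier_coeff 1 (\<lambda>x. F x * G x)) \<le> \<eta>\<^sup>2"
    by (rule fourier_coeff_bound) (intro continuous_intros cFG FG)+
  ultimately show "norm (fourier_coeff 1 (\<lambda>x. of_real (f x * g x))
      - (cnj U * fourier_coeff 2 (\<lambda>x. of_real (gh x)) + cnj V * fourier_coeff 2 (\<lambda>x. of_real (fh x)))) \<le> \<eta>\<^sup>2"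
    by (simp add: F_def[abs_def] G_def[abs_def])
  have "fourier_coeff 2 (\<lambda>x. of_real (f x * g x)) = U * V + fourier_coeff 2 (\<lambda>x. P x + F x * G x)"
    unfolding prod
    by (subst fourier_coeff_add[OF cW]) (intro continuous_on_add continuous_on_mult cP cFG, simp add: W2)
  moreover have "norm (fourier_coeff 2 (\<lambda>x. P x + F x * G x)) \<le> 2 * (norm U + norm V) * \<eta> + \<eta>\<^sup>2"
    by (rule fourier_coeff_bound)
       (intro continuous_intros cFG cP order.trans[OF norm_triangle_ineq] add_mono P FG)+
  ultimately show "norm (fourier_coeff 2 (\<lambda>x. of_real (f x * g x)) - U * V) \<le> 2 * (norm U + norm V) * \<eta> + \<eta>\<^sup>2"
    by simp
qed

lemma fourier_coeff_wave:
  fixes f fh :: "real \<Rightarrow> real" and U :: complex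
  assumes f: "\<And>x. f x = 2 * Re (cis x * U) + fh x" and cont: "continuous_on {0..2 * pi} fh"
  shows "fourier_coeff n (\<lambda>x. of_real (f x)) = (if n = 1 then U else if n = - 1 then cnj U else 0)
    + fourier_coeff n (\<lambda>x. of_real (fh x))"
proof -
  have cw: "continuous_on {0..2 * pi} (\<lambda>x. cis (of_int m * x) * k)" for m k
    by (intro continuous_intros)
  have "complex_of_real (f x) = (cis (of_int 1 * x) * U + cis (of_int (- 1) * x) * cnj U) + of_real (fh x)" for x
    by (simp add: f complex_eq_iff)
  then have "fourier_coeff n (\<lambda>x. of_real (f x)) =
      fourier_coeff n (\<lambda>x. cis (of_int 1 * x) * U) + fourier_coeff n (\<lambda>x. cis (of_int (- 1) * x) * cnj U)
      + fourier_coeff n (\<lambda>x. of_real (fh x))"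
    by (simp only: fourier_coeff_add continuous_on_add cw continuous_on_of_real cont)
  then show ?thesis
    by (simp only: fourier_coeff_cis) auto
qed

section \<open>Averaging along the periodic orbits of the linear flow\<close>

definition critical_orbit :: "real \<Rightarrow> real \<Rightarrow> real \<Rightarrow> complex \<times> complex" where
  "critical_orbit s e x = (of_real e * cis x, of_real (s * e) * cis (- x))"

definition critical_flow :: "real \<Rightarrow> complex \<times> complex \<Rightarrow> complex \<times> complex" where
  "critical_flow \<omega> z = (\<i> * of_real \<omega> * fst z, - \<i> * of_real \<omega> * snd z)"

lemma norm_critical_orbit:
  assumes "\<bar>s\<bar> \<le> 1" "0 \<le> e"
  shows "norm (critical_orbit s e x) \<le> 2 * e"
proof -
  have "norm (critical_orbit s e x) \<le> e + \<bar>s\<bar> * e"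
    unfolding critical_orbit_def
    using norm_Pair_le[of "of_real e * cis x" "of_real (s * e) * cis (- x)"] assms(2)
    by (simp add: norm_mult abs_mult)
  also have "\<dots> \<le> e + 1 * e"
    using assms by (intro add_left_mono mult_right_mono)
  finally show ?thesis by simp
qed

lemma critical_orbit_has_vector_derivative:
  assumes "\<omega> \<noteq> 0"
  shows "(critical_orbit s e has_vector_derivative (1 / \<omega>) *\<^sub>R critical_flow \<omega> (critical_orbit s e x)) (at x within S)"
proof -
  have "((\<lambda>x. (of_real e * cis (1 * x), of_real (s * e) * cis (- 1 * x))) has_vector_derivative
     (of_real e * (\<i> * of_real 1 * cis (1 * x)), of_real (s * e) * (\<i> * of_real (- 1) * cis (- 1 * x)))) (at x within S)"
    by (intro has_vector_derivative_Pair has_vector_derivative_mult_right cis_has_vector_derivative)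
  then show ?thesis
    using assms by (simp add: critical_orbit_def[abs_def] critical_flow_def scaleR_conv_of_real mult_ac)
qed

lemma continuous_on_critical_orbit: "continuous_on S (critical_orbit s e)"
  unfolding critical_orbit_def[abs_def] by (intro continuous_intros)

text \<open>Averaging replaces the solution of a differential equation along the linear flow by the solution of a linear
  equation: \<open>\<omega>\<close> times the phase derivative of \<open>F\<close> is its derivative in the direction of the flow.\<close>

lemma fourier_coeff_along_orbit:
  fixes F g :: "complex \<times> complex \<Rightarrow> complex"
  assumes "\<omega> > 0" and inside: "\<And>x. critical_orbit s e x \<in> S"
    and der: "\<And>z. z \<in> S \<Longrightarrow> (F has_derivative F' z) (at z)"
    and g: "continuous_on S g"
    and close: "\<And>x. norm (F' (critical_orbit s e x) (critical_flow \<omega> (critical_orbit s e x)) - g (critical_orbit s e x)) \<le> B"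
  shows "norm (\<i> * of_int n * of_real \<omega> * fourier_coeff n (\<lambda>x. F (critical_orbit s e x))
      - fourier_coeff n (\<lambda>x. g (critical_orbit s e x))) \<le> B"
proof -
  let ?z = "critical_orbit s e"
  have der': "((\<lambda>x. of_real \<omega> * F (?z x)) has_vector_derivative F' (?z x) (critical_flow \<omega> (?z x))) (at x within {0..2 * pi})" for x
  proof -
    interpret bounded_linear "F' (?z x)"
      using der[OF inside] by (rule has_derivative_bounded_linear)
    have "((\<lambda>x. F (?z x)) has_derivative (\<lambda>h. F' (?z x) (h *\<^sub>R ((1 / \<omega>) *\<^sub>R critical_flow \<omega> (?z x))))) (at x within {0..2 * pi})"
      using has_derivative_compose[OF critical_orbit_has_vector_derivative[unfolded has_vector_derivative_def] der[OF inside]]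
        \<open>\<omega> > 0\<close> by simp
    then have "((\<lambda>x. F (?z x)) has_vector_derivative (1 / \<omega>) *\<^sub>R F' (?z x) (critical_flow \<omega> (?z x))) (at x within {0..2 * pi})"
      by (simp add: has_vector_derivative_def scaleR)
    from has_vector_derivative_mult_right[OF this, of "of_real \<omega>"] show ?thesis
      using \<open>\<omega> > 0\<close> by (simp add: scaleR_conv_of_real)
  qed
  have "norm (\<i> * of_int n * fourier_coeff n (\<lambda>x. of_real \<omega> * F (?z x)) - fourier_coeff n (\<lambda>x. g (?z x))) \<le> B"
  proof (rule fourier_coeff_approx[OF der'])
    show "of_real \<omega> * F (?z (2 * pi)) = of_real \<omega> * F (?z 0)"
    proof -
      have "cis (- (2 * pi)) = 1" by (simp add: complex_eq_iff)
      then show ?thesis by (simp add: critical_orbit_def)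
    qed
    show "continuous_on {0..2 * pi} (\<lambda>x. g (?z x))"
      using inside by (intro continuous_on_compose2[OF g continuous_on_critical_orbit]) auto
  qed (rule close)
  then show ?thesis
    by (simp add: fourier_coeff_cmult mult.assoc)
qed

lemma tendsto_linear_rate:
  fixes f :: "real \<Rightarrow> 'a::real_normed_vector"
  assumes "\<forall>\<^sub>F e in at_right 0. norm (f e - l) \<le> K * e"
  shows "(f \<longlongrightarrow> l) (at_right 0)"
proof -
  have "((\<lambda>e. K * e) \<longlongrightarrow> 0) (at_right 0)"
    by (auto intro!: tendsto_eq_intros)
  then have "((\<lambda>e. f e - l) \<longlongrightarrow> 0) (at_right 0)"
    by (rule Lim_null_comparison[OF assms])
  then show ?thesis
    by (rule Lim_null[THEN iffD2])
qed

lemma tendsto_linear_solve: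
  fixes X Y :: "'b \<Rightarrow> 'a::real_normed_field"
  assumes "((\<lambda>e. k11 * X e + k12 * Y e) \<longlongrightarrow> f1) F" "((\<lambda>e. k21 * X e + k22 * Y e) \<longlongrightarrow> f2) F"
    and D: "k11 * k22 - k12 * k21 \<noteq> 0"
  shows "(X \<longlongrightarrow> (k22 * f1 - k12 * f2) / (k11 * k22 - k12 * k21)) F"
    and "(Y \<longlongrightarrow> (k11 * f2 - k21 * f1) / (k11 * k22 - k12 * k21)) F"
proof -
  have "((\<lambda>e. (k22 * (k11 * X e + k12 * Y e) - k12 * (k21 * X e + k22 * Y e)) / (k11 * k22 - k12 * k21))
      \<longlongrightarrow> (k22 * f1 - k12 * f2) / (k11 * k22 - k12 * k21)) F"
    by (intro tendsto_intros assms)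
  moreover have "(k22 * (k11 * X e + k12 * Y e) - k12 * (k21 * X e + k22 * Y e)) / (k11 * k22 - k12 * k21) = X e" for e
    using D by (simp add: divide_eq_eq algebra_simps)
  ultimately show "(X \<longlongrightarrow> (k22 * f1 - k12 * f2) / (k11 * k22 - k12 * k21)) F" by simp
  have "((\<lambda>e. (k11 * (k21 * X e + k22 * Y e) - k21 * (k11 * X e + k12 * Y e)) / (k11 * k22 - k12 * k21))
      \<longlongrightarrow> (k11 * f2 - k21 * f1) / (k11 * k22 - k12 * k21)) F"
    by (intro tendsto_intros assms)
  moreover have "(k11 * (k21 * X e + k22 * Y e) - k21 * (k11 * X e + k12 * Y e)) / (k11 * k22 - k12 * k21) = Y e" for e
    using D by (simp add: divide_eq_eq algebra_simps)
  ultimately show "(Y \<longlongrightarrow> (k11 * f2 - k21 * f1) / (k11 * k22 - k12 * k21)) F" by simp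
qed

text \<open>The averaging argument.  \<open>Hu\<close>, \<open>Hv\<close> satisfy a linear equation forced by quadratic terms, whose coefficients
  of order \<open>n\<close> along the orbit are found from Cramer's rule (\<open>Gu\<close>, \<open>Gv\<close>, with determinant \<open>D n\<close>); only \<open>n = 0\<close> and
  \<open>n = 2\<close> can be moved to order one by the factors \<open>cnj U\<close>, \<open>cnj V\<close> of the cubic term \<open>E\<close>.  The equation for
  \<open>T\<close> is resonant at order one, so its solvability determines \<open>\<zeta>\<close> and \<open>\<xi>\<close>.\<close>

lemma resonant_coefficients:
  fixes Hu Hv T :: "complex \<times> complex \<Rightarrow> complex"
    and m11 m12 m21 m22 \<alpha> \<beta> \<gamma> k1 k2 k3 p1 p2 \<zeta> \<xi> :: complex
  defines "U \<equiv> \<lambda>z. fst z * p1 + snd z * p2" and "V \<equiv> \<lambda>z. fst z + snd z"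
  defines "E \<equiv> \<lambda>z. k1 * (cnj (U z) * Hv z + cnj (V z) * Hu z) + k2 * (cnj (U z) * Hu z) + k3 * (cnj (V z) * Hv z)"
  assumes "0 < \<omega>" "0 < r" "0 \<le> C"
    and dHu: "\<And>z. z \<in> ball 0 r \<Longrightarrow> (Hu has_derivative Hu' z) (at z)"
    and dHv: "\<And>z. z \<in> ball 0 r \<Longrightarrow> (Hv has_derivative Hv' z) (at z)"
    and dT: "\<And>z. z \<in> ball 0 r \<Longrightarrow> (T has_derivative T' z) (at z)"
    and eHu: "\<And>z. z \<in> ball 0 r \<Longrightarrow> norm (Hu' z (critical_flow \<omega> z)
        - (m11 * Hu z + m12 * Hv z + \<alpha> * (U z * V z))) \<le> C * norm z ^ 3"
    and eHv: "\<And>z. z \<in> ball 0 r \<Longrightarrow> norm (Hv' z (critical_flow \<omega> z)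
        - (m21 * Hu z + m22 * Hv z + (\<beta> * (U z)\<^sup>2 + \<gamma> * (V z)\<^sup>2))) \<le> C * norm z ^ 3"
    and eT: "\<And>z. z \<in> ball 0 r \<Longrightarrow> norm (T' z (critical_flow \<omega> z)
        - (\<i> * of_real \<omega> * T z + fst z * (\<zeta> * of_real ((cmod (fst z))\<^sup>2) + \<xi> * of_real ((cmod (snd z))\<^sup>2)) - E z))
        \<le> C * norm z ^ 4"
  defines "K \<equiv> \<lambda>n. \<i> * of_int n * of_real \<omega>"
  defines "D \<equiv> \<lambda>n. (K n - m11) * (K n - m22) - m12 * m21"
  assumes D0: "D 0 \<noteq> 0" and D2: "D 2 \<noteq> 0"
  defines "Gu \<equiv> \<lambda>n f1 f2. ((K n - m22) * f1 + m12 * f2) / D n"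
    and "Gv \<equiv> \<lambda>n f1 f2. ((K n - m11) * f2 + m21 * f1) / D n"
  defines "R \<equiv> \<lambda>q X Y. k1 * (q * Y + X) + k2 * (q * X) + k3 * Y"
  shows "\<zeta> = R (cnj p1) (Gu 2 (\<alpha> * p1) (\<beta> * p1\<^sup>2 + \<gamma>)) (Gv 2 (\<alpha> * p1) (\<beta> * p1\<^sup>2 + \<gamma>))"
    and "\<xi> = R (cnj p2) (Gu 0 (\<alpha> * (p1 + p2)) (2 * \<beta> * p1 * p2 + 2 * \<gamma>)) (Gv 0 (\<alpha> * (p1 + p2)) (2 * \<beta> * p1 * p2 + 2 * \<gamma>))"
proof -
  \<comment> \<open>Averages of the quadratic size \<open>e\<^sup>2\<close>, rescaled to have limits as \<open>e\<close> tends to zero.\<close>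
  define X where "X n s e = fourier_coeff n (\<lambda>x. Hu (critical_orbit s e x)) / of_real (e\<^sup>2)" for n s e
  define Y where "Y n s e = fourier_coeff n (\<lambda>x. Hv (critical_orbit s e x)) / of_real (e\<^sup>2)" for n s e
  have cH: "continuous_on (ball 0 r) Hu" "continuous_on (ball 0 r) Hv" "continuous_on (ball 0 r) T"
    by (rule has_derivative_continuous_on[OF has_derivative_at_withinI[OF dHu]]
      has_derivative_continuous_on[OF has_derivative_at_withinI[OF dHv]]
      has_derivative_continuous_on[OF has_derivative_at_withinI[OF dT]]; assumption)+
  have cUV: "continuous_on S U" "continuous_on S V" for S
    unfolding U_def V_def by (intro continuous_intros)+
  have cz: "continuous_on {0..2 * pi} (\<lambda>x. f (critical_orbit s e x))"
    if "continuous_on (ball 0 r) f" "\<And>x. critical_orbit s e x \<in> ball 0 r" for f :: "complex \<times> complex \<Rightarrow> complex" and s e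
    by (rule continuous_on_compose2[OF that(1) continuous_on_critical_orbit]) (use that(2) in auto)
  define quad where "quad a1 b1 a2 b2 s e x =
    cis (of_int 2 * x) * (of_real (e\<^sup>2) * (a1 * a2)) + (cis (of_int 0 * x) * (of_real (e\<^sup>2) * of_real s * (a1 * b2 + b1 * a2))
      + cis (of_int (- 2) * x) * (of_real (e\<^sup>2) * of_real (s\<^sup>2) * (b1 * b2)))" for a1 b1 a2 b2 s e x
  have quad: "(fst (critical_orbit s e x) * a1 + snd (critical_orbit s e x) * b1)
      * (fst (critical_orbit s e x) * a2 + snd (critical_orbit s e x) * b2) = quad a1 b1 a2 b2 s e x"
    for s e x a1 b1 a2 b2
  proof -
    have c2: "cis (2 * x) = cis x * cis x" "cis (- (2 * x)) = cis (- x) * cis (- x)" "cis x * cis (- x) = 1"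
      by (simp_all add: cis_mult)
    show ?thesis
      unfolding quad_def critical_orbit_def using c2(3)
      by (simp add: c2(1,2) power2_eq_square) algebra
  qed
  have cc: "continuous_on {0..2 * pi} (\<lambda>x. cis (of_int m * x) * k)" for m k
    by (intro continuous_intros)
  have fq: "fourier_coeff n (quad a1 b1 a2 b2 s e) = (if n = 2 then of_real (e\<^sup>2) * (a1 * a2) else 0)
      + ((if n = 0 then of_real (e\<^sup>2) * of_real s * (a1 * b2 + b1 * a2) else 0)
      + (if n = - 2 then of_real (e\<^sup>2) * of_real (s\<^sup>2) * (b1 * b2) else 0))"
    for n a1 b1 a2 b2 s e
    unfolding quad_def by (simp only: fourier_coeff_add continuous_on_add cc fourier_coeff_cis)
  have UVq: "U (critical_orbit s e x) * V (critical_orbit s e x) = quad p1 p2 1 1 s e x"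
    "(U (critical_orbit s e x))\<^sup>2 = quad p1 p2 p1 p2 s e x"
    "(V (critical_orbit s e x))\<^sup>2 = quad 1 1 1 1 s e x" for s e x
    using quad[of s e x p1 p2 1 1] quad[of s e x p1 p2 p1 p2] quad[of s e x 1 1 1 1]
    by (simp_all add: U_def V_def power2_eq_square)
  have small: "\<forall>\<^sub>F e in at_right 0. 0 < e \<and> (\<forall>x. critical_orbit s e x \<in> ball 0 r)" if s: "\<bar>s\<bar> \<le> 1" for s
  proof -
    have "\<forall>\<^sub>F e in at_right 0. e < r / 2 \<and> 0 < e"
      using \<open>0 < r\<close> by (intro eventually_conj eventually_at_rightI[of 0 "r / 2"]) auto
    then show ?thesis
    proof eventually_elim
      case (elim e)
      then have "norm (critical_orbit s e x) < r" for x
        using norm_critical_orbit[OF s, of e x] by linarith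
      then show ?case using elim by simp
    qed
  qed
  have pow: "C * norm (critical_orbit s e x) ^ j \<le> 2 ^ j * C * e ^ j" if "\<bar>s\<bar> \<le> 1" "0 < e" for s e x j
    using power_mono[OF norm_critical_orbit[OF that(1), of e x], of j] that(2) \<open>0 \<le> C\<close>
    by (simp add: power_mult_distrib mult.assoc mult_left_mono mult.left_commute)
  have lim1: "((\<lambda>e. (K n - m11) * X n s e + (- m12) * Y n s e) \<longlongrightarrow> \<alpha> * (if n = 2 then p1 else of_real s * (p1 + p2))) (at_right 0)"
    and lim2: "((\<lambda>e. (- m21) * X n s e + (K n - m22) * Y n s e) \<longlongrightarrow>
       (if n = 2 then \<beta> * p1\<^sup>2 + \<gamma> else of_real s * (2 * \<beta> * p1 * p2 + 2 * \<gamma>))) (at_right 0)"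
    if n: "n = 2 \<or> n = 0" and s: "\<bar>s\<bar> \<le> 1" for n :: int and s
  proof -
    have "\<forall>\<^sub>F e in at_right 0. norm ((K n - m11) * X n s e + (- m12) * Y n s e
      - \<alpha> * (if n = 2 then p1 else of_real s * (p1 + p2))) \<le> 8 * C * e \<and>
      norm ((- m21) * X n s e + (K n - m22) * Y n s e
      - (if n = 2 then \<beta> * p1\<^sup>2 + \<gamma> else of_real s * (2 * \<beta> * p1 * p2 + 2 * \<gamma>))) \<le> 8 * C * e"
      using small[OF s]
    proof eventually_elim
      case (elim e)
      then have e: "0 < e" and inb: "\<And>x. critical_orbit s e x \<in> ball 0 r" by auto
      let ?z = "critical_orbit s e"
      let ?hu = "fourier_coeff n (\<lambda>x. Hu (?z x))" and ?hv = "fourier_coeff n (\<lambda>x. Hv (?z x))"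
      have cqs: "continuous_on {0..2 * pi} (\<lambda>x. quad a1 b1 a2 b2 s e x)" for a1 b1 a2 b2
        unfolding quad_def by (intro continuous_intros)
      note lin = fourier_coeff_add fourier_coeff_cmult continuous_on_add continuous_on_mult continuous_on_const
      have 1: "norm (K n * ?hu - fourier_coeff n (\<lambda>x. m11 * Hu (?z x) + m12 * Hv (?z x) + \<alpha> * (U (?z x) * V (?z x)))) \<le> 2 ^ 3 * C * e ^ 3"
        unfolding K_def
      proof (rule fourier_coeff_along_orbit[OF \<open>0 < \<omega>\<close> inb dHu])
        show "continuous_on (ball 0 r) (\<lambda>z. m11 * Hu z + m12 * Hv z + \<alpha> * (U z * V z))"
          by (intro continuous_intros cH cUV)
      qed (assumption | rule order.trans[OF eHu[OF inb] pow[OF s e]])+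
      have 2: "norm (K n * ?hv - fourier_coeff n (\<lambda>x. m21 * Hu (?z x) + m22 * Hv (?z x) + (\<beta> * (U (?z x))\<^sup>2 + \<gamma> * (V (?z x))\<^sup>2))) \<le> 2 ^ 3 * C * e ^ 3"
        unfolding K_def
      proof (rule fourier_coeff_along_orbit[OF \<open>0 < \<omega>\<close> inb dHv])
        show "continuous_on (ball 0 r) (\<lambda>z. m21 * Hu z + m22 * Hv z + (\<beta> * (U z)\<^sup>2 + \<gamma> * (V z)\<^sup>2))"
          by (intro continuous_intros cH cUV)
      qed (assumption | rule order.trans[OF eHv[OF inb] pow[OF s e]])+
      have 3: "fourier_coeff n (\<lambda>x. m11 * Hu (?z x) + m12 * Hv (?z x) + \<alpha> * (U (?z x) * V (?z x)))
          = m11 * ?hu + m12 * ?hv + \<alpha> * fourier_coeff n (quad p1 p2 1 1 s e)"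
        by (simp only: UVq lin cz[OF cH(1) inb] cz[OF cH(2) inb] cqs)
      have 4: "fourier_coeff n (\<lambda>x. m21 * Hu (?z x) + m22 * Hv (?z x) + (\<beta> * (U (?z x))\<^sup>2 + \<gamma> * (V (?z x))\<^sup>2))
          = m21 * ?hu + m22 * ?hv + (\<beta> * fourier_coeff n (quad p1 p2 p1 p2 s e) + \<gamma> * fourier_coeff n (quad 1 1 1 1 s e))"
        by (simp only: UVq lin cz[OF cH(1) inb] cz[OF cH(2) inb] cqs)
      have h: "?hu = of_real (e\<^sup>2) * X n s e" "?hv = of_real (e\<^sup>2) * Y n s e"
        using e by (simp_all add: X_def Y_def)
      have r1: "K n * ?hu - (m11 * ?hu + m12 * ?hv + \<alpha> * fourier_coeff n (quad p1 p2 1 1 s e))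
         = of_real (e\<^sup>2) * ((K n - m11) * X n s e + (- m12) * Y n s e - \<alpha> * (if n = 2 then p1 else of_real s * (p1 + p2)))"
        unfolding h fq using n by (auto simp: algebra_simps)
      have r2: "K n * ?hv - (m21 * ?hu + m22 * ?hv + (\<beta> * fourier_coeff n (quad p1 p2 p1 p2 s e) + \<gamma> * fourier_coeff n (quad 1 1 1 1 s e)))
         = of_real (e\<^sup>2) * ((- m21) * X n s e + (K n - m22) * Y n s e
            - (if n = 2 then \<beta> * p1\<^sup>2 + \<gamma> else of_real s * (2 * \<beta> * p1 * p2 + 2 * \<gamma>)))"
        unfolding h fq using n by (auto simp: algebra_simps power2_eq_square[of p1])
      have div: "norm w \<le> 8 * C * e" if "norm (of_real (e\<^sup>2) * w) \<le> 2 ^ 3 * C * e ^ 3" for w :: complex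
      proof -
        have "e\<^sup>2 * norm w \<le> e\<^sup>2 * (8 * C * e)"
          using that by (simp add: norm_mult norm_power power2_eq_square power3_eq_cube mult_ac)
        then show ?thesis
          using e by simp
      qed
      show ?case
        using div[of "(K n - m11) * X n s e + (- m12) * Y n s e - \<alpha> * (if n = 2 then p1 else of_real s * (p1 + p2))"]
         div[of "(- m21) * X n s e + (K n - m22) * Y n s e
            - (if n = 2 then \<beta> * p1\<^sup>2 + \<gamma> else of_real s * (2 * \<beta> * p1 * p2 + 2 * \<gamma>))"] 1 2
        unfolding 3 4 r1 r2 by blast
    qed
    then show "((\<lambda>e. (K n - m11) * X n s e + (- m12) * Y n s e) \<longlongrightarrow> \<alpha> * (if n = 2 then p1 else of_real s * (p1 + p2))) (at_right 0)"
     "((\<lambda>e. (- m21) * X n s e + (K n - m22) * Y n s e) \<longlongrightarrow>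
       (if n = 2 then \<beta> * p1\<^sup>2 + \<gamma> else of_real s * (2 * \<beta> * p1 * p2 + 2 * \<gamma>))) (at_right 0)"
      by (auto intro!: tendsto_linear_rate[where K="8 * C"] elim!: eventually_mono)
  qed
  have det: "(K n - m11) * (K n - m22) - (- m12) * (- m21) = D n" for n
    by (simp add: D_def)
  define a1 a2 where "a1 = \<alpha> * p1" and "a2 = \<beta> * p1\<^sup>2 + \<gamma>"
  define b1 b2 where "b1 = \<alpha> * (p1 + p2)" and "b2 = 2 * \<beta> * p1 * p2 + 2 * \<gamma>"
  have lim: "(X 2 s \<longlongrightarrow> Gu 2 a1 a2) (at_right 0)" "(Y 2 s \<longlongrightarrow> Gv 2 a1 a2) (at_right 0)"
    "(X 0 s \<longlongrightarrow> of_real s * Gu 0 b1 b2) (at_right 0)" "(Y 0 s \<longlongrightarrow> of_real s * Gv 0 b1 b2) (at_right 0)"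
    if s: "\<bar>s\<bar> \<le> 1" for s
  proof -
    note l2 = tendsto_linear_solve[OF lim1[of 2, OF _ s] lim2[of 2, OF _ s], unfolded det, OF _ _ D2]
    note l0 = tendsto_linear_solve[OF lim1[of 0, OF _ s] lim2[of 0, OF _ s], unfolded det, OF _ _ D0]
    show "(X 2 s \<longlongrightarrow> Gu 2 a1 a2) (at_right 0)" "(Y 2 s \<longlongrightarrow> Gv 2 a1 a2) (at_right 0)"
      using l2 by (simp_all add: Gu_def Gv_def a1_def a2_def)
    have "((K 0 - m22) * (of_real s * b1) - (- m12) * (of_real s * b2)) / D 0 = of_real s * Gu 0 b1 b2"
      "((K 0 - m11) * (of_real s * b2) - (- m21) * (of_real s * b1)) / D 0 = of_real s * Gv 0 b1 b2"
      by (simp_all add: Gu_def Gv_def algebra_simps)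
    then show "(X 0 s \<longlongrightarrow> of_real s * Gu 0 b1 b2) (at_right 0)" "(Y 0 s \<longlongrightarrow> of_real s * Gv 0 b1 b2) (at_right 0)"
      using l0 by (simp_all add: b1_def b2_def mult.left_commute[of \<alpha>])
  qed
  have main: "\<zeta> + of_real (s\<^sup>2) * \<xi> = R (cnj p1) (Gu 2 a1 a2) (Gv 2 a1 a2) + of_real (s\<^sup>2) * R (cnj p2) (Gu 0 b1 b2) (Gv 0 b1 b2)"
    if s: "\<bar>s\<bar> \<le> 1" for s
  proof -
    define J where "J e = R (cnj p1) (X 2 s e) (Y 2 s e) + of_real s * R (cnj p2) (X 0 s e) (Y 0 s e)" for e
    have "\<forall>\<^sub>F e in at_right 0. norm (J e - (\<zeta> + of_real (s\<^sup>2) * \<xi>)) \<le> 16 * C * e"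
      using small[OF s]
    proof eventually_elim
      case (elim e)
      then have e: "0 < e" and inb: "\<And>x. critical_orbit s e x \<in> ball 0 r" by auto
      let ?z = "critical_orbit s e"
      let ?t = "fourier_coeff 1 (\<lambda>x. T (?z x))"
      \<comment> \<open>The common form of \<open>cnj (U z) * f\<close> and \<open>cnj (V z) * f\<close> along the orbit.\<close>
      define wave where "wave a b f x = cis (of_int (- 1) * x) * (of_real e * a * f x) + cis (of_int 1 * x) * (of_real e * of_real s * b * f x)"
        for a b :: complex and f x
      have 1: "norm (\<i> * of_int 1 * of_real \<omega> * ?t - fourier_coeff 1 (\<lambda>x. \<i> * of_real \<omega> * T (?z x)
        + fst (?z x) * (\<zeta> * of_real ((cmod (fst (?z x)))\<^sup>2) + \<xi> * of_real ((cmod (snd (?z x)))\<^sup>2)) - E (?z x))) \<le> 2 ^ 4 * C * e ^ 4"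
      proof (rule fourier_coeff_along_orbit[OF \<open>0 < \<omega>\<close> inb dT])
        show "continuous_on (ball 0 r) (\<lambda>z. \<i> * of_real \<omega> * T z
        + fst z * (\<zeta> * of_real ((cmod (fst z))\<^sup>2) + \<xi> * of_real ((cmod (snd z))\<^sup>2)) - E z)"
          unfolding E_def by (intro continuous_intros cH cUV)
      qed (assumption | rule order.trans[OF eT[OF inb] pow[OF s e]])+
      have w: "cnj (U (?z x)) * f x = wave (cnj p1) (cnj p2) f x" "cnj (V (?z x)) * f x = wave 1 1 f x" for f x
        by (simp_all add: U_def V_def wave_def critical_orbit_def cis_cnj algebra_simps)
      have Ew: "E (?z x) = k1 * (wave (cnj p1) (cnj p2) (\<lambda>x. Hv (?z x)) x + wave 1 1 (\<lambda>x. Hu (?z x)) x)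
          + k2 * wave (cnj p1) (cnj p2) (\<lambda>x. Hu (?z x)) x + k3 * wave 1 1 (\<lambda>x. Hv (?z x)) x" for x
        by (simp only: E_def w[symmetric])
      have cub: "fst (?z x) * (\<zeta> * of_real ((cmod (fst (?z x)))\<^sup>2) + \<xi> * of_real ((cmod (snd (?z x)))\<^sup>2))
          = cis (of_int 1 * x) * (of_real (e ^ 3) * (\<zeta> + of_real (s\<^sup>2) * \<xi>))" for x
        by (simp add: critical_orbit_def norm_mult power_mult_distrib power2_eq_square power3_eq_cube algebra_simps)
      have cw: "continuous_on {0..2 * pi} (wave a b f)" if "continuous_on {0..2 * pi} f" for a b f
        unfolding wave_def by (intro continuous_intros that)
      have fw: "fourier_coeff 1 (wave a b f) = of_real e * (a * fourier_coeff 2 f + of_real s * b * fourier_coeff 0 f)"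
        if f: "continuous_on {0..2 * pi} f" for a b f
      proof -
        have "continuous_on {0..2 * pi} (\<lambda>x. cis (of_int m * x) * (k * f x))" for m k
          by (intro continuous_intros f)
        then show ?thesis
          unfolding wave_def
          by (simp only: fourier_coeff_add fourier_coeff_shift fourier_coeff_cmult) (simp add: algebra_simps)
      qed
      note cc = cc[where m=1] and c = cz[OF cH(1) inb] cz[OF cH(2) inb] cz[OF cH(3) inb]
      have fE: "fourier_coeff 1 (\<lambda>x. E (?z x)) = of_real (e ^ 3) * J e"
      proof -
        have F: "fourier_coeff 1 (\<lambda>x. E (?z x)) =
            k1 * (fourier_coeff 1 (wave (cnj p1) (cnj p2) (\<lambda>x. Hv (?z x))) + fourier_coeff 1 (wave 1 1 (\<lambda>x. Hu (?z x))))
          + k2 * fourier_coeff 1 (wave (cnj p1) (cnj p2) (\<lambda>x. Hu (?z x))) + k3 * fourier_coeff 1 (wave 1 1 (\<lambda>x. Hv (?z x)))"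
          unfolding Ew
          by (simp only: fourier_coeff_add fourier_coeff_cmult continuous_on_add continuous_on_mult continuous_on_const cw c)
        have XY: "fourier_coeff n (\<lambda>x. Hu (?z x)) = of_real (e\<^sup>2) * X n s e"
          "fourier_coeff n (\<lambda>x. Hv (?z x)) = of_real (e\<^sup>2) * Y n s e" for n
          using e by (simp_all add: X_def Y_def)
        show ?thesis
          unfolding F fw[OF c(1)] fw[OF c(2)] XY
          by (simp add: J_def R_def power2_eq_square power3_eq_cube algebra_simps)
      qed
      have cE: "continuous_on {0..2 * pi} (\<lambda>x. E (?z x))"
        unfolding Ew by (intro continuous_intros cw c)
      have "fourier_coeff 1 (\<lambda>x. \<i> * of_real \<omega> * T (?z x)
        + fst (?z x) * (\<zeta> * of_real ((cmod (fst (?z x)))\<^sup>2) + \<xi> * of_real ((cmod (snd (?z x)))\<^sup>2)) - E (?z x))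
        = \<i> * of_real \<omega> * ?t + of_real (e ^ 3) * (\<zeta> + of_real (s\<^sup>2) * \<xi>) - of_real (e ^ 3) * J e"
        unfolding cub fE[symmetric]
        by (simp only: fourier_coeff_diff fourier_coeff_add fourier_coeff_cmult fourier_coeff_cis
            continuous_on_add continuous_on_mult continuous_on_const cc cE c) simp
      then have "\<i> * of_int 1 * of_real \<omega> * ?t - fourier_coeff 1 (\<lambda>x. \<i> * of_real \<omega> * T (?z x)
        + fst (?z x) * (\<zeta> * of_real ((cmod (fst (?z x)))\<^sup>2) + \<xi> * of_real ((cmod (snd (?z x)))\<^sup>2)) - E (?z x))
        = of_real (e ^ 3) * (J e - (\<zeta> + of_real (s\<^sup>2) * \<xi>))"
        by (simp add: algebra_simps)
      with 1 have "e ^ 3 * norm (J e - (\<zeta> + of_real (s\<^sup>2) * \<xi>)) \<le> e ^ 3 * (16 * C * e)"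
        using e by (simp add: norm_mult norm_power power4_eq_xxxx power3_eq_cube mult_ac)
      then show ?case
        using e by simp
    qed
    then have "(J \<longlongrightarrow> \<zeta> + of_real (s\<^sup>2) * \<xi>) (at_right 0)"
      by (rule tendsto_linear_rate)
    moreover have "(J \<longlongrightarrow> R (cnj p1) (Gu 2 a1 a2) (Gv 2 a1 a2)
        + of_real s * R (cnj p2) (of_real s * Gu 0 b1 b2) (of_real s * Gv 0 b1 b2)) (at_right 0)"
      unfolding J_def R_def by (intro tendsto_intros lim s)
    ultimately have "\<zeta> + of_real (s\<^sup>2) * \<xi> = R (cnj p1) (Gu 2 a1 a2) (Gv 2 a1 a2)
        + of_real s * R (cnj p2) (of_real s * Gu 0 b1 b2) (of_real s * Gv 0 b1 b2)"
      using tendsto_unique trivial_limit_at_right_real by blast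
    then show ?thesis
      by (simp add: R_def power2_eq_square algebra_simps)
  qed
  show "\<zeta> = R (cnj p1) (Gu 2 (\<alpha> * p1) (\<beta> * p1\<^sup>2 + \<gamma>)) (Gv 2 (\<alpha> * p1) (\<beta> * p1\<^sup>2 + \<gamma>))"
    using main[of 0] by (simp add: a1_def a2_def)
  moreover have "\<zeta> + \<xi> = R (cnj p1) (Gu 2 a1 a2) (Gv 2 a1 a2) + R (cnj p2) (Gu 0 b1 b2) (Gv 0 b1 b2)"
    using main[of 1] by simp
  ultimately show "\<xi> = R (cnj p2) (Gu 0 (\<alpha> * (p1 + p2)) (2 * \<beta> * p1 * p2 + 2 * \<gamma>)) (Gv 0 (\<alpha> * (p1 + p2)) (2 * \<beta> * p1 * p2 + 2 * \<gamma>))"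
    by (simp add: a1_def a2_def b1_def b2_def)
qed

section \<open>Orders of vanishing\<close>

text \<open>\<open>f(z) = O(|z|\<^sup>k)\<close> as \<open>z \<rightarrow> 0\<close>, for maps between arbitrary normed spaces and including the point \<open>z = 0\<close>.\<close>

definition order_at_0 :: "nat \<Rightarrow> ('a::real_normed_vector \<Rightarrow> 'b::real_normed_vector) \<Rightarrow> bool" where
  "order_at_0 k f \<longleftrightarrow> (\<exists>C\<ge>0. \<forall>\<^sub>F z in nhds 0. norm (f z) \<le> C * norm z ^ k)"

lemma order_at_0I:
  assumes "\<forall>\<^sub>F z in nhds 0. norm (f z) \<le> C * norm z ^ k"
  shows "order_at_0 k f"
proof -
  have "\<forall>\<^sub>F z in nhds 0. norm (f z) \<le> \<bar>C\<bar> * norm z ^ k"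
    using assms by eventually_elim (auto intro: order.trans[OF _ mult_right_mono])
  then show ?thesis unfolding order_at_0_def by (intro exI[of _ "\<bar>C\<bar>"]) simp
qed

lemma order_at_0_bound:
  assumes "order_at_0 k g" and "\<forall>\<^sub>F z in nhds 0. norm (f z) \<le> norm (g z)"
  shows "order_at_0 k f"
proof -
  from assms(1) obtain C where "\<forall>\<^sub>F z in nhds 0. norm (g z) \<le> C * norm z ^ k"
    unfolding order_at_0_def by auto
  with assms(2) have "\<forall>\<^sub>F z in nhds 0. norm (f z) \<le> C * norm z ^ k"
    by eventually_elim simp
  then show ?thesis by (rule order_at_0I)
qed

lemma order_at_0_cong:
  assumes "order_at_0 k g" and "\<forall>\<^sub>F z in nhds 0. f z = g z"
  shows "order_at_0 k f"
  using assms(1) by (rule order_at_0_bound) (use assms(2) in eventually_elim, simp)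

lemma order_at_0_add:
  assumes "order_at_0 k f" "order_at_0 k g"
  shows "order_at_0 k (\<lambda>z. f z + g z)"
proof -
  from assms obtain C D where "\<forall>\<^sub>F z in nhds 0. norm (f z) \<le> C * norm z ^ k"
    "\<forall>\<^sub>F z in nhds 0. norm (g z) \<le> D * norm z ^ k"
    unfolding order_at_0_def by auto
  then have "\<forall>\<^sub>F z in nhds 0. norm (f z + g z) \<le> (C + D) * norm z ^ k"
    by eventually_elim (auto intro: norm_triangle_le simp: distrib_right)
  then show ?thesis by (rule order_at_0I)
qed

lemma order_at_0_minus: "order_at_0 k f \<Longrightarrow> order_at_0 k (\<lambda>z. - f z)"
  by (simp add: order_at_0_def)

lemma order_at_0_diff:
  "order_at_0 k f \<Longrightarrow> order_at_0 k g \<Longrightarrow> order_at_0 k (\<lambda>z. f z - g z)"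
  using order_at_0_add[OF _ order_at_0_minus] by fastforce

lemma order_at_0_mult:
  fixes f g :: "'a::real_normed_vector \<Rightarrow> 'b::real_normed_algebra"
  assumes "order_at_0 j f" "order_at_0 k g"
  shows "order_at_0 (j + k) (\<lambda>z. f z * g z)"
proof -
  from assms obtain C D where "0 \<le> C" "\<forall>\<^sub>F z in nhds 0. norm (f z) \<le> C * norm z ^ j"
    "\<forall>\<^sub>F z in nhds 0. norm (g z) \<le> D * norm z ^ k"
    unfolding order_at_0_def by auto
  from this(2,3) have "\<forall>\<^sub>F z in nhds 0. norm (f z * g z) \<le> (C * D) * norm z ^ (j + k)"
  proof eventually_elim
    case (elim z)
    have "norm (f z * g z) \<le> norm (f z) * norm (g z)"
      by (rule norm_mult_ineq)
    also have "\<dots> \<le> (C * norm z ^ j) * (D * norm z ^ k)"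
      using elim \<open>0 \<le> C\<close> by (intro mult_mono) auto
    finally show ?case by (simp add: power_add mult_ac)
  qed
  then show ?thesis by (rule order_at_0I)
qed

lemma order_at_0_cmult:
  fixes f :: "'a::real_normed_vector \<Rightarrow> 'b::real_normed_algebra"
  assumes "order_at_0 k f"
  shows "order_at_0 k (\<lambda>z. b * f z)"
  using order_at_0_mult[of 0 "\<lambda>_. b" k f] assms order_at_0I[of "\<lambda>_. b" "norm b" 0] by simp

lemma order_at_0_mono:
  assumes "order_at_0 k f" "j \<le> k"
  shows "order_at_0 j f"
proof -
  from assms obtain C where "0 \<le> C" and C: "\<forall>\<^sub>F z in nhds 0. norm (f z) \<le> C * norm z ^ k"
    unfolding order_at_0_def by auto
  have "\<forall>\<^sub>F z in nhds 0. norm (z :: 'a) \<le> 1"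
    unfolding eventually_nhds_metric by (intro exI[of _ 1]) (auto simp: dist_norm)
  with C have "\<forall>\<^sub>F z in nhds 0. norm (f z) \<le> C * norm z ^ j"
  proof eventually_elim
    case (elim z)
    then show ?case
      using power_decreasing[OF assms(2), of "norm z"] \<open>0 \<le> C\<close> by (auto intro: order.trans mult_left_mono)
  qed
  then show ?thesis by (rule order_at_0I)
qed

lemma order_at_0_Pair:
  assumes "order_at_0 k f" "order_at_0 k g"
  shows "order_at_0 k (\<lambda>z. (f z, g z))"
proof -
  from assms obtain C D where "\<forall>\<^sub>F z in nhds 0. norm (f z) \<le> C * norm z ^ k"
    "\<forall>\<^sub>F z in nhds 0. norm (g z) \<le> D * norm z ^ k"
    unfolding order_at_0_def by auto
  then have "\<forall>\<^sub>F z in nhds 0. norm (f z, g z) \<le> (C + D) * norm z ^ k"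
    by eventually_elim (auto intro: order.trans[OF norm_Pair_le] simp: distrib_right)
  then show ?thesis by (rule order_at_0I)
qed

lemma order_at_0_fst: "order_at_0 k f \<Longrightarrow> order_at_0 k (\<lambda>z. fst (f z))"
  and order_at_0_snd: "order_at_0 k f \<Longrightarrow> order_at_0 k (\<lambda>z. snd (f z))"
  using norm_fst_le norm_snd_le by (auto elim!: order_at_0_bound simp: norm_prod_def real_le_rsqrt)

lemma order_at_0_linear:
  assumes "bounded_linear f"
  shows "order_at_0 1 f"
proof -
  from bounded_linear.bounded[OF assms] obtain K where "\<And>x. norm (f x) \<le> norm x * K" by blast
  then show ?thesis by (intro order_at_0I[of _ K]) (simp add: mult.commute)
qed

text \<open>A derivative that vanishes at the origin gains one order: this makes \<open>DH(z)\<close> and \<open>DT(z)\<close> insensitive to the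
  nonlinear part of the vector field.\<close>

lemma order_at_0_derivative:
  assumes "order_at_0 k y" and F: "\<forall>\<^sub>F z in nhds 0. \<forall>v. norm (F z v) \<le> B * norm z * norm v"
  shows "order_at_0 (Suc k) (\<lambda>z. F z (y z))"
proof -
  from assms(1) obtain C where "0 \<le> C" "\<forall>\<^sub>F z in nhds 0. norm (y z) \<le> C * norm z ^ k"
    unfolding order_at_0_def by auto
  from this(2) F have "\<forall>\<^sub>F z in nhds 0. norm (F z (y z)) \<le> (\<bar>B\<bar> * C) * norm z ^ Suc k"
  proof eventually_elim
    case (elim z)
    have "norm (F z (y z)) \<le> \<bar>B\<bar> * norm z * norm (y z)"
      using elim by (intro order.trans[OF spec[OF elim(2)]] mult_right_mono) auto
    also have "\<dots> \<le> \<bar>B\<bar> * norm z * (C * norm z ^ k)"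
      using elim by (intro mult_left_mono) auto
    finally show ?case by (simp add: mult_ac)
  qed
  then show ?thesis by (rule order_at_0I)
qed

lemma order_at_0_tangent:
  assumes "order_at_0 2 (\<lambda>z. f z - z)"
  shows "(f has_derivative (\<lambda>v. v)) (at 0)"
proof -
  from assms obtain C d where "0 \<le> C" "0 < d" and d: "\<And>z. norm z < d \<Longrightarrow> norm (f z - z) \<le> C * norm z ^ 2"
    unfolding order_at_0_def eventually_nhds_metric by auto
  have f0: "f 0 = 0" using d[of 0] \<open>0 < d\<close> by simp
  have "\<exists>e'>0. \<forall>y. norm (y - 0) < e' \<longrightarrow> norm (f y - f 0 - (y - 0)) \<le> e * norm (y - 0)" if "0 < e" for e
  proof (intro exI conjI allI impI)
    show "0 < min d (e / (C + 1))" using \<open>0 < d\<close> \<open>0 < e\<close> \<open>0 \<le> C\<close> by simp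
    fix y :: 'a assume "norm (y - 0) < min d (e / (C + 1))"
    then have y: "norm y < d" "norm y * (C + 1) < e"
      using \<open>0 \<le> C\<close> by (auto simp: pos_less_divide_eq)
    have "norm (f y - f 0 - (y - 0)) \<le> (C * norm y) * norm y"
      using d[OF y(1)] by (simp add: f0 power2_eq_square mult.assoc)
    also have "\<dots> \<le> e * norm y"
    proof (rule mult_right_mono)
      have "norm y * (C + 1) = C * norm y + norm y" by (simp add: algebra_simps)
      then show "C * norm y \<le> e" using y(2) norm_ge_zero[of y] by linarith
    qed simp
    finally show "norm (f y - f 0 - (y - 0)) \<le> e * norm (y - 0)" by simp
  qed
  then show ?thesis
    unfolding has_derivative_at_alt using bounded_linear_ident by simp
qed

lemma order_at_0_power:
  fixes f :: "'a::real_normed_vector \<Rightarrow> 'b::real_normed_algebra_1"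
  assumes "order_at_0 1 f"
  shows "order_at_0 n (\<lambda>z. f z ^ n)"
proof (induction n)
  case (Suc n)
  then show ?case using order_at_0_mult[OF assms, of n] by simp
qed (auto intro: order_at_0I[of _ 1])

lemma order_at_0_mult_diff:
  fixes f f' g g' :: "'a::real_normed_vector \<Rightarrow> 'b::real_normed_algebra"
  assumes "order_at_0 j f" "order_at_0 k g'" "order_at_0 (j + m) (\<lambda>z. f z - f' z)" "order_at_0 (k + m) (\<lambda>z. g z - g' z)"
  shows "order_at_0 (j + k + m) (\<lambda>z. f z * g z - f' z * g' z)"
  using order_at_0_add[OF order_at_0_mult[OF assms(1,4)], of "\<lambda>z. (f z - f' z) * g' z"] order_at_0_mult[OF assms(3,2)]
  by (simp add: algebra_simps)

lemma has_derivative_along_curve: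
  assumes F: "(F has_derivative F') (at z0)" and z: "z 0 = z0" "(z has_vector_derivative y) (at 0)"
  shows "((\<lambda>s. F (z s)) has_vector_derivative F' y) (at 0)"
proof -
  interpret F': bounded_linear F' using F by (rule has_derivative_bounded_linear)
  have "((\<lambda>s. F (z s)) has_derivative (\<lambda>s. F' (s *\<^sub>R y))) (at 0)"
    using has_derivative_compose[OF z(2)[unfolded has_vector_derivative_def]] F z(1) by blast
  then show ?thesis by (simp add: has_vector_derivative_def F'.scaleR)
qed

section \<open>The equations on the center manifold\<close>

lemma bounded_linear_fourier_coeff:
  fixes p :: "'b::real_normed_vector \<Rightarrow> real"
  assumes p: "bounded_linear p" and "\<And>y. \<bar>p y\<bar> \<le> norm y"
  shows "bounded_linear (\<lambda>w. fourier_coeff n (\<lambda>x. of_real (p (apply_bcontfun w x))))"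
    and "norm (fourier_coeff n (\<lambda>x. of_real (p (apply_bcontfun w x)))) \<le> norm w"
proof -
  have cont: "continuous_on S (\<lambda>x. complex_of_real (p (apply_bcontfun w x)))" for S and w :: "real \<Rightarrow>\<^sub>C 'b"
    by (intro continuous_on_of_real bounded_linear.continuous_on[OF p] continuous_on_apply_bcontfun)
  show bound: "norm (fourier_coeff n (\<lambda>x. of_real (p (apply_bcontfun w x)))) \<le> norm w" for w
    using assms(2) norm_bounded order.trans by (intro fourier_coeff_bound cont) fastforce
  show "bounded_linear (\<lambda>w. fourier_coeff n (\<lambda>x. of_real (p (apply_bcontfun w x))))"
  proof (rule bounded_linear_intro[where K = 1])
    show "fourier_coeff n (\<lambda>x. of_real (p (apply_bcontfun (v + w) x)))
      = fourier_coeff n (\<lambda>x. of_real (p (apply_bcontfun v x))) + fourier_coeff n (\<lambda>x. of_real (p (apply_bcontfun w x)))" for v w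
      using fourier_coeff_add[OF cont[of _ v] cont[of _ w], of n]
      by (simp add: linear_add[OF bounded_linear.linear[OF p]])
    show "fourier_coeff n (\<lambda>x. of_real (p (apply_bcontfun (r *\<^sub>R w) x)))
      = r *\<^sub>R fourier_coeff n (\<lambda>x. of_real (p (apply_bcontfun w x)))" for r w
      using fourier_coeff_cmult[of n "of_real r" "\<lambda>x. of_real (p (apply_bcontfun w x))"]
      by (simp add: linear_cmul[OF bounded_linear.linear[OF p]] scaleR_conv_of_real)
  qed (use bound in simp)
qed

text \<open>Fixed center manifold and normal form, to be used at \<open>\<delta>\<^sub>c\<close> only.  The amplitudes \<open>z = (A, B)\<close> enter
  the mode-one coefficients of \<open>u\<close> and \<open>v\<close> through \<open>U z\<close> and \<open>V z\<close>; \<open>p1\<close> and \<open>p2\<close> are the first entries of the critical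
  eigenvectors.  \<open>Hu\<close>, \<open>Hv\<close> is the mode two of the remainder, \<open>Nu n\<close>, \<open>Nv n\<close> are the nonlinear terms in mode \<open>n\<close>,
  and \<open>nonlin\<close> is their projection on the critical eigenvectors for \<open>n = 1\<close>.\<close>

locale reduced_flow =
  fixes a c g11 g21 g22 \<rho> :: real
    and h :: "real \<times> complex \<times> complex \<Rightarrow> (real \<Rightarrow>\<^sub>C (real \<times> real))"
    and \<theta> :: "real \<times> complex \<times> complex \<Rightarrow> complex \<times> complex"
    and \<zeta> \<xi> :: complex
  assumes a: "0 < a" and ac: "a < c"
    and cm: "local_center_manifold a c g11 g21 g22 \<rho> h"
    and nf: "O2_Hopf_normal_form a c g11 g21 g22 \<rho> h \<theta> \<zeta> \<xi>"
begin

definition \<omega> :: real where "\<omega> = sqrt (c\<^sup>2 - a\<^sup>2)"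
definition p1 :: complex where "p1 = \<i> / (of_real a + \<i> * of_real \<omega>)"
definition p2 :: complex where "p2 = \<i> / (of_real a - \<i> * of_real \<omega>)"
definition U :: "complex \<times> complex \<Rightarrow> complex" where "U z = fst z * p1 + snd z * p2"
definition V :: "complex \<times> complex \<Rightarrow> complex" where "V z = fst z + snd z"

definition hc :: "complex \<times> complex \<Rightarrow> (real \<Rightarrow>\<^sub>C (real \<times> real))" where "hc z = h (\<delta>_crit a, z)"
definition u :: "complex \<times> complex \<Rightarrow> real \<Rightarrow> real" where "u z x = fst (manifold_point a c h (\<delta>_crit a) z x)"
definition v :: "complex \<times> complex \<Rightarrow> real \<Rightarrow> real" where "v z x = snd (manifold_point a c h (\<delta>_crit a) z x)"

definition mode_u :: "int \<Rightarrow> (real \<Rightarrow>\<^sub>C (real \<times> real)) \<Rightarrow> complex" where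
  "mode_u n w = fourier_coeff n (\<lambda>x. of_real (fst (apply_bcontfun w x)))"
definition mode_v :: "int \<Rightarrow> (real \<Rightarrow>\<^sub>C (real \<times> real)) \<Rightarrow> complex" where
  "mode_v n w = fourier_coeff n (\<lambda>x. of_real (snd (apply_bcontfun w x)))"

definition Hu :: "complex \<times> complex \<Rightarrow> complex" where "Hu z = mode_u 2 (hc z)"
definition Hv :: "complex \<times> complex \<Rightarrow> complex" where "Hv z = mode_v 2 (hc z)"

definition Nu :: "int \<Rightarrow> complex \<times> complex \<Rightarrow> complex" where
  "Nu n z = \<i> * of_int n * (of_real g11 * fourier_coeff n (\<lambda>x. of_real (u z x * v z x)))"
definition Nv :: "int \<Rightarrow> complex \<times> complex \<Rightarrow> complex" where
  "Nv n z = \<i> * of_int n * (of_real (g21 / 2) * fourier_coeff n (\<lambda>x. of_real ((u z x)\<^sup>2))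
                        + of_real (g22 / 2) * fourier_coeff n (\<lambda>x. of_real ((v z x)\<^sup>2)))"

definition nonlin :: "complex \<times> complex \<Rightarrow> complex \<times> complex" where
  "nonlin z = ((Nu 1 z - p2 * Nv 1 z) / (p1 - p2), (p1 * Nv 1 z - Nu 1 z) / (p1 - p2))"

lemma omega: "0 < \<omega>" "\<omega>\<^sup>2 = c\<^sup>2 - a\<^sup>2"
  using a ac power_strict_mono[of a c 2] by (auto simp: \<omega>_def)

lemma p1: "p1 * (of_real a + \<i> * of_real \<omega>) = \<i>" and p2: "p2 * (of_real a - \<i> * of_real \<omega>) = \<i>"
  using a by (simp_all add: p1_def p2_def complex_eq_iff)

lemma csq: "complex_of_real (c\<^sup>2) = (of_real a + \<i> * of_real \<omega>) * (of_real a - \<i> * of_real \<omega>)"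
  using omega(2) by (simp add: complex_eq_iff power2_eq_square)

text \<open>The second rows of the eigenvector equations.\<close>

lemma p_eigen:
  "\<i> * of_real (c\<^sup>2) * p1 = - of_real a + \<i> * of_real \<omega>"
  "\<i> * of_real (c\<^sup>2) * p2 = - of_real a - \<i> * of_real \<omega>"
proof -
  have "\<i> * of_real (c\<^sup>2) * p1 = \<i> * (of_real a - \<i> * of_real \<omega>) * (p1 * (of_real a + \<i> * of_real \<omega>))"
    by (simp only: csq mult_ac)
  also have "\<dots> = - of_real a + \<i> * of_real \<omega>"
    unfolding p1 by (simp add: complex_eq_iff)
  finally show "\<i> * of_real (c\<^sup>2) * p1 = - of_real a + \<i> * of_real \<omega>" .
  have "\<i> * of_real (c\<^sup>2) * p2 = \<i> * (of_real a + \<i> * of_real \<omega>) * (p2 * (of_real a - \<i> * of_real \<omega>))"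
    by (simp only: csq mult_ac)
  also have "\<dots> = - of_real a - \<i> * of_real \<omega>"
    unfolding p2 by (simp add: complex_eq_iff)
  finally show "\<i> * of_real (c\<^sup>2) * p2 = - of_real a - \<i> * of_real \<omega>" .
qed

lemma p1_neq_p2: "p1 - p2 \<noteq> 0"
proof
  assume "p1 - p2 = 0"
  then have "- of_real a + \<i> * of_real \<omega> = - of_real a - \<i> * of_real \<omega>"
    using p_eigen by (metis eq_iff_diff_eq_0)
  then show False
    using omega(1) by (simp add: complex_eq_iff)
qed

lemma amplitudes: "fst z = (U z - p2 * V z) / (p1 - p2)" "snd z = (p1 * V z - U z) / (p1 - p2)"
  using p1_neq_p2 by (simp_all add: U_def V_def eq_divide_eq algebra_simps)

lemma u_eq: "u z x = 2 * Re (cis x * U z) + fst (apply_bcontfun (hc z) x)"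
  and v_eq: "v z x = 2 * Re (cis x * V z) + snd (apply_bcontfun (hc z) x)"
proof -
  have p: "\<i> / (of_real a + beta1 a c (\<delta>_crit a)) = p1" "\<i> / (of_real a + beta2 a c (\<delta>_crit a)) = p2"
    unfolding beta_crit p1_def p2_def \<omega>_def by simp_all
  have "critical_part a c (\<delta>_crit a) z x = (2 * Re (cis x * U z), 2 * Re (cis x * V z))"
    unfolding critical_part_def Let_def eigvec_def p by (simp add: U_def V_def algebra_simps)
  then show "u z x = 2 * Re (cis x * U z) + fst (apply_bcontfun (hc z) x)"
    "v z x = 2 * Re (cis x * V z) + snd (apply_bcontfun (hc z) x)"
    by (simp_all add: u_def v_def hc_def manifold_point_def)
qed

lemma rho: "0 < \<rho>"
  using cm by (simp add: local_center_manifold_def)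

lemma mode_bounds: "norm (mode_u n w) \<le> norm w" "norm (mode_v n w) \<le> norm w"
  and mode_linear: "bounded_linear (mode_u n)" "bounded_linear (mode_v n)"
proof -
  have p: "\<bar>fst y\<bar> \<le> norm y" "\<bar>snd y\<bar> \<le> norm y" for y :: "real \<times> real"
    using norm_fst_le[of "fst y" "snd y"] norm_snd_le[of "snd y" "fst y"] by simp_all
  note u = bounded_linear_fourier_coeff[OF bounded_linear_fst p(1)]
  note v = bounded_linear_fourier_coeff[OF bounded_linear_snd p(2)]
  show "norm (mode_u n w) \<le> norm w" "norm (mode_v n w) \<le> norm w"
    "bounded_linear (mode_u n)" "bounded_linear (mode_v n)"
    unfolding mode_u_def[abs_def] mode_v_def[abs_def] by (rule u v)+
qed

lemma hc_cont: "continuous_on S (\<lambda>x. fst (apply_bcontfun (hc z) x))" "continuous_on S (\<lambda>x. snd (apply_bcontfun (hc z) x))"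
  by (intro continuous_intros continuous_on_apply_bcontfun)+

text \<open>The four vanishing modes of the graph: the mean value, and the modes over which the graph is taken.\<close>

lemma hc_modes:
  assumes z: "z \<in> ball 0 \<rho>"
  shows "mode_u 0 (hc z) = 0" "mode_v 0 (hc z) = 0" "mode_u 1 (hc z) = 0" "mode_v 1 (hc z) = 0"
proof -
  have mz: "mean_zero_periodic (apply_bcontfun (hc z))" and nc: "no_critical_part (apply_bcontfun (hc z))"
    using cm z rho unfolding local_center_manifold_def hc_def by auto
  have int: "(apply_bcontfun (hc z)) integrable_on {0..2 * pi}"
    by (intro integrable_continuous_real continuous_on_apply_bcontfun)
  have "integral {0..2 * pi} (\<lambda>x. fst (apply_bcontfun (hc z) x)) = 0"
    "integral {0..2 * pi} (\<lambda>x. snd (apply_bcontfun (hc z) x)) = 0"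
    using integral_linear[OF int bounded_linear_fst] integral_linear[OF int bounded_linear_snd] mz
    by (simp_all add: o_def mean_zero_periodic_def)
  then show "mode_u 0 (hc z) = 0" "mode_v 0 (hc z) = 0"
    using integral_linear[OF integrable_continuous_real[OF hc_cont(1)] bounded_linear_of_real[where ?'a = complex]]
      integral_linear[OF integrable_continuous_real[OF hc_cont(2)] bounded_linear_of_real[where ?'a = complex]]
    by (simp_all add: mode_u_def mode_v_def fourier_coeff_def o_def)
  show "mode_u 1 (hc z) = 0" "mode_v 1 (hc z) = 0"
    using nc by (simp_all add: mode_u_def mode_v_def fourier_coeff_def no_critical_part_def)
qed

text \<open>Differentiability of the amplitudes along a solution is not part of the notion of a solution on the manifold;
  it follows because the amplitudes are linear functions of the mode-one coefficients of the solution.\<close>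

lemma flow_on_manifold:
  assumes z0: "z0 \<in> ball 0 \<rho>"
  obtains \<tau> z where "0 < \<tau>" "z 0 = z0" "solution_on_manifold a c g11 g21 g22 \<rho> h (\<delta>_crit a) {-\<tau><..<\<tau>} z"
    "(z has_vector_derivative critical_flow \<omega> z0 + nonlin z0) (at 0)"
    "((\<lambda>s. Hu (z s)) has_vector_derivative - 16 * of_real a * Hu z0 + 2 * \<i> * Hv z0 + Nu 2 z0) (at 0)"
    "((\<lambda>s. Hv (z s)) has_vector_derivative 2 * \<i> * of_real (c\<^sup>2) * Hu z0 + (4 * of_real a - 12) * Hv z0 + Nv 2 z0) (at 0)"
proof -
  have "\<exists>\<tau>>0. \<exists>z. z 0 = z0 \<and> solution_on_manifold a c g11 g21 g22 \<rho> h (\<delta>_crit a) {-\<tau><..<\<tau>} z"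
    using cm z0 rho unfolding local_center_manifold_def by auto
  then obtain \<tau> z where \<tau>: "0 < \<tau>" and z: "z 0 = z0"
    and sol: "solution_on_manifold a c g11 g21 g22 \<rho> h (\<delta>_crit a) {-\<tau><..<\<tau>} z"
    by blast
  let ?I = "{-\<tau><..<\<tau>}"
  have inb: "z t \<in> ball 0 \<rho>" if "t \<in> ?I" for t
    using sol that unfolding solution_on_manifold_def by blast
  have cl: "classical_solution a c g11 g21 g22 (\<delta>_crit a) ?I (\<lambda>t x. u (z t) x) (\<lambda>t x. v (z t) x)"
    using sol unfolding solution_on_manifold_def u_def v_def by blast
  have I: "open ?I" "convex ?I" "0 \<in> ?I" using \<tau> by auto
  have mu: "fourier_coeff n (\<lambda>x. of_real (u (z t) x)) = (if n = 1 then U (z t) else if n = - 1 then cnj (U (z t)) else 0) + mode_u n (hc (z t))"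
    for n t unfolding mode_u_def by (rule fourier_coeff_wave[OF u_eq hc_cont(1)])
  have mv: "fourier_coeff n (\<lambda>x. of_real (v (z t) x)) = (if n = 1 then V (z t) else if n = - 1 then cnj (V (z t)) else 0) + mode_v n (hc (z t))"
    for n t unfolding mode_v_def by (rule fourier_coeff_wave[OF v_eq hc_cont(2)])
  note modes = classical_solution_modes[OF cl I, unfolded mu mv]
  have at1: "(if n = 1 then U (z s) else if n = - 1 then cnj (U (z s)) else 0) + mode_u n (hc (z s)) = U (z s)"
    "(if n = 1 then V (z s) else if n = - 1 then cnj (V (z s)) else 0) + mode_v n (hc (z s)) = V (z s)"
    if "s \<in> ?I" "n = 1" for s n
    using hc_modes(3,4)[OF inb[OF that(1)]] that(2) by simp_all
  have dU: "((\<lambda>s. U (z s)) has_vector_derivative \<i> * V z0 - of_real a * U z0 + Nu 1 z0) (at 0)"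
    using has_vector_derivative_transform_within_open[OF modes(1)[of 1] I(1,3) at1(1)[OF _ refl]] at1[OF I(3) refl]
    by (simp add: z Nu_def)
  have dV: "((\<lambda>s. V (z s)) has_vector_derivative \<i> * of_real (c\<^sup>2) * U z0 + of_real a * V z0 + Nv 1 z0) (at 0)"
    using has_vector_derivative_transform_within_open[OF modes(2)[of 1] I(1,3) at1(2)[OF _ refl]] at1[OF I(3) refl]
    by (simp add: z Nv_def \<delta>_crit_def algebra_simps)
  have dz1: "((\<lambda>s. fst (z s)) has_vector_derivative \<i> * of_real \<omega> * fst z0 + fst (nonlin z0)) (at 0)"
  proof -
    have e: "\<i> * of_real \<omega> * (U z0 - p2 * V z0) + (Nu 1 z0 - p2 * Nv 1 z0)
        = (\<i> * V z0 - of_real a * U z0 + Nu 1 z0) - p2 * (\<i> * of_real (c\<^sup>2) * U z0 + of_real a * V z0 + Nv 1 z0)"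
      (is "?l = ?r")
    proof -
      have "?l - ?r = U z0 * (\<i> * of_real (c\<^sup>2) * p2 - (- of_real a - \<i> * of_real \<omega>))
          + V z0 * (p2 * (of_real a - \<i> * of_real \<omega>) - \<i>)"
        by (simp add: algebra_simps)
      then have "?l - ?r = 0" unfolding p2 p_eigen(2) by simp
      then show ?thesis by (rule eq_iff_diff_eq_0[THEN iffD2])
    qed
    show ?thesis
      unfolding nonlin_def fst_conv snd_conv
      unfolding amplitudes times_divide_eq_right add_divide_distrib[symmetric] e
      by (rule has_vector_derivative_divide[OF has_vector_derivative_diff[OF dU has_vector_derivative_mult_right[OF dV, of p2]], of "p1 - p2"])
  qed
  have dz2: "((\<lambda>s. snd (z s)) has_vector_derivative - \<i> * of_real \<omega> * snd z0 + snd (nonlin z0)) (at 0)"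
  proof -
    have e: "- \<i> * of_real \<omega> * (p1 * V z0 - U z0) + (p1 * Nv 1 z0 - Nu 1 z0)
        = p1 * (\<i> * of_real (c\<^sup>2) * U z0 + of_real a * V z0 + Nv 1 z0) - (\<i> * V z0 - of_real a * U z0 + Nu 1 z0)"
      (is "?l = ?r")
    proof -
      have "?l - ?r = U z0 * (- of_real a + \<i> * of_real \<omega> - \<i> * of_real (c\<^sup>2) * p1)
          + V z0 * (\<i> - p1 * (of_real a + \<i> * of_real \<omega>))"
        by (simp add: algebra_simps)
      then have "?l - ?r = 0" unfolding p1 p_eigen(1) by simp
      then show ?thesis by (rule eq_iff_diff_eq_0[THEN iffD2])
    qed
    show ?thesis
      unfolding nonlin_def fst_conv snd_conv
      unfolding amplitudes times_divide_eq_right add_divide_distrib[symmetric] e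
      by (rule has_vector_derivative_divide[OF has_vector_derivative_diff[OF has_vector_derivative_mult_right[OF dV, of p1] dU], of "p1 - p2"])
  qed
  have dz: "(z has_vector_derivative critical_flow \<omega> z0 + nonlin z0) (at 0)"
    using has_vector_derivative_Pair[OF dz1 dz2] by (simp add: critical_flow_def plus_prod_def)
  show thesis
    by (rule that[OF \<tau> z sol dz]) (use modes[of 2] in \<open>simp_all add: z Hu_def Hv_def Nu_def Nv_def \<delta>_crit_def algebra_simps\<close>)
qed

lemma five_eq_Suc: "(5 :: nat) = Suc (Suc 3)"
  by simp

text \<open>Tangency makes the graph quadratic and its derivative linear in \<open>|z|\<close>.\<close>

lemma hc_C2:
  obtains C r h' where "0 < r" "r \<le> \<rho>" "0 \<le> C"
    "\<And>z. z \<in> ball 0 r \<Longrightarrow> (hc has_derivative h' z) (at z)"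
    "\<And>z w. z \<in> ball 0 r \<Longrightarrow> norm (h' z w) \<le> C * norm z * norm w"
    "order_at_0 2 hc"
proof -
  have dh: "(h has_derivative (\<lambda>_. 0)) (at (\<delta>_crit a, 0))"
    and C5: "C_k_on 5 h (ball (\<delta>_crit a) \<rho> \<times> ball 0 \<rho>)"
    and h0: "h (\<delta>_crit a, 0) = 0"
    using cm rho unfolding local_center_manifold_def by auto
  have "(Pair (\<delta>_crit a) has_derivative (\<lambda>w. (0, w))) (at (0 :: complex \<times> complex))"
    by (auto intro!: derivative_eq_intros)
  from has_derivative_compose[OF this dh]
  have L: "((\<lambda>z. h (\<delta>_crit a, z)) has_derivative (\<lambda>_. 0)) (at 0)" .
  obtain C r h' where r: "0 < r" "r \<le> \<rho>" "0 \<le> C"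
    and h': "\<And>z. z \<in> ball 0 r \<Longrightarrow> ((\<lambda>z. h (\<delta>_crit a, z)) has_derivative h' z) (at z)"
    "\<And>z w. z \<in> ball 0 r \<Longrightarrow> norm (h' z w - 0) \<le> C * norm z * norm w"
    by (rule C_2_slice[OF C5[unfolded five_eq_Suc] rho L]) blast
  have "order_at_0 2 hc"
  proof (rule order_at_0I)
    have "\<forall>\<^sub>F z in nhds 0. z \<in> ball (0 :: complex \<times> complex) r"
      using r(1) by (intro eventually_nhds_in_open) auto
    then show "\<forall>\<^sub>F z in nhds 0. norm (hc z) \<le> C * norm z ^ 2"
    proof eventually_elim
      case (elim z)
      show ?case
        using quadratic_bound[OF h'(1) _ r(3) h0 elim] h'(2) unfolding hc_def by simp
    qed
  qed
  then show thesis
    using that[of r C h'] r h' unfolding hc_def[abs_def] by simp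
qed

definition shift :: "complex \<times> complex \<Rightarrow> complex \<times> complex" where "shift z = \<theta> (\<delta>_crit a, z) - z"

text \<open>The cubic estimate on \<open>\<theta>(z) - z\<close> forces its derivative to vanish at the origin, and the latter is
  Lipschitz there.\<close>

lemma theta_C2:
  obtains C r t' where "0 < r" "r \<le> \<rho>" "0 \<le> C"
    "\<And>z. z \<in> ball 0 r \<Longrightarrow> (shift has_derivative t' z) (at z)"
    "\<And>z w. z \<in> ball 0 r \<Longrightarrow> norm (t' z w) \<le> C * norm z * norm w"
    "order_at_0 3 shift"
proof -
  have C5: "C_k_on 5 \<theta> (ball (\<delta>_crit a) \<rho> \<times> ball 0 \<rho>)"
    using nf unfolding O2_Hopf_normal_form_def by blast
  obtain K where K: "\<And>z. z \<in> ball 0 \<rho> \<Longrightarrow> norm (\<theta> (\<delta>_crit a, z) - z) \<le> K * norm z ^ 3"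
    using nf rho unfolding O2_Hopf_normal_form_def by (metis centre_in_ball)
  have inb: "\<forall>\<^sub>F z in nhds 0. z \<in> ball (0 :: complex \<times> complex) \<rho>"
    using rho by (intro eventually_nhds_in_open) auto
  have ord: "order_at_0 3 shift"
    by (rule order_at_0I[of _ K], use inb in eventually_elim) (simp add: shift_def K)
  have L: "((\<lambda>z. \<theta> (\<delta>_crit a, z)) has_derivative (\<lambda>v. v)) (at 0)"
    using order_at_0_mono[OF ord, of 2] by (intro order_at_0_tangent) (simp add: shift_def[abs_def])
  obtain C r t' where r: "0 < r" "r \<le> \<rho>" "0 \<le> C"
    and t': "\<And>z. z \<in> ball 0 r \<Longrightarrow> ((\<lambda>z. \<theta> (\<delta>_crit a, z)) has_derivative t' z) (at z)"
    "\<And>z w. z \<in> ball 0 r \<Longrightarrow> norm (t' z w - w) \<le> C * norm z * norm w"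
    by (rule C_2_slice[OF C5[unfolded five_eq_Suc] rho L]) blast
  show thesis
    using that[of r C "\<lambda>z w. t' z w - w"] r t' ord unfolding shift_def[abs_def]
    by (auto intro!: derivative_intros)
qed

lemma eventually_in_ball: "0 < r \<Longrightarrow> \<forall>\<^sub>F z in nhds 0. z \<in> ball (0 :: complex \<times> complex) r"
  by (intro eventually_nhds_in_open) auto

lemma critical_orders:
  shows "order_at_0 1 (\<lambda>z :: complex \<times> complex. fst z)" "order_at_0 1 (\<lambda>z :: complex \<times> complex. snd z)"
    and "order_at_0 1 U" "order_at_0 1 V" "order_at_0 1 (\<lambda>z. cnj (U z))" "order_at_0 1 (\<lambda>z. cnj (V z))"
    and "order_at_0 2 hc" "order_at_0 2 Hu" "order_at_0 2 Hv"
proof -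
  show fs: "order_at_0 1 (\<lambda>z :: complex \<times> complex. fst z)" "order_at_0 1 (\<lambda>z :: complex \<times> complex. snd z)"
    by (intro order_at_0_linear bounded_linear_fst bounded_linear_snd)+
  show U: "order_at_0 1 U" and V: "order_at_0 1 V"
    unfolding U_def[abs_def] V_def[abs_def]
    by (intro order_at_0_linear bounded_linear_add bounded_linear_mult_const bounded_linear_fst bounded_linear_snd)+
  show "order_at_0 1 (\<lambda>z. cnj (U z))" "order_at_0 1 (\<lambda>z. cnj (V z))"
    by (rule order_at_0_bound[OF U], simp, rule order_at_0_bound[OF V], simp)
  show h: "order_at_0 2 hc" using hc_C2 by blast
  show "order_at_0 2 Hu" "order_at_0 2 Hv"
    by (rule order_at_0_bound[OF h], simp add: Hu_def Hv_def mode_bounds)+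
qed

lemma product_modes:
  assumes z: "z \<in> ball 0 \<rho>"
  shows "norm (fourier_coeff 1 (\<lambda>x. of_real (u z x * v z x)) - (cnj (U z) * Hv z + cnj (V z) * Hu z)) \<le> (norm (hc z))\<^sup>2"
    "norm (fourier_coeff 1 (\<lambda>x. of_real ((u z x)\<^sup>2)) - 2 * (cnj (U z) * Hu z)) \<le> (norm (hc z))\<^sup>2"
    "norm (fourier_coeff 1 (\<lambda>x. of_real ((v z x)\<^sup>2)) - 2 * (cnj (V z) * Hv z)) \<le> (norm (hc z))\<^sup>2"
    "norm (fourier_coeff 2 (\<lambda>x. of_real (u z x * v z x)) - U z * V z) \<le> 2 * (norm (U z) + norm (V z)) * norm (hc z) + (norm (hc z))\<^sup>2"
    "norm (fourier_coeff 2 (\<lambda>x. of_real ((u z x)\<^sup>2)) - (U z)\<^sup>2) \<le> 2 * (norm (U z) + norm (U z)) * norm (hc z) + (norm (hc z))\<^sup>2"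
    "norm (fourier_coeff 2 (\<lambda>x. of_real ((v z x)\<^sup>2)) - (V z)\<^sup>2) \<le> 2 * (norm (V z) + norm (V z)) * norm (hc z) + (norm (hc z))\<^sup>2"
proof -
  have b: "\<bar>fst (apply_bcontfun (hc z) x)\<bar> \<le> norm (hc z)" "\<bar>snd (apply_bcontfun (hc z) x)\<bar> \<le> norm (hc z)" for x
    using norm_bounded[of "hc z" x] norm_fst_le[of "fst (apply_bcontfun (hc z) x)" "snd (apply_bcontfun (hc z) x)"]
      norm_snd_le[of "snd (apply_bcontfun (hc z) x)" "fst (apply_bcontfun (hc z) x)"] by simp_all
  note m = hc_modes(1,2)[OF z, unfolded mode_u_def mode_v_def]
  note uv = fourier_coeff_wave_product[OF u_eq v_eq hc_cont(1,2) m(1,2) b(1,2)]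
  note uu = fourier_coeff_wave_product[OF u_eq u_eq hc_cont(1,1) m(1,1) b(1,1)]
  note vv = fourier_coeff_wave_product[OF v_eq v_eq hc_cont(2,2) m(2,2) b(2,2)]
  note H = Hu_def Hv_def mode_u_def mode_v_def
  show "norm (fourier_coeff 1 (\<lambda>x. of_real (u z x * v z x)) - (cnj (U z) * Hv z + cnj (V z) * Hu z)) \<le> (norm (hc z))\<^sup>2"
    "norm (fourier_coeff 2 (\<lambda>x. of_real (u z x * v z x)) - U z * V z) \<le> 2 * (norm (U z) + norm (V z)) * norm (hc z) + (norm (hc z))\<^sup>2"
    using uv unfolding H .
  show "norm (fourier_coeff 1 (\<lambda>x. of_real ((u z x)\<^sup>2)) - 2 * (cnj (U z) * Hu z)) \<le> (norm (hc z))\<^sup>2"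
    "norm (fourier_coeff 2 (\<lambda>x. of_real ((u z x)\<^sup>2)) - (U z)\<^sup>2) \<le> 2 * (norm (U z) + norm (U z)) * norm (hc z) + (norm (hc z))\<^sup>2"
    using uu unfolding H power2_eq_square[of "u _ _"] power2_eq_square[of "U _"] mult_2 .
  show "norm (fourier_coeff 1 (\<lambda>x. of_real ((v z x)\<^sup>2)) - 2 * (cnj (V z) * Hv z)) \<le> (norm (hc z))\<^sup>2"
    "norm (fourier_coeff 2 (\<lambda>x. of_real ((v z x)\<^sup>2)) - (V z)\<^sup>2) \<le> 2 * (norm (V z) + norm (V z)) * norm (hc z) + (norm (hc z))\<^sup>2"
    using vv unfolding H power2_eq_square[of "v _ _"] power2_eq_square[of "V _"] mult_2 .
qed

lemma nonlinearity_orders: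
  shows "order_at_0 4 (\<lambda>z. Nu 1 z - \<i> * of_real g11 * (cnj (U z) * Hv z + cnj (V z) * Hu z))"
    and "order_at_0 4 (\<lambda>z. Nv 1 z - \<i> * (of_real g21 * (cnj (U z) * Hu z) + of_real g22 * (cnj (V z) * Hv z)))"
    and "order_at_0 3 (\<lambda>z. Nu 2 z - 2 * \<i> * of_real g11 * (U z * V z))"
    and "order_at_0 3 (\<lambda>z. Nv 2 z - (\<i> * of_real g21 * (U z)\<^sup>2 + \<i> * of_real g22 * (V z)\<^sup>2))"
proof -
  note ev = eventually_in_ball[OF rho]
  have hn: "order_at_0 2 (\<lambda>z. norm (hc z))" and Un: "order_at_0 1 (\<lambda>z. norm (U z))" and Vn: "order_at_0 1 (\<lambda>z. norm (V z))"
    by (rule order_at_0_bound[OF critical_orders(7)] order_at_0_bound[OF critical_orders(3)] order_at_0_bound[OF critical_orders(4)]; simp)+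
  have hh: "order_at_0 4 (\<lambda>z. (norm (hc z))\<^sup>2)"
    using order_at_0_mult[OF hn hn] by (simp add: power2_eq_square)
  have hU: "order_at_0 3 (\<lambda>z. 2 * (norm (w1 z) + norm (w2 z)) * norm (hc z) + (norm (hc z))\<^sup>2)"
    if "order_at_0 1 (\<lambda>z. norm (w1 z))" "order_at_0 1 (\<lambda>z. norm (w2 z))" for w1 w2 :: "complex \<times> complex \<Rightarrow> complex"
    using order_at_0_add[OF order_at_0_mult[OF order_at_0_cmult[OF order_at_0_add[OF that], of 2] hn] order_at_0_mono[OF hh, of "1+2"]]
    by (simp add: numeral_3_eq_3)
  have A: "order_at_0 4 (\<lambda>z. fourier_coeff 1 (\<lambda>x. of_real (u z x * v z x)) - (cnj (U z) * Hv z + cnj (V z) * Hu z))"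
    "order_at_0 4 (\<lambda>z. fourier_coeff 1 (\<lambda>x. of_real ((u z x)\<^sup>2)) - 2 * (cnj (U z) * Hu z))"
    "order_at_0 4 (\<lambda>z. fourier_coeff 1 (\<lambda>x. of_real ((v z x)\<^sup>2)) - 2 * (cnj (V z) * Hv z))"
    by (rule order_at_0_bound[OF hh], use ev in eventually_elim, use product_modes in \<open>simp only: real_norm_def abs_of_nonneg zero_le_power2\<close>)+
  have B: "order_at_0 3 (\<lambda>z. fourier_coeff 2 (\<lambda>x. of_real (u z x * v z x)) - U z * V z)"
    "order_at_0 3 (\<lambda>z. fourier_coeff 2 (\<lambda>x. of_real ((u z x)\<^sup>2)) - (U z)\<^sup>2)"
    "order_at_0 3 (\<lambda>z. fourier_coeff 2 (\<lambda>x. of_real ((v z x)\<^sup>2)) - (V z)\<^sup>2)"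
    by (rule order_at_0_bound[OF hU[OF Un Vn]] order_at_0_bound[OF hU[OF Un Un]] order_at_0_bound[OF hU[OF Vn Vn]],
        use ev in eventually_elim, use product_modes in \<open>simp only: real_norm_def order.trans[OF _ abs_ge_self]\<close>)+
  show "order_at_0 4 (\<lambda>z. Nu 1 z - \<i> * of_real g11 * (cnj (U z) * Hv z + cnj (V z) * Hu z))"
    by (rule order_at_0_cong[OF order_at_0_cmult[OF A(1), of "\<i> * of_real g11"]]) (simp add: Nu_def algebra_simps)
  show "order_at_0 4 (\<lambda>z. Nv 1 z - \<i> * (of_real g21 * (cnj (U z) * Hu z) + of_real g22 * (cnj (V z) * Hv z)))"
    by (rule order_at_0_cong[OF order_at_0_add[OF order_at_0_cmult[OF A(2), of "\<i> * of_real (g21 / 2)"]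
          order_at_0_cmult[OF A(3), of "\<i> * of_real (g22 / 2)"]]])
       (simp add: Nv_def algebra_simps)
  show "order_at_0 3 (\<lambda>z. Nu 2 z - 2 * \<i> * of_real g11 * (U z * V z))"
    by (rule order_at_0_cong[OF order_at_0_cmult[OF B(1), of "2 * \<i> * of_real g11"]]) (simp add: Nu_def algebra_simps)
  show "order_at_0 3 (\<lambda>z. Nv 2 z - (\<i> * of_real g21 * (U z)\<^sup>2 + \<i> * of_real g22 * (V z)\<^sup>2))"
    by (rule order_at_0_cong[OF order_at_0_add[OF order_at_0_cmult[OF B(2), of "\<i> * of_real g21"]
          order_at_0_cmult[OF B(3), of "\<i> * of_real g22"]]])
       (simp add: Nv_def algebra_simps)
qed

text \<open>The cubic part of the first component of \<open>nonlin\<close>, written in terms of \<open>H\<close>.\<close>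

definition leading :: "complex \<times> complex \<Rightarrow> complex" where
  "leading z = \<i> * of_real g11 / (p1 - p2) * (cnj (U z) * Hv z + cnj (V z) * Hu z)
    + (- (\<i> * p2 * of_real g21 / (p1 - p2))) * (cnj (U z) * Hu z)
    + (- (\<i> * p2 * of_real g22 / (p1 - p2))) * (cnj (V z) * Hv z)"

lemma nonlin_orders:
  shows "order_at_0 4 (\<lambda>z. fst (nonlin z) - leading z)" and "order_at_0 3 nonlin"
proof -
  note cmult = order_at_0_cmult
  show "order_at_0 4 (\<lambda>z. fst (nonlin z) - leading z)"
    by (rule order_at_0_cong[OF order_at_0_diff[OF cmult[OF nonlinearity_orders(1), of "1 / (p1 - p2)"]
          cmult[OF nonlinearity_orders(2), of "p2 / (p1 - p2)"]]])
       (simp add: nonlin_def leading_def divide_inverse algebra_simps)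
  have 3: "order_at_0 3 (\<lambda>z. cnj (U z) * Hv z)" "order_at_0 3 (\<lambda>z. cnj (V z) * Hu z)"
    "order_at_0 3 (\<lambda>z. cnj (U z) * Hu z)" "order_at_0 3 (\<lambda>z. cnj (V z) * Hv z)"
    using order_at_0_mult[OF critical_orders(5) critical_orders(9)] order_at_0_mult[OF critical_orders(6) critical_orders(8)]
      order_at_0_mult[OF critical_orders(5) critical_orders(8)] order_at_0_mult[OF critical_orders(6) critical_orders(9)]
    by (simp_all add: numeral_3_eq_3)
  have "order_at_0 3 (Nu 1)"
    using order_at_0_add[OF order_at_0_mono[OF nonlinearity_orders(1), of 3] cmult[OF order_at_0_add[OF 3(1,2)], of "\<i> * of_real g11"]]
    by simp
  moreover have "order_at_0 3 (Nv 1)"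
    using order_at_0_add[OF order_at_0_mono[OF nonlinearity_orders(2), of 3]
        cmult[OF order_at_0_add[OF cmult[OF 3(3), of "of_real g21"] cmult[OF 3(4), of "of_real g22"]], of "\<i>"]]
    by simp
  ultimately have "order_at_0 3 (\<lambda>z. (1 / (p1 - p2) * (Nu 1 z - p2 * Nv 1 z), 1 / (p1 - p2) * (p1 * Nv 1 z - Nu 1 z)))"
    by (intro order_at_0_Pair cmult order_at_0_diff)
  then show "order_at_0 3 nonlin"
    by (simp add: nonlin_def[abs_def])
qed

text \<open>The cubic part of the first normal form equation.\<close>

definition cubic :: "complex \<times> complex \<Rightarrow> complex" where
  "cubic z = fst z * (\<zeta> * of_real ((cmod (fst z))\<^sup>2) + \<xi> * of_real ((cmod (snd z))\<^sup>2))"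

text \<open>Each of the three factors is of order one and changes at order three, so their product changes at order five.\<close>

lemma cubic_perturbation:
  assumes Z: "order_at_0 3 (\<lambda>z. Z z - z)"
  shows "order_at_0 4 (\<lambda>z. cubic (Z z) - cubic z)"
proof -
  have d: "order_at_0 3 (\<lambda>z. fst (Z z) - fst z)" "order_at_0 3 (\<lambda>z. snd (Z z) - snd z)"
    using order_at_0_fst[OF Z] order_at_0_snd[OF Z] by simp_all
  have o: "order_at_0 1 (\<lambda>z. fst (Z z))" "order_at_0 1 (\<lambda>z. snd (Z z))"
    using order_at_0_add[OF critical_orders(1) order_at_0_mono[OF d(1), of 1]] order_at_0_add[OF critical_orders(2) order_at_0_mono[OF d(2), of 1]]
    by simp_all
  have cnj: "order_at_0 k (\<lambda>z. cnj (f z))" if "order_at_0 k f" for k and f :: "complex \<times> complex \<Rightarrow> complex"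
    by (rule order_at_0_bound[OF that]) simp
  have sq: "order_at_0 4 (\<lambda>z. f (Z z) * cnj (f (Z z)) - f z * cnj (f z))"
    "order_at_0 2 (\<lambda>z. f z * cnj (f z))"
    if "order_at_0 1 (\<lambda>z. f (Z z))" "order_at_0 1 f" "order_at_0 3 (\<lambda>z. f (Z z) - f z)"
    for f :: "complex \<times> complex \<Rightarrow> complex"
    using order_at_0_mult_diff[OF that(1) cnj[OF that(2)], of 2 f "\<lambda>z. cnj (f (Z z))"] that(3) cnj[OF that(3)]
      order_at_0_mult[OF that(2) cnj[OF that(2)]]
    by (simp_all add: numeral_eq_Suc)
  note s1 = sq[of fst, OF o(1) critical_orders(1) d(1)] and s2 = sq[of snd, OF o(2) critical_orders(2) d(2)]
  define N where "N w = \<zeta> * (fst w * cnj (fst w)) + \<xi> * (snd w * cnj (snd w))" for w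
  have "order_at_0 4 (\<lambda>z. N (Z z) - N z)"
    using order_at_0_add[OF order_at_0_cmult[OF s1(1), of \<zeta>] order_at_0_cmult[OF s2(1), of \<xi>]]
    by (simp add: N_def algebra_simps)
  moreover have "order_at_0 2 N"
    unfolding N_def[abs_def] by (intro order_at_0_add order_at_0_cmult s1(2) s2(2))
  ultimately have "order_at_0 5 (\<lambda>z. fst (Z z) * N (Z z) - fst z * N z)"
    using order_at_0_mult_diff[of 1 "\<lambda>z. fst (Z z)" 2 N 2 fst "\<lambda>z. N (Z z)"] o(1) d(1)
    by (simp add: numeral_eq_Suc)
  moreover have "cubic w = fst w * N w" for w
    by (simp only: cubic_def N_def complex_norm_square[symmetric] of_real_power)
  ultimately show ?thesis
    using order_at_0_mono[of 5 _ 4] by simp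
qed

lemma theta_flow:
  obtains K where "\<And>z0 \<tau> z. 0 < \<tau> \<Longrightarrow> solution_on_manifold a c g11 g21 g22 \<rho> h (\<delta>_crit a) {-\<tau><..<\<tau>} z \<Longrightarrow> z 0 = z0 \<Longrightarrow>
    \<exists>d. ((\<lambda>s. \<theta> (\<delta>_crit a, z s)) has_vector_derivative d) (at 0) \<and>
      norm (fst d - (\<i> * of_real \<omega> * fst (\<theta> (\<delta>_crit a, z0)) + cubic (\<theta> (\<delta>_crit a, z0)))) \<le> K * norm (\<theta> (\<delta>_crit a, z0)) ^ 5"
proof -
  let ?\<theta> = "\<lambda>z. \<theta> (\<delta>_crit a, z)"
  obtain K where "\<forall>\<delta>\<in>ball (\<delta>_crit a) \<rho>. \<forall>r s z. solution_on_manifold a c g11 g21 g22 \<rho> h \<delta> {r<..<s} z \<longrightarrow>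
        (\<forall>t\<in>{r<..<s}. \<exists>d1 d2.
           ((\<lambda>\<tau>. \<theta> (\<delta>, z \<tau>)) has_vector_derivative (d1, d2)) (at t) \<and>
           (let Z1 = fst (\<theta> (\<delta>, z t)); Z2 = snd (\<theta> (\<delta>, z t));
                R = \<bar>\<delta> - \<delta>_crit a\<bar> * norm (Z1, Z2) ^ 3 + norm (Z1, Z2) ^ 5
            in norm (d1 - (beta1 a c \<delta> * Z1
                   + Z1 * (\<zeta> * of_real ((cmod Z1)\<^sup>2) + \<xi> * of_real ((cmod Z2)\<^sup>2)))) \<le> K * R \<and>
               norm (d2 - (beta2 a c \<delta> * Z2
                   + Z2 * (cnj \<xi> * of_real ((cmod Z1)\<^sup>2) + cnj \<zeta> * of_real ((cmod Z2)\<^sup>2)))) \<le> K * R))"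
    using nf unfolding O2_Hopf_normal_form_def by blast
  from this[rule_format, of "\<delta>_crit a"] rho
  have K: "\<exists>d1 d2. ((\<lambda>\<tau>. ?\<theta> (z \<tau>)) has_vector_derivative (d1, d2)) (at t) \<and>
           (let Z1 = fst (?\<theta> (z t)); Z2 = snd (?\<theta> (z t));
                R = \<bar>\<delta>_crit a - \<delta>_crit a\<bar> * norm (Z1, Z2) ^ 3 + norm (Z1, Z2) ^ 5
            in norm (d1 - (beta1 a c (\<delta>_crit a) * Z1
                   + Z1 * (\<zeta> * of_real ((cmod Z1)\<^sup>2) + \<xi> * of_real ((cmod Z2)\<^sup>2)))) \<le> K * R \<and>
               norm (d2 - (beta2 a c (\<delta>_crit a) * Z2
                   + Z2 * (cnj \<xi> * of_real ((cmod Z1)\<^sup>2) + cnj \<zeta> * of_real ((cmod Z2)\<^sup>2)))) \<le> K * R)"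
    if "solution_on_manifold a c g11 g21 g22 \<rho> h (\<delta>_crit a) {r<..<s} z" "t \<in> {r<..<s}" for r s z t
    using that centre_in_ball by blast
  show thesis
  proof (rule that[of K])
    fix z0 \<tau> z assume "0 < \<tau>" and sol: "solution_on_manifold a c g11 g21 g22 \<rho> h (\<delta>_crit a) {-\<tau><..<\<tau>} z" and "z 0 = z0"
    then obtain d1 d2 where "((\<lambda>\<tau>. ?\<theta> (z \<tau>)) has_vector_derivative (d1, d2)) (at 0)"
      "norm (d1 - (beta1 a c (\<delta>_crit a) * fst (?\<theta> z0) + cubic (?\<theta> z0))) \<le> K * norm (?\<theta> z0) ^ 5"
      using K[OF sol, of 0] unfolding Let_def cubic_def by auto
    then show "\<exists>d. ((\<lambda>s. ?\<theta> (z s)) has_vector_derivative d) (at 0) \<and>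
      norm (fst d - (\<i> * of_real \<omega> * fst (?\<theta> z0) + cubic (?\<theta> z0))) \<le> K * norm (?\<theta> z0) ^ 5"
      unfolding beta_crit \<omega>_def[symmetric] by (intro exI[of _ "(d1, d2)"]) simp
  qed
qed

text \<open>Both sides of the equations are evaluated at the initial point of a solution through \<open>z\<close>, which exists for
  every small \<open>z\<close>.  Differentiating \<open>Hu\<close>, \<open>Hv\<close>, \<open>\<theta>\<close> along it by the chain rule, and comparing with the
  derivatives prescribed by the system and the normal form, gives equations in the direction \<open>\<Lambda> z + nonlin z\<close>;
  dropping \<open>nonlin z\<close> there changes them at order four.\<close>

lemma reduced_equations:
  defines "\<Lambda> \<equiv> critical_flow \<omega>"
  obtains r C Hu' Hv' T T' where "0 < r" "0 \<le> C"
    "\<And>z. z \<in> ball 0 r \<Longrightarrow> (Hu has_derivative Hu' z) (at z)"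
    "\<And>z. z \<in> ball 0 r \<Longrightarrow> (Hv has_derivative Hv' z) (at z)"
    "\<And>z. z \<in> ball 0 r \<Longrightarrow> (T has_derivative T' z) (at z)"
    "\<And>z. z \<in> ball 0 r \<Longrightarrow> norm (Hu' z (\<Lambda> z)
        - ((- 16 * of_real a) * Hu z + (2 * \<i>) * Hv z + (2 * \<i> * of_real g11) * (U z * V z))) \<le> C * norm z ^ 3"
    "\<And>z. z \<in> ball 0 r \<Longrightarrow> norm (Hv' z (\<Lambda> z)
        - ((2 * \<i> * of_real (c\<^sup>2)) * Hu z + (4 * of_real a - 12) * Hv z + ((\<i> * of_real g21) * (U z)\<^sup>2 + (\<i> * of_real g22) * (V z)\<^sup>2))) \<le> C * norm z ^ 3"
    "\<And>z. z \<in> ball 0 r \<Longrightarrow> norm (T' z (\<Lambda> z) - (\<i> * of_real \<omega> * T z + cubic z - leading z)) \<le> C * norm z ^ 4"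
proof -
  obtain C1 r1 h' where r1: "0 < r1" "r1 \<le> \<rho>"
    and h': "\<And>z. z \<in> ball 0 r1 \<Longrightarrow> (hc has_derivative h' z) (at z)"
    and hb: "\<And>z w. z \<in> ball 0 r1 \<Longrightarrow> norm (h' z w) \<le> C1 * norm z * norm w"
    by (rule hc_C2) blast
  obtain C2 r2 t' where r2: "0 < r2" "r2 \<le> \<rho>"
    and t': "\<And>z. z \<in> ball 0 r2 \<Longrightarrow> (shift has_derivative t' z) (at z)"
    and tb: "\<And>z w. z \<in> ball 0 r2 \<Longrightarrow> norm (t' z w) \<le> C2 * norm z * norm w"
    and t3: "order_at_0 3 shift"
    by (rule theta_C2) blast
  obtain K where K: "\<And>z0 \<tau> z. 0 < \<tau> \<Longrightarrow> solution_on_manifold a c g11 g21 g22 \<rho> h (\<delta>_crit a) {-\<tau><..<\<tau>} z \<Longrightarrow> z 0 = z0 \<Longrightarrow>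
    \<exists>d. ((\<lambda>s. \<theta> (\<delta>_crit a, z s)) has_vector_derivative d) (at 0) \<and>
      norm (fst d - (\<i> * of_real \<omega> * fst (\<theta> (\<delta>_crit a, z0)) + cubic (\<theta> (\<delta>_crit a, z0)))) \<le> K * norm (\<theta> (\<delta>_crit a, z0)) ^ 5"
    by (rule theta_flow) blast
  define r0 where "r0 = min r1 r2"
  have r0: "0 < r0" using r1 r2 by (simp add: r0_def)
  have ev: "\<forall>\<^sub>F z in nhds 0. z \<in> ball (0 :: complex \<times> complex) r0" by (rule eventually_in_ball[OF r0])
  define Hu' where "Hu' z w = mode_u 2 (h' z w)" for z w
  define Hv' where "Hv' z w = mode_v 2 (h' z w)" for z w
  define T where "T z = fst (shift z)" for z
  define T' where "T' z w = fst (t' z w)" for z w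
  define Z where "Z z = \<theta> (\<delta>_crit a, z)" for z
  have Z: "Z z = z + shift z" for z by (simp add: Z_def shift_def)
  have dHu: "(Hu has_derivative Hu' z) (at z)" and dHv: "(Hv has_derivative Hv' z) (at z)"
    and dT: "(T has_derivative T' z) (at z)" if "z \<in> ball 0 r0" for z
  proof -
    have "z \<in> ball 0 r1" "z \<in> ball 0 r2" using that by (simp_all add: r0_def)
    then show "(Hu has_derivative Hu' z) (at z)" "(Hv has_derivative Hv' z) (at z)" "(T has_derivative T' z) (at z)"
      using bounded_linear.has_derivative[OF mode_linear(1) h'] bounded_linear.has_derivative[OF mode_linear(2) h']
        bounded_linear.has_derivative[OF bounded_linear_fst t']
      by (simp_all add: Hu_def[abs_def] Hv_def[abs_def] T_def[abs_def] Hu'_def[abs_def] Hv'_def[abs_def] T'_def[abs_def])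
  qed
  have lin: "linear (Hu' z)" "linear (Hv' z)" "linear (T' z)" if "z \<in> ball 0 r0" for z
    using dHu[OF that] dHv[OF that] dT[OF that] by (auto dest: has_derivative_linear)
  have eqs: "Hu' z (\<Lambda> z + nonlin z) = - 16 * of_real a * Hu z + 2 * \<i> * Hv z + Nu 2 z \<and>
      Hv' z (\<Lambda> z + nonlin z) = 2 * \<i> * of_real (c\<^sup>2) * Hu z + (4 * of_real a - 12) * Hv z + Nv 2 z \<and>
      norm (T' z (\<Lambda> z + nonlin z) + fst (\<Lambda> z + nonlin z) - (\<i> * of_real \<omega> * fst (Z z) + cubic (Z z))) \<le> K * norm (Z z) ^ 5"
    if z: "z \<in> ball 0 r0" for z
  proof -
    have "z \<in> ball 0 \<rho>" using z r1 by (simp add: r0_def)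
    then obtain \<tau> y where y: "0 < \<tau>" "y 0 = z" "solution_on_manifold a c g11 g21 g22 \<rho> h (\<delta>_crit a) {-\<tau><..<\<tau>} y"
      "(y has_vector_derivative \<Lambda> z + nonlin z) (at 0)"
      "((\<lambda>s. Hu (y s)) has_vector_derivative - 16 * of_real a * Hu z + 2 * \<i> * Hv z + Nu 2 z) (at 0)"
      "((\<lambda>s. Hv (y s)) has_vector_derivative 2 * \<i> * of_real (c\<^sup>2) * Hu z + (4 * of_real a - 12) * Hv z + Nv 2 z) (at 0)"
      unfolding \<Lambda>_def by (rule flow_on_manifold)
    obtain d where d: "((\<lambda>s. \<theta> (\<delta>_crit a, y s)) has_vector_derivative d) (at 0)"
      "norm (fst d - (\<i> * of_real \<omega> * fst (Z z) + cubic (Z z))) \<le> K * norm (Z z) ^ 5"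
      using K[OF y(1,3,2)] unfolding Z_def by blast
    have "(Z has_derivative (\<lambda>w. w + t' z w)) (at z)"
      unfolding Z[abs_def] using z by (intro derivative_intros t') (simp add: r0_def)
    from has_derivative_along_curve[OF this y(2,4)] d(1)
    have "d = (\<Lambda> z + nonlin z) + t' z (\<Lambda> z + nonlin z)"
      unfolding Z_def by (blast intro: vector_derivative_unique_at)
    then have "fst d = T' z (\<Lambda> z + nonlin z) + fst (\<Lambda> z + nonlin z)"
      by (simp add: T'_def)
    then show ?thesis
      using has_derivative_along_curve[OF dHu[OF z] y(2,4)] has_derivative_along_curve[OF dHv[OF z] y(2,4)] y(5,6) d(2)
      by (metis vector_derivative_unique_at)
  qed
  have hb': "\<forall>\<^sub>F z in nhds 0. \<forall>w. norm (Hu' z w) \<le> C1 * norm z * norm w"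
    "\<forall>\<^sub>F z in nhds 0. \<forall>w. norm (Hv' z w) \<le> C1 * norm z * norm w"
    "\<forall>\<^sub>F z in nhds 0. \<forall>w. norm (T' z w) \<le> C2 * norm z * norm w"
  proof -
    have T: "norm (T' z w) \<le> norm (t' z w)" for z w
      using norm_fst_le[of "fst (t' z w)" "snd (t' z w)"] by (simp add: T'_def)
    show "\<forall>\<^sub>F z in nhds 0. \<forall>w. norm (Hu' z w) \<le> C1 * norm z * norm w"
      using eventually_in_ball[OF r1(1)] by eventually_elim (unfold Hu'_def, intro allI order.trans[OF mode_bounds(1) hb])
    show "\<forall>\<^sub>F z in nhds 0. \<forall>w. norm (Hv' z w) \<le> C1 * norm z * norm w"
      using eventually_in_ball[OF r1(1)] by eventually_elim (unfold Hv'_def, intro allI order.trans[OF mode_bounds(2) hb])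
    show "\<forall>\<^sub>F z in nhds 0. \<forall>w. norm (T' z w) \<le> C2 * norm z * norm w"
      using eventually_in_ball[OF r2(1)] by eventually_elim (intro allI order.trans[OF T tb])
  qed
  have oHu: "order_at_0 3 (\<lambda>z. Hu' z (\<Lambda> z)
        - ((- 16 * of_real a) * Hu z + (2 * \<i>) * Hv z + (2 * \<i> * of_real g11) * (U z * V z)))"
  proof (rule order_at_0_cong)
    show "order_at_0 3 (\<lambda>z. (Nu 2 z - 2 * \<i> * of_real g11 * (U z * V z)) - Hu' z (nonlin z))"
      by (intro order_at_0_diff nonlinearity_orders order_at_0_mono[OF order_at_0_derivative[OF nonlin_orders(2) hb'(1)]]) simp
    show "\<forall>\<^sub>F z in nhds 0. Hu' z (\<Lambda> z)
        - ((- 16 * of_real a) * Hu z + (2 * \<i>) * Hv z + (2 * \<i> * of_real g11) * (U z * V z))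
      = (Nu 2 z - 2 * \<i> * of_real g11 * (U z * V z)) - Hu' z (nonlin z)"
      using ev
    proof eventually_elim
      case (elim z)
      then show ?case
        using eqs[OF elim] linear_add[OF lin(1)[OF elim], of "\<Lambda> z" "nonlin z"] by (simp add: algebra_simps)
    qed
  qed
  have oHv: "order_at_0 3 (\<lambda>z. Hv' z (\<Lambda> z)
        - ((2 * \<i> * of_real (c\<^sup>2)) * Hu z + (4 * of_real a - 12) * Hv z + ((\<i> * of_real g21) * (U z)\<^sup>2 + (\<i> * of_real g22) * (V z)\<^sup>2)))"
  proof (rule order_at_0_cong)
    show "order_at_0 3 (\<lambda>z. (Nv 2 z - (\<i> * of_real g21 * (U z)\<^sup>2 + \<i> * of_real g22 * (V z)\<^sup>2)) - Hv' z (nonlin z))"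
      by (intro order_at_0_diff nonlinearity_orders order_at_0_mono[OF order_at_0_derivative[OF nonlin_orders(2) hb'(2)]]) simp
    show "\<forall>\<^sub>F z in nhds 0. Hv' z (\<Lambda> z)
        - ((2 * \<i> * of_real (c\<^sup>2)) * Hu z + (4 * of_real a - 12) * Hv z + ((\<i> * of_real g21) * (U z)\<^sup>2 + (\<i> * of_real g22) * (V z)\<^sup>2))
      = (Nv 2 z - (\<i> * of_real g21 * (U z)\<^sup>2 + \<i> * of_real g22 * (V z)\<^sup>2)) - Hv' z (nonlin z)"
      using ev
    proof eventually_elim
      case (elim z)
      then show ?case
        using eqs[OF elim] linear_add[OF lin(2)[OF elim], of "\<Lambda> z" "nonlin z"] by (simp add: algebra_simps)
    qed
  qed
  define err where "err z = T' z (\<Lambda> z + nonlin z) + fst (\<Lambda> z + nonlin z) - (\<i> * of_real \<omega> * fst (Z z) + cubic (Z z))" for z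
  have "order_at_0 1 Z"
    unfolding Z[abs_def] by (rule order_at_0_add[OF order_at_0_linear[OF bounded_linear_ident] order_at_0_mono[OF t3]]) simp
  then have "order_at_0 1 (\<lambda>z. norm (Z z))"
    by (rule order_at_0_bound) simp
  then have "order_at_0 5 (\<lambda>z. K * norm (Z z) ^ 5)"
    by (intro order_at_0_cmult order_at_0_power)
  moreover have "\<forall>\<^sub>F z in nhds 0. norm (err z) \<le> norm (K * norm (Z z) ^ 5)"
    using ev by eventually_elim (use eqs in \<open>force simp: err_def intro: order.trans[OF _ abs_ge_self]\<close>)
  ultimately have err: "order_at_0 4 err"
    using order_at_0_bound order_at_0_mono[of 5 err 4] by force
  have oT: "order_at_0 4 (\<lambda>z. T' z (\<Lambda> z) - (\<i> * of_real \<omega> * T z + cubic z - leading z))"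
  proof (rule order_at_0_cong)
    show "order_at_0 4 (\<lambda>z. err z - (fst (nonlin z) - leading z) + (cubic (Z z) - cubic z) - T' z (nonlin z))"
      using order_at_0_derivative[OF nonlin_orders(2) hb'(3)] t3
      by (intro order_at_0_diff[OF order_at_0_add[OF order_at_0_diff[OF err nonlin_orders(1)] cubic_perturbation]])
         (simp_all add: Z)
    show "\<forall>\<^sub>F z in nhds 0. T' z (\<Lambda> z) - (\<i> * of_real \<omega> * T z + cubic z - leading z)
      = err z - (fst (nonlin z) - leading z) + (cubic (Z z) - cubic z) - T' z (nonlin z)"
      using ev
    proof eventually_elim
      case (elim z)
      then show ?case
        using linear_add[OF lin(3)[OF elim], of "\<Lambda> z" "nonlin z"]
        by (simp add: err_def T_def Z[of z] \<Lambda>_def critical_flow_def algebra_simps)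
    qed
  qed
  obtain A1 A2 A3 where A: "0 \<le> A1" "0 \<le> A2" "0 \<le> A3"
    and "\<forall>\<^sub>F z in nhds 0. norm (Hu' z (\<Lambda> z)
        - ((- 16 * of_real a) * Hu z + (2 * \<i>) * Hv z + (2 * \<i> * of_real g11) * (U z * V z))) \<le> A1 * norm z ^ 3"
     "\<forall>\<^sub>F z in nhds 0. norm (Hv' z (\<Lambda> z)
        - ((2 * \<i> * of_real (c\<^sup>2)) * Hu z + (4 * of_real a - 12) * Hv z + ((\<i> * of_real g21) * (U z)\<^sup>2 + (\<i> * of_real g22) * (V z)\<^sup>2))) \<le> A2 * norm z ^ 3"
     "\<forall>\<^sub>F z in nhds 0. norm (T' z (\<Lambda> z) - (\<i> * of_real \<omega> * T z + cubic z - leading z)) \<le> A3 * norm z ^ 4"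
    using oHu oHv oT unfolding order_at_0_def by blast
  from eventually_conj[OF ev eventually_conj[OF this(4) eventually_conj[OF this(5,6)]]]
  obtain r where "0 < r" and r: "\<And>z. dist z 0 < r \<Longrightarrow> z \<in> ball 0 r0 \<and>
     norm (Hu' z (\<Lambda> z)
        - ((- 16 * of_real a) * Hu z + (2 * \<i>) * Hv z + (2 * \<i> * of_real g11) * (U z * V z))) \<le> A1 * norm z ^ 3 \<and>
     norm (Hv' z (\<Lambda> z)
        - ((2 * \<i> * of_real (c\<^sup>2)) * Hu z + (4 * of_real a - 12) * Hv z + ((\<i> * of_real g21) * (U z)\<^sup>2 + (\<i> * of_real g22) * (V z)\<^sup>2))) \<le> A2 * norm z ^ 3 \<and>
     norm (T' z (\<Lambda> z) - (\<i> * of_real \<omega> * T z + cubic z - leading z)) \<le> A3 * norm z ^ 4"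
    unfolding eventually_nhds_metric by blast
  have up: "x \<le> (A1 + A2 + A3) * norm z ^ k" if "x \<le> B * norm z ^ k" "B \<in> {A1, A2, A3}" for x B k and z :: "complex \<times> complex"
    using that A by (auto intro: order.trans[OF that(1) mult_right_mono])
  show thesis
  proof (rule that[of r "A1 + A2 + A3" Hu' Hv' T T'])
    show "0 < r" by fact
    show "0 \<le> A1 + A2 + A3" using A by simp
  next
    fix z :: "complex \<times> complex" assume "z \<in> ball 0 r"
    then have z: "dist z 0 < r" by (simp add: dist_commute)
    show "(Hu has_derivative Hu' z) (at z)" "(Hv has_derivative Hv' z) (at z)" "(T has_derivative T' z) (at z)"
      using dHu dHv dT r[OF z] by blast+
    show "norm (Hu' z (\<Lambda> z)
        - ((- 16 * of_real a) * Hu z + (2 * \<i>) * Hv z + (2 * \<i> * of_real g11) * (U z * V z))) \<le> (A1 + A2 + A3) * norm z ^ 3"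
      using r[OF z] by (intro up[of _ A1]) auto
    show "norm (Hv' z (\<Lambda> z)
        - ((2 * \<i> * of_real (c\<^sup>2)) * Hu z + (4 * of_real a - 12) * Hv z + ((\<i> * of_real g21) * (U z)\<^sup>2 + (\<i> * of_real g22) * (V z)\<^sup>2))) \<le> (A1 + A2 + A3) * norm z ^ 3"
      using r[OF z] by (intro up[of _ A2]) auto
    show "norm (T' z (\<Lambda> z) - (\<i> * of_real \<omega> * T z + cubic z - leading z)) \<le> (A1 + A2 + A3) * norm z ^ 4"
      using r[OF z] by (intro up[of _ A3]) auto
  qed
qed

end

section \<open>The coefficients\<close>

text \<open>The identity behind \<open>Re \<zeta>\<close>, cleared of denominators: \<open>C\<close> stands for \<open>c\<^sup>2\<close>, \<open>P1\<close>, \<open>P2\<close>, \<open>Q\<close> for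
  \<open>c\<^sup>2\<close> times \<open>p1\<close>, \<open>p2\<close> and \<open>cnj p1\<close>, and the last factor is the conjugate of the determinant at \<open>n = 2\<close>.\<close>

lemma zeta_polynomial:
  fixes a w C g11 g21 g22 :: real
  assumes C: "C = a\<^sup>2 + w\<^sup>2"
  defines "P1 \<equiv> Complex w a" and "P2 \<equiv> Complex (- w) a" and "Q \<equiv> Complex w (- a)"
  defines "F1 \<equiv> Complex 0 (2 * g11 * C) * P1" and "F2 \<equiv> \<i> * (of_real g21 * (P1 * P1) + of_real (g22 * C * C))"
  defines "X \<equiv> Complex (12 - 4 * a) (2 * w) * F1 + 2 * \<i> * F2"
    and "Y \<equiv> Complex (16 * a) (2 * w) * F2 + Complex 0 (2 * C) * F1"
  shows "Re (\<i> * (of_real g11 * (of_real C * (Q * Y) + of_real (C * C) * X) - P2 * (of_real g21 * (Q * X) + of_real (g22 * C) * Y))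
       * Complex (- 12 * a * (5 * a - 16)) (- 24 * w * (a + 1)))
     = 24 * w * C\<^sup>2 * (g11\<^sup>2 * (- 2 * C * (9 * a^3 - 72 * a\<^sup>2 + 4 * a * C + 108 * a + 4 * C))
       + g21\<^sup>2 * (- 2 * (a + 1)) + g22\<^sup>2 * (C * (63 * a^3 - 126 * a\<^sup>2 - 2 * a * C - 2 * C))
       + g11 * g21 * (a^3 + 22 * a\<^sup>2 - 8 * a * C - 168 * a - 8 * C)
       + g11 * g22 * (C * (63 * a^3 - 126 * a\<^sup>2 - 8 * a * C - 8 * C))
       + g21 * g22 * (35 * a^3 - 154 * a\<^sup>2 - 4 * a * C - 4 * C))"
proof -
  have F1: "F1 = Complex (- 2 * g11 * C * a) (2 * g11 * C * w)"
    by (simp add: F1_def P1_def complex_eq_iff)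
  have F2: "F2 = Complex (- 2 * g21 * w * a) (g21 * (w\<^sup>2 - a\<^sup>2) + g22 * C\<^sup>2)"
    by (simp add: F2_def P1_def complex_eq_iff power2_eq_square algebra_simps)
  show ?thesis
    unfolding X_def Y_def F1 F2 P2_def Q_def C
    by simp algebra
qed

context reduced_flow
begin

lemma csq_pos: "0 < c\<^sup>2"
  using a ac by simp

lemma p_explicit:
  "p1 = Complex \<omega> a / of_real (c\<^sup>2)" "p2 = Complex (- \<omega>) a / of_real (c\<^sup>2)"
proof -
  have "p1 * of_real (c\<^sup>2) = Complex \<omega> a" "p2 * of_real (c\<^sup>2) = Complex (- \<omega>) a"
    using p_eigen by (auto simp: complex_eq_iff algebra_simps)
  then show "p1 = Complex \<omega> a / of_real (c\<^sup>2)" "p2 = Complex (- \<omega>) a / of_real (c\<^sup>2)"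
    using csq_pos by (simp_all add: eq_divide_eq del: of_real_power)
qed

text \<open>The determinants of \<open>in\<omega> - M\<^sub>2\<close> for \<open>n = 0\<close> and \<open>n = 2\<close>, in the form in which \<open>resonant_coefficients\<close> produces them.\<close>

lemma determinants:
  shows "(\<i> * of_int 0 * of_real \<omega> - (- 16 * of_real a)) * (\<i> * of_int 0 * of_real \<omega> - (4 * of_real a - 12))
      - 2 * \<i> * (2 * \<i> * of_real (c\<^sup>2)) = of_real (4 * D_xi a c)"
    and "(\<i> * of_int 2 * of_real \<omega> - (- 16 * of_real a)) * (\<i> * of_int 2 * of_real \<omega> - (4 * of_real a - 12))
      - 2 * \<i> * (2 * \<i> * of_real (c\<^sup>2)) = Complex (- 12 * a * (5 * a - 16)) (24 * \<omega> * (a + 1))"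
  using omega(2) by (simp_all add: D_xi_def complex_eq_iff power2_eq_square algebra_simps)

text \<open>The outcome of the averaging for the present system, with the determinants and \<open>p1 - p2\<close> multiplied out.\<close>

lemma coefficients:
  assumes "D_xi a c \<noteq> 0"
  defines "q1 \<equiv> cnj p1" and "q2 \<equiv> cnj p2"
    and "f1 \<equiv> 2 * \<i> * of_real g11 * p1" and "f2 \<equiv> \<i> * of_real g21 * p1\<^sup>2 + \<i> * of_real g22"
    and "e1 \<equiv> 2 * \<i> * of_real g11 * (p1 + p2)" and "e2 \<equiv> 2 * (\<i> * of_real g21) * p1 * p2 + 2 * (\<i> * of_real g22)"
  defines "X \<equiv> (2 * \<i> * of_real \<omega> - 4 * of_real a + 12) * f1 + 2 * \<i> * f2"
    and "Y \<equiv> (2 * \<i> * of_real \<omega> + 16 * of_real a) * f2 + 2 * \<i> * of_real (c\<^sup>2) * f1"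
    and "X0 \<equiv> (12 - 4 * of_real a) * e1 + 2 * \<i> * e2"
    and "Y0 \<equiv> 16 * of_real a * e2 + 2 * \<i> * of_real (c\<^sup>2) * e1"
    and "S \<equiv> \<lambda>q X Y. \<i> * (of_real g11 * (q * Y + X) - p2 * (of_real g21 * q * X + of_real g22 * Y))"
  shows "\<zeta> * Complex (- 12 * a * (5 * a - 16)) (24 * \<omega> * (a + 1)) * (p1 - p2) = S q1 X Y"
    and "\<xi> * of_real (4 * D_xi a c) * (p1 - p2) = S q2 X0 Y0"
proof -
  define D2 where "D2 = Complex (- 12 * a * (5 * a - 16)) (24 * \<omega> * (a + 1))"
  define D0 where "D0 = complex_of_real (4 * D_xi a c)"
  have D: "D2 \<noteq> 0" "D0 \<noteq> 0"
    using omega(1) a assms(1) by (auto simp: D2_def D0_def complex_eq_iff)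
  obtain r C Hu' Hv' T T' where eqs: "0 < r" "0 \<le> C"
    "\<And>z. z \<in> ball 0 r \<Longrightarrow> (Hu has_derivative Hu' z) (at z)"
    "\<And>z. z \<in> ball 0 r \<Longrightarrow> (Hv has_derivative Hv' z) (at z)"
    "\<And>z. z \<in> ball 0 r \<Longrightarrow> (T has_derivative T' z) (at z)"
    "\<And>z. z \<in> ball 0 r \<Longrightarrow> norm (Hu' z (critical_flow \<omega> z)
        - ((- 16 * of_real a) * Hu z + (2 * \<i>) * Hv z + (2 * \<i> * of_real g11) * (U z * V z))) \<le> C * norm z ^ 3"
    "\<And>z. z \<in> ball 0 r \<Longrightarrow> norm (Hv' z (critical_flow \<omega> z)
        - ((2 * \<i> * of_real (c\<^sup>2)) * Hu z + (4 * of_real a - 12) * Hv z + ((\<i> * of_real g21) * (U z)\<^sup>2 + (\<i> * of_real g22) * (V z)\<^sup>2))) \<le> C * norm z ^ 3"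
    "\<And>z. z \<in> ball 0 r \<Longrightarrow> norm (T' z (critical_flow \<omega> z) - (\<i> * of_real \<omega> * T z + cubic z - leading z)) \<le> C * norm z ^ 4"
    by (rule reduced_equations) blast
  have solved: "(\<i> * of_int 2 * of_real \<omega> - (4 * of_real a - 12)) * f1 + 2 * \<i> * f2 = X"
    "(\<i> * of_int 2 * of_real \<omega> - (- 16 * of_real a)) * f2 + 2 * \<i> * of_real (c\<^sup>2) * f1 = Y"
    "(\<i> * of_int 0 * of_real \<omega> - (4 * of_real a - 12)) * e1 + 2 * \<i> * e2 = X0"
    "(\<i> * of_int 0 * of_real \<omega> - (- 16 * of_real a)) * e2 + 2 * \<i> * of_real (c\<^sup>2) * e1 = Y0"
    by (simp_all add: X_def Y_def X0_def Y0_def algebra_simps)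
  have S: "(\<i> * of_real g11 / (p1 - p2) * (q * (Y / D) + X / D) + - (\<i> * p2 * of_real g21 / (p1 - p2)) * (q * (X / D))
      + - (\<i> * p2 * of_real g22 / (p1 - p2)) * (Y / D)) * D * (p1 - p2) = S q X Y" if "D \<noteq> 0" for q X Y D
    using that p1_neq_p2 by (simp add: S_def divide_simps) (simp add: algebra_simps)
  note rc = resonant_coefficients[OF omega(1) eqs[unfolded U_def V_def leading_def cubic_def],
      unfolded determinants, folded D2_def D0_def f1_def f2_def e1_def e2_def q1_def q2_def, unfolded solved]
  have "\<zeta> * D2 * (p1 - p2) = S q1 X Y"
    by (subst rc(1), (assumption | rule D)+, rule S[OF D(1)])
  then show "\<zeta> * Complex (- 12 * a * (5 * a - 16)) (24 * \<omega> * (a + 1)) * (p1 - p2) = S q1 X Y"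
    by (simp only: D2_def)
  have "\<xi> * D0 * (p1 - p2) = S q2 X0 Y0"
    by (subst rc(2), (assumption | rule D)+, rule S[OF D(2)])
  then show "\<xi> * of_real (4 * D_xi a c) * (p1 - p2) = S q2 X0 Y0"
    by (simp only: D0_def)
qed

lemma D_zeta_cmod: "(cmod (Complex (- 12 * a * (5 * a - 16)) (24 * \<omega> * (a + 1))))\<^sup>2 = 144 * D_zeta a c"
  unfolding D_zeta_def omega(2)[symmetric] cmod_power2 by (simp add: power2_eq_square algebra_simps)

lemma Re_zeta:
  assumes "D_xi a c \<noteq> 0"
  shows "Re \<zeta> = zeta_R_formula a c g11 g21 g22"
proof -
  define D where "D = Complex (- 12 * a * (5 * a - 16)) (24 * \<omega> * (a + 1))"
  define F1 where "F1 = Complex 0 (2 * g11 * c\<^sup>2) * Complex \<omega> a"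
  define F2 where "F2 = \<i> * (of_real g21 * (Complex \<omega> a * Complex \<omega> a) + of_real (g22 * c\<^sup>2 * c\<^sup>2))"
  define X where "X = Complex (12 - 4 * a) (2 * \<omega>) * F1 + 2 * \<i> * F2"
  define Y where "Y = Complex (16 * a) (2 * \<omega>) * F2 + Complex 0 (2 * c\<^sup>2) * F1"
  define S where "S = \<i> * (of_real g11 * (of_real (c\<^sup>2) * (Complex \<omega> (- a) * Y) + of_real (c\<^sup>2 * c\<^sup>2) * X)
    - Complex (- \<omega>) a * (of_real g21 * (Complex \<omega> (- a) * X) + of_real (g22 * c\<^sup>2) * Y))"
  have cC: "c\<^sup>2 = a\<^sup>2 + \<omega>\<^sup>2" using omega(2) by simp
  \<comment> \<open>Multiplication by \<open>k\<^sup>4\<close> clears all denominators: \<open>f2\<close> is quadratic in \<open>p1\<close>, and \<open>cnj p1\<close> and \<open>p2\<close> are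
    further factors.\<close>
  define k where "k = complex_of_real (c\<^sup>2)"
  have k: "k \<noteq> 0" using csq_pos by (simp add: k_def)
  have kp: "k * p1 = Complex \<omega> a" "k * p2 = Complex (- \<omega>) a" "k * cnj p1 = Complex \<omega> (- a)"
    using k by (simp_all add: p_explicit k_def complex_cnj)
  define f1 f2 where "f1 = 2 * \<i> * of_real g11 * p1" and "f2 = \<i> * of_real g21 * p1\<^sup>2 + \<i> * of_real g22"
  have F: "k\<^sup>2 * f1 = F1" "k\<^sup>2 * f2 = F2"
  proof -
    have "F1 = 2 * \<i> * of_real g11 * k * (k * p1)"
      unfolding kp F1_def by (simp add: complex_eq_iff k_def)
    then show "k\<^sup>2 * f1 = F1" by (simp add: f1_def power2_eq_square mult_ac)
    have "F2 = \<i> * (of_real g21 * ((k * p1) * (k * p1)) + of_real g22 * k * k)"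
      unfolding kp F2_def by (simp add: k_def)
    then show "k\<^sup>2 * f2 = F2" by (simp add: f2_def power2_eq_square algebra_simps)
  qed
  define x y where "x = (2 * \<i> * of_real \<omega> - 4 * of_real a + 12) * f1 + 2 * \<i> * f2"
    and "y = (2 * \<i> * of_real \<omega> + 16 * of_real a) * f2 + 2 * \<i> * of_real (c\<^sup>2) * f1"
  have cx: "2 * \<i> * of_real \<omega> - 4 * of_real a + 12 = Complex (12 - 4 * a) (2 * \<omega>)"
    "2 * \<i> * of_real \<omega> + 16 * of_real a = Complex (16 * a) (2 * \<omega>)"
    "2 * \<i> * of_real (c\<^sup>2) = Complex 0 (2 * c\<^sup>2)"
    by (simp_all add: complex_eq_iff)
  have XY: "k\<^sup>2 * x = X" "k\<^sup>2 * y = Y"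
    unfolding X_def Y_def F[symmetric] x_def y_def cx by (simp_all add: algebra_simps)
  have "\<zeta> * D * (p1 - p2) = \<i> * (of_real g11 * (cnj p1 * y + x) - p2 * (of_real g21 * cnj p1 * x + of_real g22 * y))"
    using coefficients(1)[OF assms] by (simp only: x_def y_def f1_def f2_def D_def)
  moreover have "k * k ^ 3 * (\<i> * (of_real g11 * (cnj p1 * y + x) - p2 * (of_real g21 * cnj p1 * x + of_real g22 * y)))
     = \<i> * (of_real g11 * (k * ((k * cnj p1) * (k\<^sup>2 * y)) + (k * k) * (k\<^sup>2 * x))
          - (k * p2) * (of_real g21 * ((k * cnj p1) * (k\<^sup>2 * x)) + (of_real g22 * k) * (k\<^sup>2 * y)))"
    by (simp add: power2_eq_square power3_eq_cube algebra_simps)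
  ultimately have "k * k ^ 3 * (\<zeta> * D * (p1 - p2)) = S"
    unfolding kp XY S_def by (simp only: k_def of_real_mult)
  moreover have "k * (p1 - p2) = 2 * of_real \<omega>"
    unfolding right_diff_distrib kp by (simp add: complex_eq_iff)
  ultimately have "\<zeta> * D * (2 * of_real \<omega>) * of_real (c\<^sup>2) ^ 3 = S"
    unfolding k_def by (metis (no_types, lifting) mult.assoc mult.commute)
  then have "S * cnj D = \<zeta> * of_real ((cmod D)\<^sup>2 * (2 * \<omega> * (c\<^sup>2) ^ 3))"
    by (simp add: complex_norm_square mult_ac flip: of_real_power)
  then have "Re (S * cnj D) = Re \<zeta> * ((cmod D)\<^sup>2 * (2 * \<omega> * (c\<^sup>2) ^ 3))"
    by simp
  moreover have "cnj D = Complex (- 12 * a * (5 * a - 16)) (- 24 * \<omega> * (a + 1))"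
    by (simp add: D_def complex_cnj)
  ultimately have "Re \<zeta> * (144 * D_zeta a c * (2 * \<omega> * (c\<^sup>2) ^ 3)) = 24 * \<omega> * (c\<^sup>2)\<^sup>2 *
      (g11\<^sup>2 * (- 2 * c\<^sup>2 * (9 * a^3 - 72 * a\<^sup>2 + 4 * a * c\<^sup>2 + 108 * a + 4 * c\<^sup>2))
       + g21\<^sup>2 * (- 2 * (a + 1)) + g22\<^sup>2 * (c\<^sup>2 * (63 * a^3 - 126 * a\<^sup>2 - 2 * a * c\<^sup>2 - 2 * c\<^sup>2))
       + g11 * g21 * (a^3 + 22 * a\<^sup>2 - 8 * a * c\<^sup>2 - 168 * a - 8 * c\<^sup>2)
       + g11 * g22 * (c\<^sup>2 * (63 * a^3 - 126 * a\<^sup>2 - 8 * a * c\<^sup>2 - 8 * c\<^sup>2))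
       + g21 * g22 * (35 * a^3 - 154 * a\<^sup>2 - 4 * a * c\<^sup>2 - 4 * c\<^sup>2))" (is "_ = _ * ?N")
    using zeta_polynomial[OF cC, of g11 g21 g22] unfolding S_def X_def Y_def F1_def F2_def D_def D_zeta_cmod by simp
  then have "24 * \<omega> * (c\<^sup>2)\<^sup>2 * (Re \<zeta> * (12 * c\<^sup>2 * D_zeta a c)) = 24 * \<omega> * (c\<^sup>2)\<^sup>2 * ?N"
    by (simp add: power2_eq_square power3_eq_cube mult_ac)
  then have "Re \<zeta> * (12 * c\<^sup>2 * D_zeta a c) = ?N"
    using omega(1) csq_pos by simp
  moreover have "D_zeta a c \<noteq> 0"
  proof -
    have "0 < 4 * (a + 1)\<^sup>2 * \<omega>\<^sup>2" using a omega(1) by simp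
    then show ?thesis unfolding D_zeta_def omega(2)[symmetric] by (smt (verit) zero_le_mult_iff zero_le_power2)
  qed
  ultimately have "Re \<zeta> = ?N / (12 * c\<^sup>2 * D_zeta a c)"
    using csq_pos by (simp add: eq_divide_eq)
  moreover have "vector [g11, g21, g22] \<bullet> (N_mat a c *v vector [g11, g21, g22]) = ?N"
    unfolding N_mat_def Let_def
    by (simp add: inner_vec_def matrix_vector_mult_def sum_3 power2_eq_square field_simps)
  ultimately show ?thesis
    by (simp add: zeta_R_formula_def Let_def)
qed

lemma Re_xi:
  assumes D: "D_xi a c \<noteq> 0"
  shows "Re \<xi> = xi_R_formula a c g11 g21 g22"
proof -
  have norm_p: "\<omega>\<^sup>2 + a\<^sup>2 = c\<^sup>2" using omega(2) by simp
  have c0: "c \<noteq> 0" using csq_pos by auto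
  \<comment> \<open>The order-zero equation has real determinant; its solution is \<open>x\<close> and \<open>i y\<close>, up to that determinant.\<close>
  define e x y where "e = g22 - g21 / c\<^sup>2"
    and "x = (12 - 4 * a) * (- 4 * a * g11 / c\<^sup>2) - 4 * e"
    and "y = 8 * a * (4 * e - g11)"
  have p12: "p1 + p2 = \<i> * of_real (2 * a / c\<^sup>2)" "p1 * p2 = of_real (- 1 / c\<^sup>2)" "p2 * cnj p2 = of_real (1 / c\<^sup>2)"
    "p1 - p2 = of_real (2 * \<omega> / c\<^sup>2)"
  proof -
    have "Complex \<omega> a + Complex (- \<omega>) a = \<i> * of_real (2 * a)" "Complex \<omega> a - Complex (- \<omega>) a = of_real (2 * \<omega>)"
      "Complex \<omega> a * Complex (- \<omega>) a = - of_real (c\<^sup>2)" "Complex (- \<omega>) a * cnj (Complex (- \<omega>) a) = of_real (c\<^sup>2)"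
      using norm_p by (simp_all add: complex_eq_iff power2_eq_square)
    then show "p1 + p2 = \<i> * of_real (2 * a / c\<^sup>2)" "p1 * p2 = of_real (- 1 / c\<^sup>2)"
      "p2 * cnj p2 = of_real (1 / c\<^sup>2)" "p1 - p2 = of_real (2 * \<omega> / c\<^sup>2)"
      using c0 unfolding p_explicit add_divide_distrib[symmetric] diff_divide_distrib[symmetric] complex_cnj_divide
        complex_cnj_complex_of_real times_divide_times_eq by (simp_all only: of_real_divide) (simp_all add: divide_simps power2_eq_square power4_eq_xxxx)
  qed
  have e1: "2 * \<i> * of_real g11 * (p1 + p2) = of_real (- 4 * a * g11 / c\<^sup>2)"
    unfolding p12 by (simp add: complex_eq_iff)
  have e2: "2 * (\<i> * of_real g21) * p1 * p2 + 2 * (\<i> * of_real g22) = \<i> * of_real (2 * e)"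
    unfolding mult.assoc p12 e_def by (simp add: complex_eq_iff)
  have x: "(12 - 4 * of_real a) * of_real (- 4 * a * g11 / c\<^sup>2) + 2 * \<i> * (\<i> * of_real (2 * e)) = complex_of_real x"
    by (simp add: complex_eq_iff x_def)
  have y: "16 * of_real a * (\<i> * of_real (2 * e)) + 2 * \<i> * of_real (c\<^sup>2) * of_real (- 4 * a * g11 / c\<^sup>2) = \<i> * complex_of_real y"
    using c0 by (simp add: complex_eq_iff y_def algebra_simps)
  have "\<xi> * of_real (4 * D_xi a c * (2 * \<omega> / c\<^sup>2)) = \<i> * (of_real g11 * (cnj p2 * (\<i> * of_real y) + of_real x)
      - p2 * (of_real g21 * cnj p2 * of_real x + of_real g22 * (\<i> * of_real y)))"
    using coefficients(2)[OF D] unfolding e1 e2 x y p12(4) by (simp add: mult.assoc)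
  also have "\<dots> = - of_real (g11 * y) * cnj p2 + of_real (g22 * y) * p2
      + \<i> * (of_real (g11 * x) - of_real (g21 * x) * (p2 * cnj p2))"
    by (simp add: algebra_simps)
  also have "\<dots> = - of_real (g11 * y) * cnj p2 + of_real (g22 * y) * p2 + \<i> * of_real (g11 * x - g21 * x * (1 / c\<^sup>2))"
    unfolding p12 by (simp only: of_real_diff of_real_mult)
  finally have "Re (\<xi> * of_real (4 * D_xi a c * (2 * \<omega> / c\<^sup>2)))
      = Re (- of_real (g11 * y) * cnj p2 + of_real (g22 * y) * p2 + \<i> * of_real (g11 * x - g21 * x * (1 / c\<^sup>2)))"
    by simp
  moreover have "Re p2 = - \<omega> / c\<^sup>2"
    unfolding p_explicit by (simp only: Re_divide_of_real complex.sel)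
  ultimately have "Re \<xi> * (4 * D_xi a c * (2 * \<omega> / c\<^sup>2)) = - (g11 * y) * (- \<omega> / c\<^sup>2) + g22 * y * (- \<omega> / c\<^sup>2)"
    by simp
  then have "\<omega> / c\<^sup>2 * (Re \<xi> * (8 * D_xi a c)) = \<omega> / c\<^sup>2 * ((g11 - g22) * y)"
    using c0 by (simp add: field_simps)
  then have "Re \<xi> * (8 * D_xi a c) = (g11 - g22) * y"
    using omega(1) c0 by simp
  then have "8 * (Re \<xi> * D_xi a c) = 8 * (a * (g11 - g22) * (4 * e - g11))"
    by (simp only: y_def mult_ac)
  then have R: "Re \<xi> * D_xi a c = a * (g11 - g22) * (4 * e - g11)"
    by (simp only: mult_cancel_left) simp
  have "Re \<xi> * D_xi a c * c\<^sup>2 = a * (g11 - g22) * (4 * (e * c\<^sup>2) - g11 * c\<^sup>2)"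
    unfolding R by (simp add: algebra_simps)
  moreover have "e * c\<^sup>2 = g22 * c\<^sup>2 - g21"
    using c0 by (simp add: e_def field_simps)
  ultimately have "Re \<xi> * (c\<^sup>2 * D_xi a c) = - (a * (g11 - g22) * (c\<^sup>2 * (g11 - 4 * g22) + 4 * g21))"
    by (simp add: algebra_simps)
  then show ?thesis
    using D csq_pos by (simp add: xi_R_formula_def eq_divide_eq flip: divide_minus_left)
qed

end

text \<open>With \<open>b = a + 1\<close> the claim \<open>4 a (a + 1)\<^sup>3 / 27 \<ge> 16 a (a - 3)\<close> is \<open>b\<^sup>3 - 108 b + 432 = (b - 6)\<^sup>2 (b + 12) \<ge> 0\<close>.\<close>

lemma D_xi_pos:
  assumes "0 < a" "c\<^sup>2 > 4 * a * (a + 1) ^ 3 / 27"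
  shows "0 < D_xi a c"
proof -
  have "0 \<le> 4 * a * ((a - 5)\<^sup>2 * (a + 13))"
    using assms(1) by simp
  also have "\<dots> = 4 * a * (a + 1) ^ 3 - 27 * (16 * a * (a - 3))"
    by (simp add: power2_eq_square power3_eq_cube algebra_simps)
  finally show ?thesis
    using assms(2) by (simp add: D_xi_def field_simps)
qed

lemma O2_Hopf_coefficients_Re:
  assumes "0 < a" "a < c" "c\<^sup>2 > 4 * a * (a + 1) ^ 3 / 27" "O2_Hopf_coefficients a c g11 g21 g22 \<zeta> \<xi>"
  shows "Re \<zeta> = zeta_R_formula a c g11 g21 g22" "Re \<xi> = xi_R_formula a c g11 g21 g22"
proof -
  from assms(4) obtain \<rho> h \<theta> where "local_center_manifold a c g11 g21 g22 \<rho> h"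
    "O2_Hopf_normal_form a c g11 g21 g22 \<rho> h \<theta> \<zeta> \<xi>"
    unfolding O2_Hopf_coefficients_def by blast
  then interpret reduced_flow a c g11 g21 g22 \<rho> h \<theta> \<zeta> \<xi>
    using assms(1,2) by unfold_locales
  show "Re \<zeta> = zeta_R_formula a c g11 g21 g22" "Re \<xi> = xi_R_formula a c g11 g21 g22"
    using Re_zeta Re_xi D_xi_pos[OF assms(1,3)] by simp_all
qed

theorem mainTheorem6:
  shows "(\<forall>a c g11 g21 g22 \<zeta> \<xi>.
            0 < a \<longrightarrow> a < c \<longrightarrow> c\<^sup>2 > 4 * a * (a + 1) ^ 3 / 27 \<longrightarrow>
            O2_Hopf_coefficients a c g11 g21 g22 \<zeta> \<xi> \<longrightarrow>
            Re \<zeta> = zeta_R_formula a c g11 g21 g22 \<and> Re \<xi> = xi_R_formula a c g11 g21 g22)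
       \<and> (\<forall>R\<in>set O2_Hopf_scenarios. \<exists>g11 g22.
            (\<forall>\<zeta> \<xi>. O2_Hopf_coefficients (1/2) 1 g11 1 g22 \<zeta> \<xi> \<longrightarrow> (Re \<zeta>, Re \<xi>) \<in> R) \<and>
            (zeta_R_formula (1/2) 1 g11 1 g22, xi_R_formula (1/2) 1 g11 1 g22) \<in> R)"
proof (intro conjI allI impI)
  fix a c g11 g21 g22 \<zeta> \<xi>
  assume "0 < a" "a < c" "4 * a * (a + 1) ^ 3 / 27 < c\<^sup>2" "O2_Hopf_coefficients a c g11 g21 g22 \<zeta> \<xi>"
  then show "Re \<zeta> = zeta_R_formula a c g11 g21 g22" "Re \<xi> = xi_R_formula a c g11 g21 g22"
    by (rule O2_Hopf_coefficients_Re)+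
next
  have half: "4 * (1/2) * (1/2 + 1) ^ 3 / 27 < (1 :: real)\<^sup>2"
    by (simp add: power3_eq_cube)
  define Z X where "Z g11 g22 = zeta_R_formula (1/2) 1 g11 1 g22" and "X g11 g22 = xi_R_formula (1/2) 1 g11 1 g22" for g11 g22
  have Z: "Z g11 g22 = - (86.25 * g11\<^sup>2 + 3 + 26.625 * g22\<^sup>2 + 90.375 * g11 + 35.625 * g11 * g22 + 40.125 * g22) / 627.75" for g11 g22
    unfolding Z_def zeta_R_formula_def Let_def N_mat_def D_zeta_def
    by (simp add: inner_vec_def matrix_vector_mult_def sum_3 power2_eq_square power3_eq_cube field_simps)
  have X: "X g11 g22 = - ((g11 - g22) * (g11 - 4 * g22 + 4)) / 42" for g11 g22
    unfolding X_def xi_R_formula_def D_xi_def by (simp add: field_simps)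
  \<comment> \<open>Along \<open>g\<^sub>1\<^sub>1 = g\<^sub>2\<^sub>2\<close> the coefficient \<open>Re \<xi>\<close> vanishes, which gives the regions I and IV; the other four
    points are found by a search over small half-integers.\<close>
  have "Z (-1/2) (-1/2) + X (-1/2) (-1/2) > 0 \<and> Z (-1/2) (-1/2) - X (-1/2) (-1/2) > 0"
    "Z (-1) 0 > 0 \<and> Z (-1) 0 - X (-1) 0 < 0"
    "Z (-1) (-1/2) < 0 \<and> Z (-1) (-1/2) + X (-1) (-1/2) > 0"
    "Z 0 0 + X 0 0 < 0 \<and> Z 0 0 - X 0 0 < 0"
    "Z 0 (-2) < 0 \<and> Z 0 (-2) - X 0 (-2) > 0"
    "Z 0 (-1) > 0 \<and> Z 0 (-1) + X 0 (-1) < 0"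
    by (simp_all add: Z X power2_eq_square)
  then have "\<forall>R\<in>set O2_Hopf_scenarios. \<exists>g11 g22. (Z g11 g22, X g11 g22) \<in> R"
    unfolding O2_Hopf_scenarios_def by (simp only: list.set ball_simps mem_Collect_eq case_prod_conv) blast
  moreover have "Re \<zeta> = Z g11 g22" "Re \<xi> = X g11 g22" if "O2_Hopf_coefficients (1/2) 1 g11 1 g22 \<zeta> \<xi>" for g11 g22 \<zeta> \<xi>
    unfolding Z_def X_def using O2_Hopf_coefficients_Re[OF _ _ half that] by simp_all
  ultimately show "\<forall>R\<in>set O2_Hopf_scenarios. \<exists>g11 g22.
            (\<forall>\<zeta> \<xi>. O2_Hopf_coefficients (1/2) 1 g11 1 g22 \<zeta> \<xi> \<longrightarrow> (Re \<zeta>, Re \<xi>) \<in> R) \<and>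
            (zeta_R_formula (1/2) 1 g11 1 g22, xi_R_formula (1/2) 1 g11 1 g22) \<in> R"
    unfolding Z_def[symmetric] X_def[symmetric] by metis
qed

end
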